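(* Let $\tau\in L^1_{loc}(\mathbb{R})$ with $\operatorname{supp}\tau\subseteq[0,\infty)$ be slowly decreasing and have (improper) Laplace transform $\mathcal{L}\{\tau;s\}=\int_0^\infty\tau(x)e^{-sx}\,\mathrm{d}x$ convergent for $\Re e\, s>0$. Let $g\in L^\infty(\mathbb{R})$, $G(s)=\int_0^\infty g(x)e^{-sx}\,\mathrm{d}x$ for $\Re e\, s>0$, and $b$ a constant. Suppose that $$F(s)=\mathcal{L}\{\tau;s\}-\frac{b}{s}-\frac{G(s)}{s}$$ has local pseudofunction boundary behavior on $i(\mathbb{R}\setminus E)$, where $E\subset\mathbb{R}$ is a closed null set, and that for each $t\in E$ the function $F(s)/(s-it)$ has pseudomeasure boundary behavior at $it$. Then $\tau(x)=b+\int_0^xg(y)\,\mathrm{d}y+o(1)$ as $x\to\infty$. Conversely, if $\tau$ satisfies $\tau(x)=b+\int_0^xg(y)\,\mathrm{d}y+o(1)$, then $F$ has local pseudofunction boundary behavior on the whole line $\Re e\, s=0$.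
   Context: A real-valued $\tau$ is slowly decreasing if for each $\varepsilon>0$ there is $\delta>0$ with $\liminf_{x\to\infty}\inf_{h\in[0,\delta]}(\tau(x+h)-\tau(x))>-\varepsilon$; complex-valued: real and imaginary parts are. Fourier transform $\hat\varphi(t)=\int e^{-itx}\varphi(x)\,\mathrm{d}x$. A tempered distribution $f$ is a pseudomeasure if $\hat f\in L^\infty$, a pseudofunction if moreover $\hat f(x)\to0$ as $|x|\to\infty$; a distribution on an open $U$ is a local pseudofunction (pseudomeasure) on $U$ if near each point of $U$ it coincides with a pseudofunction (pseudomeasure). An analytic $F$ on $\Re e\, s>0$ has local pseudofunction boundary behavior on $iU$ ($U$ open) if $F(\sigma+it)$ converges in $\mathcal{D}'(U)$ as $\sigma\to0^+$ to a local pseudofunction on $U$; it has pseudomeasure boundary behavior at $it_0$ if this holds with "local pseudomeasure" for some open interval $U\ni t_0$. *)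

theory Defs
  imports "HOL-Analysis.Analysis" "HOL-Library.Extended_Real"
begin

definition slowly_decreasing_real :: "(real \<Rightarrow> real) \<Rightarrow> bool" where
  "slowly_decreasing_real \<rho> \<longleftrightarrow>
     (\<forall>\<epsilon>>0. \<exists>\<delta>>0.
        Liminf at_top (\<lambda>x. INF h\<in>{0..\<delta>}. ereal (\<rho> (x + h) - \<rho> x)) > - ereal \<epsilon>)"

definition slowly_decreasing :: "(real \<Rightarrow> complex) \<Rightarrow> bool" where
  "slowly_decreasing \<tau> \<longleftrightarrow>
     slowly_decreasing_real (\<lambda>x. Re (\<tau> x)) \<and> slowly_decreasing_real (\<lambda>x. Im (\<tau> x))"

definition smooth_fun :: "(real \<Rightarrow> complex) \<Rightarrow> bool" where
  "smooth_fun \<phi> \<longleftrightarrow>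
     (\<exists>D. D 0 = \<phi> \<and> (\<forall>n x. (D n has_vector_derivative D (Suc n) x) (at x)))"

definition test_fun_on :: "real set \<Rightarrow> (real \<Rightarrow> complex) \<Rightarrow> bool" where
  "test_fun_on U \<phi> \<longleftrightarrow> smooth_fun \<phi> \<and> compact (closure {x. \<phi> x \<noteq> 0})
      \<and> closure {x. \<phi> x \<noteq> 0} \<subseteq> U"

definition fourier :: "(real \<Rightarrow> complex) \<Rightarrow> real \<Rightarrow> complex" where
  "fourier \<phi> t = (LINT x|lborel. exp (- \<i> * of_real (t * x)) * \<phi> x)"

text \<open>Action on a test function of the tempered distribution f whose Fourier transform is
  the function h: by definition of the distributional Fourier transform,
  f(phi) = h(F^{-1} phi) = (1/(2 pi)) int h(u) hat phi(-u) du.\<close>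
definition ft_action :: "(real \<Rightarrow> complex) \<Rightarrow> (real \<Rightarrow> complex) \<Rightarrow> complex" where
  "ft_action h \<phi> = (1 / (2 * of_real pi)) * (LINT u|lborel. h u * fourier \<phi> (- u))"

text \<open>Fourier transforms of pseudomeasures (L-infinity) and pseudofunctions
  (L-infinity and tending to 0 at infinity).\<close>
definition pm_transform :: "(real \<Rightarrow> complex) \<Rightarrow> bool" where
  "pm_transform h \<longleftrightarrow> h \<in> borel_measurable lborel \<and> bounded (range h)"

definition pf_transform :: "(real \<Rightarrow> complex) \<Rightarrow> bool" where
  "pf_transform h \<longleftrightarrow> pm_transform h \<and> (h \<longlongrightarrow> 0) at_infinity"

text \<open>A distribution T on U (a functional on test functions supported in U) is locally
  (near each point of U) equal to a tempered distribution whose Fourier transform satisfies P.\<close>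
definition local_pseudo :: "((real \<Rightarrow> complex) \<Rightarrow> bool) \<Rightarrow> real set
      \<Rightarrow> ((real \<Rightarrow> complex) \<Rightarrow> complex) \<Rightarrow> bool" where
  "local_pseudo P U T \<longleftrightarrow>
     (\<forall>t0\<in>U. \<exists>V. open V \<and> t0 \<in> V \<and> V \<subseteq> U \<and>
        (\<exists>h. P h \<and> (\<forall>\<phi>. test_fun_on V \<phi> \<longrightarrow> T \<phi> = ft_action h \<phi>)))"

abbreviation "local_pseudofunction \<equiv> local_pseudo pf_transform"
abbreviation "local_pseudomeasure \<equiv> local_pseudo pm_transform"

text \<open>F(sigma + i t) converges in D'(U) as sigma -> 0+ to a distribution T with property Q.\<close>
definition boundary_behavior :: "(real set \<Rightarrow> ((real \<Rightarrow> complex) \<Rightarrow> complex) \<Rightarrow> bool)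
      \<Rightarrow> real set \<Rightarrow> (complex \<Rightarrow> complex) \<Rightarrow> bool" where
  "boundary_behavior Q U F \<longleftrightarrow>
     (\<exists>T. (\<forall>\<phi>. test_fun_on U \<phi> \<longrightarrow>
             ((\<lambda>\<sigma>. LINT t|lborel. F (Complex \<sigma> t) * \<phi> t) \<longlongrightarrow> T \<phi>) (at_right 0))
          \<and> Q U T)"

definition local_pf_boundary :: "real set \<Rightarrow> (complex \<Rightarrow> complex) \<Rightarrow> bool" where
  "local_pf_boundary U F \<longleftrightarrow> boundary_behavior local_pseudofunction U F"

definition pm_boundary_at :: "real \<Rightarrow> (complex \<Rightarrow> complex) \<Rightarrow> bool" where
  "pm_boundary_at t0 F \<longleftrightarrow>
     (\<exists>a b. a < t0 \<and> t0 < b \<and> boundary_behavior local_pseudomeasure {a<..<b} F)"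

end

theory Submission
  imports Defs "HOL-Probability.Probability" "HOL-Real_Asymp.Real_Asymp"
begin

text \<open>Subtracting \<open>b\<close> and the primitive of \<open>g\<close> leaves a slowly decreasing function \<open>\<rho>\<close> whose
  Laplace transform is \<open>F\<close>, and slow decrease makes that transform absolutely convergent. For a
  test function \<open>\<phi>\<close> the boundary values of \<open>F\<close> act on \<open>exp (i x t) \<phi>(t)\<close> as the average
  \<open>\<integral>\<rho>(u) (fourier \<phi>)(u - x) du\<close>. Pseudomeasure behavior at \<open>0\<close> bounds these averages for a positive
  kernel, which forces \<open>\<rho>\<close> to be bounded; likewise the condition at \<open>t \<in> E\<close> bounds the primitive of
  \<open>exp (- i t u) \<rho>(u)\<close>. The averages tend to \<open>0\<close> as soon as \<open>\<phi>\<close> is supported off \<open>E\<close>. On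
  the closed null set of remaining singular frequencies, Baire's theorem makes the bounds on the
  primitives uniform on a relatively open part, and cutting \<open>\<phi>\<close> into cells of mesh \<open>l\<close> shows that
  this part contributes at most a constant times the length of a small cover, so it is not singular.
  Hence all averages tend to \<open>0\<close>, and slow decrease gives \<open>\<rho> \<longlongrightarrow> 0\<close>.\<close>

section \<open>Smooth functions and test functions\<close>

text \<open>Dividing the transform by s - i t corresponds, up to a modulation, to integrating exp (-
  i t u) \<rho>(u). If that primitive is bounded by M, an average against \<phi> can be rewritten as
  an average of a bounded function against (y - t) \<phi>(y). On a cell of mesh l containing t the
  new factor is at most 2 l, while the L1 norm of the Fourier transform of a cell does not grow as l
  shrinks. So the cell costs O(M l) uniformly in x, and the number of cells times l is the length of
  a cover of a null set. The obstacle is that M depends on t, whereas summing over cells needs one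
  bound. Baire's theorem applies because for fixed x the primitive is continuous in t, so the set of
  t with bound n is closed. Boundedness of \<rho> has to come before this: it makes the averages
  absolutely convergent. Slow decrease is one-sided, so it controls averages only against a
  nonnegative kernel. In the converse direction \<rho> is small at infinity but merely integrable on
  bounded intervals. Its initial part has to be smoothed by a cutoff before a bounded transform can
  be exhibited.\<close>

fun ndiff :: "nat \<Rightarrow> (real \<Rightarrow> 'a::real_normed_vector) \<Rightarrow> bool" where
  "ndiff 0 f = True"
| "ndiff (Suc n) f = (\<exists>f'. (\<forall>x. (f has_vector_derivative f' x) (at x)) \<and> ndiff n f')"

lemma ndiff_Suc_imp: "ndiff (Suc n) f \<Longrightarrow> ndiff n f"
proof (induction n arbitrary: f)
  case (Suc n)
  then obtain f' where "\<forall>x. (f has_vector_derivative f' x) (at x)" "ndiff (Suc n) f'"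
    using ndiff.simps(2)[of "Suc n" f] by blast
  then show ?case using Suc.IH[of f'] ndiff.simps(2)[of n f] by blast
qed simp

lemma ndiff_add: "ndiff n f \<Longrightarrow> ndiff n g \<Longrightarrow> ndiff n (\<lambda>x. f x + g x)"
proof (induction n arbitrary: f g)
  case (Suc n)
  from Suc.prems obtain f' g' where "\<forall>x. (f has_vector_derivative f' x) (at x)" "ndiff n f'"
    "\<forall>x. (g has_vector_derivative g' x) (at x)" "ndiff n g'" by auto
  then show ?case using Suc.IH[of f' g'] 
    by (auto intro!: exI[of _ "\<lambda>x. f' x + g' x"] has_vector_derivative_add)
qed simp

lemma ndiff_mult:
  fixes f g :: "real \<Rightarrow> 'a::real_normed_algebra"
  shows "ndiff n f \<Longrightarrow> ndiff n g \<Longrightarrow> ndiff n (\<lambda>x. f x * g x)"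
proof (induction n arbitrary: f g)
  case (Suc n)
  have n: "ndiff n f" "ndiff n g" using Suc.prems by (auto intro: ndiff_Suc_imp simp del: ndiff.simps)
  from Suc.prems obtain f' g' where d: "\<forall>x. (f has_vector_derivative f' x) (at x)" "ndiff n f'"
    "\<forall>x. (g has_vector_derivative g' x) (at x)" "ndiff n g'" by auto
  have "ndiff n (\<lambda>x. f x * g' x + f' x * g x)"
    using Suc.IH n d by (intro ndiff_add) auto
  moreover have "\<forall>x. ((\<lambda>x. f x * g x) has_vector_derivative f x * g' x + f' x * g x) (at x)"
    using d by (auto intro!: has_vector_derivative_mult)
  ultimately show ?case by auto
qed simp

lemma ndiff_const: "ndiff n (\<lambda>x. c)"
  by (induction n arbitrary: c) (auto intro!: exI[of _ "\<lambda>x. 0"] has_vector_derivative_const)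

text \<open>The derivative of 1 / g is - (1 / g) g' (1 / g). It involves only g' and 1 / g itself,
  so order n for 1 / g yields order n + 1.\<close>

lemma ndiff_inverse:
  fixes g :: "real \<Rightarrow> 'a::real_normed_field"
  assumes "\<And>x. g x \<noteq> 0"
  shows "ndiff n g \<Longrightarrow> ndiff n (\<lambda>x. inverse (g x))"
proof (induction n)
  case (Suc n)
  have IH: "ndiff n (\<lambda>x. inverse (g x))" using Suc ndiff_Suc_imp by blast
  from Suc.prems obtain g' where d: "\<forall>x. (g has_vector_derivative g' x) (at x)" "ndiff n g'" by auto
  have "ndiff n (\<lambda>x. (- 1) * (inverse (g x) * g' x * inverse (g x)))"
    by (intro ndiff_mult ndiff_const IH d)
  moreover have "((\<lambda>x. inverse (g x)) has_vector_derivative (- 1) * (inverse (g x) * g' x * inverse (g x))) (at x)" for x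
    using Deriv.has_derivative_inverse[OF assms[of x] d(1)[rule_format, of x, unfolded has_vector_derivative_def]]
    unfolding has_vector_derivative_def by simp
  ultimately show ?case
    by (auto intro!: exI[of _ "\<lambda>x. (- 1) * (inverse (g x) * g' x * inverse (g x))"] simp del: mult_minus_left mult_minus1)
qed simp

lemma ndiff_affine:
  "ndiff n f \<Longrightarrow> ndiff n (\<lambda>x. f (c * x + d))"
proof (induction n arbitrary: f)
  case (Suc n)
  from Suc.prems obtain f' where d: "\<forall>x. (f has_vector_derivative f' x) (at x)" "ndiff n f'" by auto
  have "((\<lambda>x. f (c * x + d)) has_vector_derivative c *\<^sub>R f' (c * x + d)) (at x)" for x
  proof -
    have "((\<lambda>x. c * x + d) has_vector_derivative c) (at x)"
      by (auto intro!: derivative_eq_intros)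
    from vector_diff_chain_at[OF this d(1)[rule_format]] show ?thesis by (simp add: o_def)
  qed
  moreover have scale: "ndiff m h \<Longrightarrow> ndiff m (\<lambda>x. c *\<^sub>R h x)" for m and h :: "real \<Rightarrow> 'a"
  proof (induction m arbitrary: h)
    case (Suc m)
    then obtain h' where d: "\<forall>x. (h has_vector_derivative h' x) (at x)" "ndiff m h'" by auto
    then show ?case using Suc.IH[of h']
      by (auto intro!: exI[of _ "\<lambda>x. c *\<^sub>R h' x"] derivative_eq_intros)
  qed simp
  ultimately show ?case using Suc.IH[OF d(2)] by (auto intro!: exI[of _ "\<lambda>x. c *\<^sub>R f' (c * x + d)"])
qed simp

text \<open>\<open>smooth_fun\<close> asks for one sequence of all derivatives at once, which is
  awkward for products and reciprocals; \<open>ndiff\<close> admits induction on the order. For the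
  way back, derivatives are unique, so iterating \<open>vector_derivative\<close> gives a single
  sequence that serves every order.\<close>

lemma smooth_fun_iff_ndiff: "smooth_fun f \<longleftrightarrow> (\<forall>n. ndiff n f)"
proof
  assume "smooth_fun f"
  then obtain D where D: "D 0 = f" "\<forall>n x. (D n has_vector_derivative D (Suc n) x) (at x)"
    by (auto simp: smooth_fun_def)
  have "ndiff n (D m)" for n m
    by (induction n arbitrary: m) (use D in auto)
  then show "\<forall>n. ndiff n f" using D(1) by blast
next
  assume *: "\<forall>n. ndiff n f"
  define D where "D n = ((\<lambda>f x. vector_derivative f (at x)) ^^ n) f" for n
  have step: "(g has_vector_derivative vector_derivative g (at x)) (at x) \<and> 
      ndiff m (\<lambda>x. vector_derivative g (at x))" if "ndiff (Suc m) g" for g :: "real \<Rightarrow> complex" and m x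
  proof -
    from that obtain g' where "\<forall>x. (g has_vector_derivative g' x) (at x)" "ndiff m g'" by auto
    moreover from this have "vector_derivative g (at x) = g' x" for x
      by (simp add: vector_derivative_at)
    ultimately show ?thesis by simp
  qed
  have nD: "\<forall>m. ndiff m (D n)" for n
    by (induction n) (use * step in \<open>auto simp: D_def simp del: ndiff.simps\<close>)
  show "smooth_fun f" unfolding smooth_fun_def
    by (intro exI[of _ D]) (use nD step in \<open>auto simp: D_def simp del: ndiff.simps\<close>)
qed

lemma smooth_fun_add: "smooth_fun f \<Longrightarrow> smooth_fun g \<Longrightarrow> smooth_fun (\<lambda>x. f x + g x)"
  and smooth_fun_mult: "smooth_fun f \<Longrightarrow> smooth_fun g \<Longrightarrow> smooth_fun (\<lambda>x. f x * g x)"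
  and smooth_fun_const: "smooth_fun (\<lambda>x. c)"
  and smooth_fun_affine: "smooth_fun f \<Longrightarrow> smooth_fun (\<lambda>x. f (p * x + q))"
  by (auto simp: smooth_fun_iff_ndiff ndiff_add ndiff_mult ndiff_const ndiff_affine)

lemma smooth_fun_diff: "smooth_fun f \<Longrightarrow> smooth_fun g \<Longrightarrow> smooth_fun (\<lambda>x. f x - g x)"
  using smooth_fun_add[of f "\<lambda>x. (- 1) * g x"] smooth_fun_mult[of "\<lambda>x. - 1" g] 
  by (simp add: smooth_fun_const)

lemma smooth_fun_of_real: "smooth_fun of_real"
  unfolding smooth_fun_iff_ndiff
proof
  fix n show "ndiff n (of_real :: real \<Rightarrow> complex)"
  proof (cases n)
    case (Suc m)
    have "((of_real :: real \<Rightarrow> complex) has_vector_derivative 1) (at x)" for x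
      using has_vector_derivative_of_real[OF DERIV_ident, of "at x"] by simp
    then show ?thesis using Suc ndiff_const by (auto intro!: exI[of _ "\<lambda>x. 1"])
  qed simp
qed

lemma smooth_fun_exp: "smooth_fun (\<lambda>t. exp (\<i> * of_real (c * t)))"
  unfolding smooth_fun_def
proof (intro exI conjI allI)
  let ?D = "\<lambda>n t. (\<i> * of_real c) ^ n * exp (\<i> * of_real (c * t))"
  show "?D 0 = (\<lambda>t. exp (\<i> * of_real (c * t)))" by simp
  show "(?D n has_vector_derivative ?D (Suc n) x) (at x)" for n x
  proof -
    have "((\<lambda>z. (\<i> * of_real c) ^ n * exp (\<i> * (of_real c * z))) has_field_derivative 
        ?D (Suc n) x) (at (of_real x))"
      by (auto intro!: derivative_eq_intros simp: mult_ac)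
    from has_vector_derivative_real_field[OF this, of UNIV] show ?thesis by simp
  qed
qed

lemma smooth_fun_continuous: "smooth_fun f \<Longrightarrow> continuous_on A f"
  unfolding smooth_fun_def
  by (metis continuous_at_imp_continuous_on has_vector_derivative_continuous)

subsection \<open>A smooth step function\<close>

lemma poly_exp_tendsto_0: "((\<lambda>y::real. poly p y * exp (- y)) \<longlongrightarrow> 0) at_top"
proof -
  have "((\<lambda>y::real. y ^ i * exp (- y)) \<longlongrightarrow> 0) at_top" for i
    using tendsto_power_div_exp_0[of i] by (simp add: exp_minus divide_inverse)
  then have "((\<lambda>y::real. \<Sum>i\<le>degree p. coeff p i * (y ^ i * exp (- y))) \<longlongrightarrow> (\<Sum>i\<le>degree p. coeff p i * 0)) at_top"
    by (intro tendsto_sum tendsto_mult tendsto_const)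
  then show ?thesis by (simp add: poly_altdef sum_distrib_right mult.assoc)
qed

text \<open>The classical exp (- 1 / x), extended by 0. The polynomial in 1 / x is carried along so
  that the family is closed under differentiation.\<close>

definition flat_exp :: "real poly \<Rightarrow> real \<Rightarrow> real" where
  "flat_exp p x = (if x > 0 then poly p (inverse x) * exp (- inverse x) else 0)"

text \<open>For x > 0 the chain rule gives (1 / x)^2 (p - p')(1 / x) exp (- 1 / x), and
  \<open>[:0, 0, 1:]\<close> is the square. At 0 the right difference quotient is y p(y) exp (- y)
  with y = 1 / h, and it tends to 0 as y tends to infinity.\<close>

lemma flat_exp_deriv:
  "(flat_exp p has_vector_derivative flat_exp ([:0, 0, 1:] * (p - pderiv p)) x) (at x)"
proof -
  let ?q = "[:0, 0, 1:] * (p - pderiv p)"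
  consider "x > 0" | "x < 0" | "x = 0" by linarith
  then have "(flat_exp p has_real_derivative flat_exp ?q x) (at x)"
  proof cases
    case 1
    have "((\<lambda>x. poly p (inverse x) * exp (- inverse x)) has_real_derivative flat_exp ?q x) (at x)"
      using 1 by (auto intro!: derivative_eq_intros simp: flat_exp_def algebra_simps power2_eq_square)
    moreover have "\<forall>\<^sub>F y in nhds x. poly p (inverse y) * exp (- inverse y) = flat_exp p y"
      using eventually_nhds_in_open[of "{0<..}" x] 1 by (auto elim!: eventually_mono simp: flat_exp_def)
    ultimately show ?thesis by (subst DERIV_cong_ev[OF refl _ refl, symmetric]) auto
  next
    case 2
    have "((\<lambda>x. 0) has_real_derivative flat_exp ?q x) (at x)" using 2 by (simp add: flat_exp_def)
    moreover have "\<forall>\<^sub>F y in nhds x. 0 = flat_exp p y"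
      using eventually_nhds_in_open[of "{..<0}" x] 2 by (auto elim!: eventually_mono simp: flat_exp_def)
    ultimately show ?thesis by (subst DERIV_cong_ev[OF refl _ refl, symmetric]) auto
  next
    case 3
    have "((\<lambda>h. flat_exp p h / h) \<longlongrightarrow> 0) (at_right 0)"
    proof -
      have "((\<lambda>h::real. poly ([:0,1:] * p) (inverse h) * exp (- inverse h)) \<longlongrightarrow> 0) (at_right 0)"
        by (rule filterlim_compose[OF poly_exp_tendsto_0 filterlim_inverse_at_top_right])
      moreover have "\<forall>\<^sub>F h::real in at_right 0. poly ([:0,1:] * p) (inverse h) * exp (- inverse h) = flat_exp p h / h"
        by (auto simp: eventually_at_filter flat_exp_def field_simps)
      ultimately show ?thesis by (rule Lim_transform_eventually)
    qed
    moreover have "((\<lambda>h. flat_exp p h / h) \<longlongrightarrow> 0) (at_left 0)"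
      by (rule tendsto_eventually) (auto simp: eventually_at_filter flat_exp_def)
    ultimately show ?thesis using 3
      by (simp add: DERIV_def flat_exp_def[of _ 0] filterlim_split_at)
  qed
  then show ?thesis by (simp add: has_real_derivative_iff_has_vector_derivative)
qed

lemma ndiff_flat_exp: "ndiff n (flat_exp p)"
  by (induction n arbitrary: p) (auto intro: flat_exp_deriv)

definition step_fun :: "real \<Rightarrow> real" where
  "step_fun x = flat_exp 1 x * inverse (flat_exp 1 x + flat_exp 1 (1 - x))"

lemma step_denom_pos: "flat_exp 1 x + flat_exp 1 (1 - x) > 0"
  by (cases "x > 0"; cases "x < 1") (auto simp: flat_exp_def intro: add_pos_pos)

lemma step_fun_0: "x \<le> 0 \<Longrightarrow> step_fun x = 0"
  and step_fun_1: "x \<ge> 1 \<Longrightarrow> step_fun x = 1"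
  and step_fun_bounds: "0 \<le> step_fun x" "step_fun x \<le> 1"
  using step_denom_pos[of x] by (auto simp: step_fun_def flat_exp_def field_simps)

lemma ndiff_of_real: "ndiff n f \<Longrightarrow> ndiff n (\<lambda>x. of_real (f x) :: complex)"
proof (induction n arbitrary: f)
  case (Suc n)
  then obtain f' where d: "\<forall>x. (f has_vector_derivative f' x) (at x)" "ndiff n f'" by auto
  then show ?case using Suc.IH[of f'] has_vector_derivative_of_real
    by (auto intro!: exI[of _ "\<lambda>x. of_real (f' x)"] simp: has_real_derivative_iff_has_vector_derivative)
qed simp

lemma smooth_step: "smooth_fun (\<lambda>x. of_real (step_fun x))"
  unfolding smooth_fun_iff_ndiff
proof
  fix n
  have "ndiff n (\<lambda>x. flat_exp 1 ((-1) * x + 1))" by (intro ndiff_affine ndiff_flat_exp)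
  then have "ndiff n (\<lambda>x. flat_exp 1 x + flat_exp 1 (1 - x))" by (intro ndiff_add ndiff_flat_exp) simp
  then have "ndiff n step_fun" unfolding step_fun_def[abs_def]
    using step_denom_pos by (intro ndiff_mult ndiff_flat_exp ndiff_inverse) (auto simp: less_imp_neq[symmetric])
  then show "ndiff n (\<lambda>x. complex_of_real (step_fun x))" by (rule ndiff_of_real)
qed

text \<open>Differences of unit translates of one step telescope, so the integer translates of
  \<open>cell\<close> form a smooth partition of unity whose members live on intervals of length
  2.\<close>

definition cell :: "real \<Rightarrow> real" where
  "cell x = step_fun x - step_fun (x - 1)"

lemma smooth_cell: "smooth_fun (\<lambda>x. of_real (cell (p * x + q)))"
  using smooth_fun_affine[OF smooth_fun_diff[OF smooth_step smooth_fun_affine[OF smooth_step, of 1 "- 1"]], of p q]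
  by (simp add: cell_def)

lemma cell_eq_0: "x \<le> 0 \<or> x \<ge> 2 \<Longrightarrow> cell x = 0"
  by (auto simp: cell_def step_fun_0 step_fun_1)

lemma cell_1: "cell 1 = 1"
  by (simp add: cell_def step_fun_0 step_fun_1)

lemma sum_cell: 
  assumes "m \<le> n" "of_int m + 1 \<le> y" "y \<le> of_int n"
  shows "(\<Sum>j=m..<n. cell (y - of_int j)) = 1"
proof -
  have "(\<Sum>j=m..<n. cell (y - of_int j)) = step_fun (y - of_int m) - step_fun (y - of_int n)"
    using \<open>m \<le> n\<close>
  proof (induction n rule: int_ge_induct)
    case (step i)
    have "{m..<i + 1} = insert i {m..<i}" using step by auto
    then show ?case using step by (simp add: cell_def algebra_simps)
  qed simp
  then show ?thesis using assms by (simp add: step_fun_0 step_fun_1)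
qed

subsection \<open>Test functions\<close>

lemma test_fun_smooth: "test_fun_on U \<phi> \<Longrightarrow> smooth_fun \<phi>"
  by (simp add: test_fun_on_def)

lemma test_fun_mono: "test_fun_on U \<phi> \<Longrightarrow> U \<subseteq> V \<Longrightarrow> test_fun_on V \<phi>"
  by (auto simp: test_fun_on_def)

lemma test_fun_bounded_supportE:
  assumes "test_fun_on U \<phi>"
  obtains a where "a > 0" "\<And>x. \<bar>x\<bar> > a \<Longrightarrow> \<phi> x = 0"
proof -
  have "bounded {x. \<phi> x \<noteq> 0}" using assms unfolding test_fun_on_def
    by (meson bounded_subset closure_subset compact_imp_bounded)
  then obtain a where "\<And>x. \<phi> x \<noteq> 0 \<Longrightarrow> \<bar>x\<bar> \<le> a" by (auto simp: bounded_iff)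
  then show ?thesis using that[of "max a 1"] by fastforce
qed

lemma test_funI:
  assumes "smooth_fun \<phi>" "closed C" "C \<subseteq> U" "\<And>x. \<phi> x \<noteq> 0 \<Longrightarrow> x \<in> C" "bounded {x. \<phi> x \<noteq> 0}"
  shows "test_fun_on U \<phi>"
proof -
  have "closure {x. \<phi> x \<noteq> 0} \<subseteq> C" using assms by (intro closure_minimal) auto
  then show ?thesis using assms by (auto simp: test_fun_on_def compact_closure)
qed

text \<open>The intersection keeps both facts about the support: after multiplication by a cell the
  product still lives in \<open>U\<close>, and it is confined to the cell.\<close>

lemma test_fun_mult:
  assumes "test_fun_on U \<phi>" "smooth_fun \<theta>" "closed C" "\<And>x. \<theta> x \<noteq> 0 \<Longrightarrow> x \<in> C"
  shows "test_fun_on (U \<inter> C) (\<lambda>x. \<theta> x * \<phi> x)"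
proof -
  let ?S = "closure {x. \<phi> x \<noteq> 0}"
  have S: "compact ?S" "?S \<subseteq> U" and sm: "smooth_fun \<phi>" using assms by (auto simp: test_fun_on_def)
  have sub: "x \<in> ?S" if "\<phi> x \<noteq> 0" for x using closure_subset[of "{x. \<phi> x \<noteq> 0}"] that by blast
  have "bounded {x. \<theta> x * \<phi> x \<noteq> 0}"
    by (rule bounded_subset[OF compact_imp_bounded[OF S(1)]]) (auto intro: sub)
  then show ?thesis using S sub assms
    by (intro test_funI[where C="?S \<inter> C"] smooth_fun_mult sm) auto
qed

lemma test_fun_mult': 
  assumes "test_fun_on U \<phi>" "smooth_fun \<theta>"
  shows "test_fun_on U (\<lambda>x. \<theta> x * \<phi> x)"
  using test_fun_mult[OF assms, of UNIV] by simp

lemma test_fun_affine: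
  assumes "test_fun_on U \<phi>" "p \<noteq> 0"
  shows "test_fun_on {x. p * x + q \<in> U} (\<lambda>x. \<phi> (p * x + q))"
proof -
  let ?S = "closure {x. \<phi> x \<noteq> 0}"
  have S: "compact ?S" "?S \<subseteq> U" using assms by (auto simp: test_fun_on_def)
  let ?C = "{x. p * x + q \<in> ?S}"
  have "?C = (\<lambda>x. (x - q) / p) ` ?S"
  proof (intro set_eqI iffI)
    fix x assume "x \<in> ?C"
    then show "x \<in> (\<lambda>x. (x - q) / p) ` ?S" using assms(2) by (intro image_eqI[of _ _ "p * x + q"]) auto
  qed (use assms in auto)
  then have C: "compact ?C" using S assms(2)
    by (auto intro!: compact_continuous_image continuous_intros)
  show ?thesis
  proof (rule test_funI[where C = ?C])
    show "smooth_fun (\<lambda>x. \<phi> (p * x + q))" using assms by (intro smooth_fun_affine) (simp add: test_fun_on_def)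
    show "bounded {x. \<phi> (p * x + q) \<noteq> 0}"
      by (rule bounded_subset[OF compact_imp_bounded[OF C]]) (use closure_subset in fastforce)
  qed (use C S closure_subset[of "{x. \<phi> x \<noteq> 0}"] in \<open>auto simp: compact_imp_closed\<close>)
qed

lemma test_fun_exp:
  "test_fun_on U \<phi> \<Longrightarrow> test_fun_on U (\<lambda>t. exp (\<i> * of_real (x * t)) * \<phi> t)"
  by (intro test_fun_mult' smooth_fun_exp)

section \<open>Cutting a test function into cells of mesh \<open>l\<close>\<close>

lemma cell_decomposition:
  assumes "test_fun_on U \<phi>" "l > 0"
  obtains N :: int where "\<And>t. \<phi> t = (\<Sum>j\<in>{-N..<N}. of_real (cell (t / l - of_int j)) * \<phi> t)"
proof -
  obtain a where a: "a > 0" "\<And>x. \<bar>x\<bar> > a \<Longrightarrow> \<phi> x = 0" using test_fun_bounded_supportE assms by blast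
  \<comment> \<open>For \<bar>t\<bar> \<le> a the point t / l has to lie between - N + 1 and N, the
    range in which the cells with indices from - N to N - 1 sum to 1. This is where the additional 1
    comes from.\<close>
  define N where "N = \<lceil>a / l\<rceil> + 1"
  have N: "a / l + 1 \<le> of_int N" unfolding N_def by linarith
  have "a / l > 0" using a assms by simp
  then have N0: "N \<ge> 0" using N by linarith
  have "\<phi> t = (\<Sum>j\<in>{-N..<N}. of_real (cell (t / l - of_int j)) * \<phi> t)" for t
  proof (cases "\<bar>t\<bar> > a")
    case False
    then have "\<bar>t / l\<bar> \<le> a / l" using assms by (simp add: divide_right_mono)
    then have "(\<Sum>j=-N..<N. cell (t / l - of_int j)) = 1" 
      using N N0 by (intro sum_cell) linarith+
    then show ?thesis by (simp flip: sum_distrib_right of_real_sum)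
  qed (use a in simp)
  then show thesis by (rule that)
qed

lemma smooth_cell_scaled: "smooth_fun (\<lambda>t. of_real (cell (t / l - of_int j)))"
  using smooth_cell[of "1 / l" "- of_int j"] by simp

lemma cell_scaled_nz:
  assumes "cell (t / l - of_int j) \<noteq> 0" "l > 0"
  shows "t \<in> {of_int j * l..of_int (j + 2) * l}"
proof -
  have "0 < t / l - of_int j" "t / l - of_int j < 2" using assms(1) cell_eq_0 by (meson not_le)+
  then show ?thesis using assms(2) by (auto simp: field_simps)
qed

section \<open>Fourier transforms of test functions\<close>

lemma integrable_compact_support:
  fixes f :: "'a::euclidean_space \<Rightarrow> 'b::euclidean_space"
  assumes "continuous_on UNIV f" "compact S" "\<And>x. x \<notin> S \<Longrightarrow> f x = 0"
  shows "integrable lborel f"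
proof -
  have "integrable lborel (\<lambda>x. indicator S x *\<^sub>R f x)"
    using assms(1,2) continuous_on_subset[of UNIV f S] by (intro borel_integrable_compact) auto
  also have "(\<lambda>x. indicator S x *\<^sub>R f x) = f" using assms(3) by (auto simp: indicator_def)
  finally show ?thesis .
qed

lemma integrable_abs_support:
  fixes f :: "real \<Rightarrow> complex"
  assumes "continuous_on UNIV f" "\<And>x. \<bar>x\<bar> > a \<Longrightarrow> f x = 0"
  shows "integrable lborel f"
  using assms by (intro integrable_compact_support[of f "{-a..a}"]) auto

lemma test_fun_integrable: 
  assumes "test_fun_on U \<phi>" shows "integrable lborel \<phi>"
proof -
  obtain a where "\<And>x. \<bar>x\<bar> > a \<Longrightarrow> \<phi> x = 0" using test_fun_bounded_supportE[OF assms] by blast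
  then show ?thesis
    by (intro integrable_abs_support[of \<phi> a] smooth_fun_continuous[OF test_fun_smooth[OF assms]])
qed

lemma deriv_zero_off_support:
  fixes f :: "real \<Rightarrow> complex"
  assumes "\<And>x. (f has_vector_derivative f' x) (at x)" "\<And>x. \<bar>x\<bar> > a \<Longrightarrow> f x = 0" "\<bar>x\<bar> > a"
  shows "f' x = 0"
proof -
  have "((\<lambda>x. 0) has_vector_derivative f' x) (at x)"
    by (rule has_vector_derivative_transform_within_open[OF assms(1), of "{y. \<bar>y\<bar> > a}"])
      (use assms in \<open>auto intro!: open_Collect_less continuous_intros\<close>)
  then show ?thesis using vector_derivative_unique_at has_vector_derivative_const by blast
qed

lemma integral_deriv_compact_support:
  fixes f :: "real \<Rightarrow> complex"
  assumes d: "\<And>x. (f has_vector_derivative f' x) (at x)" and "continuous_on UNIV f'" 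
    and z: "\<And>x. \<bar>x\<bar> > a \<Longrightarrow> f x = 0" 
  shows "(LINT x|lborel. f' x) = 0"
proof -
  let ?a = "\<bar>a\<bar> + 1"
  have "(\<integral>x. indicator {- ?a .. ?a} x *\<^sub>R f' x \<partial>lborel) = f ?a - f (- ?a)"
    by (rule integral_FTC_Icc)
      (use assms continuous_on_subset[of UNIV f'] in \<open>auto intro: has_vector_derivative_at_within\<close>)
  also have "(\<lambda>x. indicator {- ?a .. ?a} x *\<^sub>R f' x) = f'"
    using deriv_zero_off_support[OF d z] by (force simp: indicator_def)
  finally show ?thesis using z by simp
qed

lemma fourier_integrable:
  assumes "integrable lborel \<phi>"
  shows "integrable lborel (\<lambda>x. exp (- \<i> * of_real (t * x)) * \<phi> x)"
proof (rule Bochner_Integration.integrable_bound[OF assms])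
  show "(\<lambda>x. exp (- \<i> * of_real (t * x)) * \<phi> x) \<in> borel_measurable lborel"
    using assms by (intro borel_measurable_times) (auto intro!: borel_measurable_continuous_onI continuous_intros)
qed (simp add: norm_mult)

lemma fourier_norm_le: "norm (fourier \<phi> t) \<le> (LINT x|lborel. norm (\<phi> x))"
  unfolding fourier_def
  by (rule order_trans[OF integral_norm_bound]) (simp add: norm_mult)

lemma fourier_continuous:
  assumes "integrable lborel \<phi>"
  shows "continuous_on A (fourier \<phi>)"
proof -
  have "isCont (fourier \<phi>) t" for t
  proof (rule continuous_at_sequentiallyI)
    fix u :: "nat \<Rightarrow> real" assume u: "u \<longlonglongrightarrow> t"
    show "(\<lambda>n. fourier \<phi> (u n)) \<longlonglongrightarrow> fourier \<phi> t"
      unfolding fourier_def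
    proof (rule integral_dominated_convergence[where w="\<lambda>x. norm (\<phi> x)"])
      show "integrable lborel (\<lambda>x. norm (\<phi> x))" using assms by simp
    qed (use fourier_integrable[OF assms] u in \<open>auto intro!: tendsto_intros AE_I2 simp: norm_mult\<close>)
  qed
  then show ?thesis by (auto intro: continuous_at_imp_continuous_on)
qed

lemma fourier_measurable: "integrable lborel \<phi> \<Longrightarrow> fourier \<phi> \<in> borel_measurable borel"
  by (intro borel_measurable_continuous_onI fourier_continuous)

text \<open>The product of exp (- i u x) and f has compact support, so its derivative integrates to
  0: integration by parts without boundary terms.\<close>

lemma fourier_deriv:
  assumes d: "\<And>x. (f has_vector_derivative f' x) (at x)" and c': "continuous_on UNIV f'" 
    and z: "\<And>x. \<bar>x\<bar> > a \<Longrightarrow> f x = 0" 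
  shows "fourier f' u = \<i> * of_real u * fourier f u"
proof -
  have c: "continuous_on UNIV f"
    using d by (intro continuous_at_imp_continuous_on) (auto intro: has_vector_derivative_continuous)
  have i: "integrable lborel f" "integrable lborel f'"
    using c c' z deriv_zero_off_support[OF d z] by (auto intro: integrable_abs_support)
  let ?e = "\<lambda>x. exp (- \<i> * of_real (u * x))"
  have e: "(?e has_vector_derivative - \<i> * of_real u * ?e x) (at x)" for x
  proof -
    have "((\<lambda>z. exp (- \<i> * (of_real u * z))) has_field_derivative - \<i> * of_real u * ?e x) (at (of_real x))"
      by (auto intro!: derivative_eq_intros)
    from has_vector_derivative_real_field[OF this, of UNIV] show ?thesis by simp
  qed
  have "(LINT x|lborel. ?e x * f' x + (- \<i> * of_real u * ?e x) * f x) = 0"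
    by (rule integral_deriv_compact_support[where f = "\<lambda>x. ?e x * f x" and a = a])
      (use z c c' has_vector_derivative_mult[OF e d] in \<open>auto intro!: continuous_intros\<close>)
  also have "(LINT x|lborel. ?e x * f' x + (- \<i> * of_real u * ?e x) * f x)
      = (LINT x|lborel. ?e x * f' x + (- \<i> * of_real u) * (?e x * f x))"
    by (simp add: mult.assoc)
  also have "\<dots> = fourier f' u + (- \<i> * of_real u) * fourier f u"
    unfolding fourier_def
    using fourier_integrable[OF i(1), of u] fourier_integrable[OF i(2), of u]
    by (subst Bochner_Integration.integral_add) auto
  finally show ?thesis by (simp add: algebra_simps)
qed

lemma norm_integral_le_length:
  fixes f :: "real \<Rightarrow> complex"
  assumes "p \<le> q" "\<And>x. x \<notin> {p..q} \<Longrightarrow> f x = 0" "\<And>x. norm (f x) \<le> A"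
  shows "norm (LINT x|lborel. f x) \<le> (q - p) * A"
proof -
  have A: "A \<ge> 0" using assms(3)[of 0] by (rule order_trans[OF norm_ge_zero])
  have "integrable lborel (\<lambda>x. A * indicator {p..q} x)"
    by (intro integrable_mult_right integrable_real_indicator) (use assms in auto)
  then have "(LINT x|lborel. norm (f x)) \<le> (LINT x|lborel. A * indicator {p..q} x)"
    by (rule Bochner_Integration.integral_mono') (use assms A in \<open>auto simp: indicator_def\<close>)
  also have "\<dots> = (q - p) * A" using assms by simp
  finally show ?thesis using integral_norm_bound[of lborel f] by linarith
qed

text \<open>Interval length times supremum bounds the transform of f and also that of f'', and the
  latter transform carries a factor u^2 in modulus. The two bounds are combined with a free weight
  l^2, to be chosen as the square of the scale on which f varies.\<close>

lemma fourier_decay: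
  assumes d: "\<And>x. (f has_vector_derivative f' x) (at x)" "\<And>x. (f' has_vector_derivative f'' x) (at x)"
    and c: "continuous_on UNIV f''" and z: "p \<le> q" "\<And>x. x \<notin> {p..q} \<Longrightarrow> f x = 0"
    and b: "\<And>x. norm (f x) \<le> A" "\<And>x. x \<in> {p..q} \<Longrightarrow> norm (f'' x) \<le> C"
  shows "norm (fourier f u) \<le> (q - p) * (A + l\<^sup>2 * C) / (1 + l\<^sup>2 * u\<^sup>2)"
proof -
  have off: "g' x = 0" if "\<And>x. (g has_vector_derivative g' x) (at x)" "\<And>x. x \<notin> {p..q} \<Longrightarrow> g x = 0" "x \<notin> {p..q}"
    for g g' :: "real \<Rightarrow> complex" and x
  proof -
    have "((\<lambda>x. 0) has_vector_derivative g' x) (at x)"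
      by (rule has_vector_derivative_transform_within_open[OF that(1), of "- {p..q}"])
        (use that in \<open>auto\<close>)
    then show ?thesis using vector_derivative_unique_at has_vector_derivative_const by blast
  qed
  have z': "f' x = 0" if "x \<notin> {p..q}" for x using off[OF d(1) z(2) that] .
  have z'': "f'' x = 0" if "x \<notin> {p..q}" for x using off[OF d(2) z' that] .
  have c': "continuous_on UNIV f'"
    using d by (intro continuous_at_imp_continuous_on) (auto intro: has_vector_derivative_continuous)
  let ?a = "max \<bar>p\<bar> \<bar>q\<bar>"
  have za: "f x = 0" "f' x = 0" if "\<bar>x\<bar> > ?a" for x using z z' that by (auto intro!: z z')
  have 1: "norm (fourier f u) \<le> (q - p) * A"
    unfolding fourier_def by (rule norm_integral_le_length) (use z b in \<open>auto simp: norm_mult\<close>)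
  have "norm (f'' x) \<le> C" for x 
  proof (cases "x \<in> {p..q}")
    case False
    have "C \<ge> 0" using b(2)[of p] z(1) by (auto intro: order_trans[OF norm_ge_zero])
    then show ?thesis using z''[OF False] by simp
  qed (use b in auto)
  then have "norm (fourier f'' u) \<le> (q - p) * C"
    unfolding fourier_def by (intro norm_integral_le_length) (use z z'' in \<open>auto simp: norm_mult\<close>)
  moreover have "fourier f'' u = (\<i> * of_real u) * ((\<i> * of_real u) * fourier f u)"
    using fourier_deriv[OF d(2) c, of ?a u] fourier_deriv[OF d(1) c', of ?a u] za by simp
  ultimately have 2: "u\<^sup>2 * norm (fourier f u) \<le> (q - p) * C"
    by (simp add: norm_mult power2_eq_square mult.assoc)
  have "l\<^sup>2 * (u\<^sup>2 * norm (fourier f u)) \<le> l\<^sup>2 * ((q - p) * C)"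
    using 2 by (rule mult_left_mono) simp
  then have "(1 + l\<^sup>2 * u\<^sup>2) * norm (fourier f u) \<le> (q - p) * (A + l\<^sup>2 * C)"
    using 1 by (simp add: algebra_simps)
  moreover have "1 + l\<^sup>2 * u\<^sup>2 > 0" by (simp add: add_pos_nonneg)
  ultimately show ?thesis by (simp add: field_simps)
qed

lemma lorentz_integral:
  assumes "l > 0"
  shows "integrable lborel (\<lambda>u. 1 / (1 + l\<^sup>2 * u\<^sup>2))" "(LINT u|lborel. 1 / (1 + l\<^sup>2 * u\<^sup>2)) = pi / l"
proof -
  have i: "integrable lborel (\<lambda>u::real. inverse (1 + u\<^sup>2))" 
    using integrable_inverse_1_plus_square by (simp add: set_integrable_def)
  have v: "(LINT u|lborel. inverse (1 + u\<^sup>2)) = pi"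
    using LBINT_inverse_1_plus_square
    by (simp add: interval_lebesgue_integral_def set_lebesgue_integral_def)
  show "integrable lborel (\<lambda>u. 1 / (1 + l\<^sup>2 * u\<^sup>2))"
    using lborel_integrable_real_affine[OF i, of l 0] assms by (simp add: power_mult_distrib inverse_eq_divide)
  show "(LINT u|lborel. 1 / (1 + l\<^sup>2 * u\<^sup>2)) = pi / l"
    using lborel_integral_real_affine[of l "\<lambda>u. inverse (1 + u\<^sup>2)" 0] v assms
    by (simp add: power_mult_distrib inverse_eq_divide field_simps)
qed

text \<open>Integrating the decay bound at scale l costs pi / l. When the interval has length of
  order l this cancels, and only A + l^2 C remains, so the L1 norm of the transform does not
  deteriorate under dilation.\<close>

lemma fourier_L1_bound:
  assumes d: "\<And>x. (f has_vector_derivative f' x) (at x)" "\<And>x. (f' has_vector_derivative f'' x) (at x)"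
    and c: "continuous_on UNIV f''" and z: "p \<le> q" "\<And>x. x \<notin> {p..q} \<Longrightarrow> f x = 0"
    and b: "\<And>x. norm (f x) \<le> A" "\<And>x. x \<in> {p..q} \<Longrightarrow> norm (f'' x) \<le> C" and l: "l > 0"
  shows "integrable lborel (fourier f)" 
    "(LINT u|lborel. norm (fourier f u)) \<le> (q - p) * (A + l\<^sup>2 * C) * pi / l"
proof -
  note dec = fourier_decay[OF d c z b, where l=l]
  let ?K = "(q - p) * (A + l\<^sup>2 * C)"
  have "continuous_on UNIV f"
    using d by (intro continuous_at_imp_continuous_on) (auto intro: has_vector_derivative_continuous)
  then have i: "integrable lborel f"
    using z by (intro integrable_compact_support[of f "{p..q}"]) auto
  have L: "integrable lborel (\<lambda>u. ?K * (1 / (1 + l\<^sup>2 * u\<^sup>2)))"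
    using lorentz_integral[OF l] by (intro integrable_mult_right) auto
  show i': "integrable lborel (fourier f)"
    by (rule Bochner_Integration.integrable_bound[OF L])
      (use fourier_measurable[OF i] in \<open>auto intro!: AE_I2 order_trans[OF dec] divide_right_mono\<close>)
  have "(LINT u|lborel. norm (fourier f u)) \<le> (LINT u|lborel. ?K * (1 / (1 + l\<^sup>2 * u\<^sup>2)))"
    by (rule integral_mono) (use dec L i' in auto)
  also have "\<dots> = ?K * (pi / l)"
    unfolding lorentz_integral(2)[OF l, symmetric] by (rule integral_mult_right_zero)
  finally show "(LINT u|lborel. norm (fourier f u)) \<le> ?K * pi / l" by simp
qed

lemma test_fun_derivs:
  assumes "test_fun_on U \<phi>"
  obtains D a M where "D 0 = \<phi>" "\<And>n x. (D n has_vector_derivative D (Suc n) x) (at x)" "a > 0"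
    "\<And>n x. \<bar>x\<bar> > a \<Longrightarrow> D n x = 0" "\<And>n. continuous_on UNIV (D n)" "\<And>n x. norm (D n x) \<le> M n" "\<And>n::nat. M n \<ge> 0"
proof -
  obtain a where a: "a > 0" "\<And>x. \<bar>x\<bar> > a \<Longrightarrow> \<phi> x = 0" using test_fun_bounded_supportE[OF assms] by blast
  obtain D where D: "D 0 = \<phi>" "\<And>n x. (D n has_vector_derivative D (Suc n) x) (at x)"
    using test_fun_smooth[OF assms] unfolding smooth_fun_def by auto
  have c: "continuous_on UNIV (D n)" for n
    by (intro continuous_at_imp_continuous_on ballI has_vector_derivative_continuous[OF D(2)])
  have z: "D n x = 0" if "\<bar>x\<bar> > a" for n x
    using that
  proof (induction n arbitrary: x)
    case (Suc n)
    show ?case using deriv_zero_off_support[of "D n" "D (Suc n)" a x, OF D(2) Suc.IH Suc.prems] by simp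
  next
    case 0
    then show ?case using a(2) D(1) by simp
  qed
  have "\<exists>M\<ge>0. \<forall>x. norm (D n x) \<le> M" for n
  proof -
    have "compact (D n ` {-a..a})" by (intro compact_continuous_image) (auto intro: continuous_on_subset[OF c])
    then obtain M where M: "M > 0" "\<And>y. y \<in> D n ` {-a..a} \<Longrightarrow> norm y \<le> M" 
      using compact_imp_bounded bounded_pos by metis
    have "norm (D n x) \<le> M" for x
    proof (cases "\<bar>x\<bar> > a")
      case True
      then show ?thesis using M(1) z[of x n] by simp
    next
      case False
      then have "x \<in> {-a..a}" by (auto simp: abs_if split: if_splits)
      then show ?thesis using M(2) by blast
    qed
    then show ?thesis using M(1) by (intro exI[of _ M]) auto
  qed
  then obtain M where M: "\<And>n. M n \<ge> 0" "\<And>n x. norm (D n x) \<le> M n" by metis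
  show thesis by (rule that[OF D a(1) z c M(2,1)])
qed

lemma fourier_test_decay:
  assumes "test_fun_on U \<phi>"
  obtains N where "N > 0" "\<And>u. norm (fourier \<phi> u) \<le> N / (1 + u\<^sup>2)"
proof -
  obtain D a M where D: "D 0 = \<phi>" "\<And>n x. (D n has_vector_derivative D (Suc n) x) (at x)" "a > 0"
    "\<And>n x. \<bar>x\<bar> > a \<Longrightarrow> D n x = 0" "\<And>n. continuous_on UNIV (D n)" "\<And>n x. norm (D n x) \<le> M n" "\<And>n::nat. M n \<ge> 0"
    using test_fun_derivs[OF assms] by blast
  let ?N = "(a - - a) * (M 0 + 1\<^sup>2 * M 2)"
  have "norm (fourier (D 0) u) \<le> ?N / (1 + 1\<^sup>2 * u\<^sup>2)" for u
  proof (rule fourier_decay[OF D(2,2) _ _ _ D(6)])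
    show "continuous_on UNIV (D (Suc (Suc 0)))" by (rule D(5))
    show "norm (D (Suc (Suc 0)) x) \<le> M 2" for x using D(6)[of 2 x] by (simp add: numeral_2_eq_2)
    show "D 0 x = 0" if "x \<notin> {- a..a}" for x using D(4)[of x 0] that by (auto simp: abs_if)
  qed (use D(3) in auto)
  then have 1: "norm (fourier \<phi> u) \<le> ?N / (1 + u\<^sup>2)" for u using D(1) by simp
  have "norm (fourier \<phi> u) \<le> (?N + 1) / (1 + u\<^sup>2)" for u
    by (rule order_trans[OF 1]) (auto intro!: divide_right_mono add_nonneg_nonneg)
  moreover have "?N + 1 > 0" using D(3,7) by (intro add_nonneg_pos mult_nonneg_nonneg) auto
  ultimately show thesis using that by blast
qed

lemma fourier_test_integrable:
  assumes "test_fun_on U \<phi>"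
  shows "integrable lborel (fourier \<phi>)"
proof -
  obtain N where N: "\<And>u. norm (fourier \<phi> u) \<le> N / (1 + u\<^sup>2)" using fourier_test_decay[OF assms] by blast
  have "integrable lborel (\<lambda>u. N * (1 / (1 + 1\<^sup>2 * u\<^sup>2)))"
    using lorentz_integral[of 1] by (intro integrable_mult_right) auto
  then show ?thesis
    by (rule Bochner_Integration.integrable_bound)
      (use fourier_measurable[OF test_fun_integrable[OF assms]] in \<open>auto intro!: AE_I2 order_trans[OF N] divide_right_mono\<close>)
qed

lemma fourier_modulate: "fourier (\<lambda>t. exp (\<i> * of_real (x * t)) * \<phi> t) u = fourier \<phi> (u - x)"
proof -
  have "exp (- \<i> * of_real (u * t)) * (exp (\<i> * of_real (x * t)) * \<phi> t) = exp (- \<i> * of_real ((u - x) * t)) * \<phi> t" for t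
    unfolding mult.assoc[symmetric] exp_add[symmetric] by (simp add: algebra_simps)
  then show ?thesis unfolding fourier_def by (simp only:)
qed

lemma fourier_dilate: 
  assumes "c > 0" shows "fourier (\<lambda>t. \<phi> (t / c)) u = of_real c * fourier \<phi> (c * u)"
  unfolding fourier_def
  using lborel_integral_real_affine[of c "\<lambda>t. exp (- \<i> * of_real (u * t)) * \<phi> (t / c)" 0] assms
  by (simp add: scaleR_conv_of_real mult.left_commute mult.commute)

lemma fourier_mult_left: "fourier (\<lambda>t. c * \<phi> t) u = c * fourier \<phi> u"
  unfolding fourier_def by (subst mult.left_commute) simp

lemma fourier_sum: 
  assumes "\<And>i. i \<in> I \<Longrightarrow> integrable lborel (f i)"
  shows "fourier (\<lambda>t. \<Sum>i\<in>I. f i t) u = (\<Sum>i\<in>I. fourier (f i) u)"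
  unfolding fourier_def sum_distrib_left
  by (rule Bochner_Integration.integral_sum) (use fourier_integrable assms in auto)

lemma test_fun_cell: "test_fun_on UNIV (\<lambda>x. of_real (cell x))"
proof (rule test_funI[where C="{0..2}"])
  show "smooth_fun (\<lambda>x. complex_of_real (cell x))" using smooth_cell[of 1 0] by simp
  show nz: "x \<in> {0..2}" if "complex_of_real (cell x) \<noteq> 0" for x
    using that cell_eq_0[of x] by (cases "x \<le> 0"; cases "x \<ge> 2") auto
  show "bounded {x. complex_of_real (cell x) \<noteq> 0}" by (rule bounded_subset[of "{0..2::real}"]) (use nz in auto)
qed auto

text \<open>The factor \<open>y - t\<close> is of size \<open>l\<close> on the cell, while two derivatives cost \<open>l\<^sup>-\<^sup>2\<close>.\<close>

lemma cell_fourier_bound: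
  assumes "test_fun_on U \<phi>"
  obtains C where "C \<ge> 0" "\<And>l j t. 0 < l \<Longrightarrow> l \<le> 1 \<Longrightarrow> t \<in> {of_int j * l..of_int (j + 2) * l} \<Longrightarrow>
    (LINT u|lborel. norm (fourier (\<lambda>y. of_real (y - t) * (of_real (cell (y / l - of_int j)) * \<phi> y)) u)) \<le> C * l"
proof -
  obtain D a M where D: "D 0 = \<phi>" "\<And>n x. (D n has_vector_derivative D (Suc n) x) (at x)" "a > 0"
    "\<And>n x. \<bar>x\<bar> > a \<Longrightarrow> D n x = 0" "\<And>n. continuous_on UNIV (D n)" "\<And>n x. norm (D n x) \<le> M n" "\<And>n::nat. M n \<ge> 0"
    using test_fun_derivs[OF assms] by blast
  obtain c b X where c: "c 0 = (\<lambda>x. complex_of_real (cell x))" "\<And>n x. (c n has_vector_derivative c (Suc n) x) (at x)" "b > 0"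
    "\<And>n x. \<bar>x\<bar> > b \<Longrightarrow> c n x = 0" "\<And>n. continuous_on UNIV (c n)" "\<And>n x. norm (c n x) \<le> X n" "\<And>n::nat. X n \<ge> 0"
    using test_fun_derivs[OF test_fun_cell] by blast
  \<comment> \<open>\<open>G0\<close>, \<open>G1\<close>, \<open>G2\<close> bound the product of the
    cell with \<phi> and its first two derivatives, once the powers 1, 1 / l and 1 / l^2 are split
    off. The assumption l \<le> 1 absorbs lower powers of 1 / l into the highest one.\<close>
  define G0 where "G0 = X 0 * M 0"
  define G1 where "G1 = X 0 * M 1 + X 1 * M 0"
  define G2 where "G2 = X 0 * M 2 + 2 * (X 1 * M 1) + X 2 * M 0"
  have G: "G0 \<ge> 0" "G1 \<ge> 0" "G2 \<ge> 0" unfolding G0_def G1_def G2_def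
    by (auto intro!: add_nonneg_nonneg mult_nonneg_nonneg D(7) c(7))
  \<comment> \<open>The interval length 2 l, the bounds 2 l \<open>G0\<close> and (2
    \<open>G2\<close> + 2 \<open>G1\<close>) / l with weight l^2, and the final factor pi / l leave
    exactly one power of l.\<close>
  let ?C = "2 * (2 * G0 + 2 * G1 + 2 * G2) * pi"
  have "(LINT u|lborel. norm (fourier (\<lambda>y. of_real (y - t) * (of_real (cell (y / l - of_int j)) * \<phi> y)) u)) \<le> ?C * l"
    if l: "0 < l" "l \<le> 1" and t: "t \<in> {of_int j * l..of_int (j + 2) * l}" for l j t
  proof -
    define k where "k n y = c n (y / l - of_int j)" for n y
    have kb: "norm (k n y) \<le> X n" for n y unfolding k_def by (rule c(6))
    have kc: "continuous_on UNIV (k n)" for n unfolding k_def[abs_def]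
      by (intro continuous_on_compose2[OF c(5)] continuous_intros) (use l in auto)
    have kd: "(k n has_vector_derivative (1 / l) *\<^sub>R k (Suc n) y) (at y)" for n y
    proof -
      have "((\<lambda>y. y / l - of_int j) has_vector_derivative 1 / l) (at y)"
        using l by (auto intro!: derivative_eq_intros)
      from vector_diff_chain_at[OF this c(2)] show ?thesis unfolding k_def[abs_def] o_def by simp
    qed
    have k0: "k 0 y = of_real (cell (y / l - of_int j))" for y by (simp add: k_def c(1))
    define L where "L = complex_of_real (1 / l)"
    have kd': "(k n has_vector_derivative L * k (Suc n) y) (at y)" for n y
      using kd[of n y] by (simp add: L_def scaleR_conv_of_real)
    have nL: "norm L = 1 / l" unfolding L_def norm_of_real using l by simp
    define f where "f y = complex_of_real (y - t) * (k 0 y * D 0 y)" for y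
    define g1 where "g1 y = k 0 y * D 1 y + L * k 1 y * D 0 y" for y
    define g2 where "g2 y = k 0 y * D 2 y + 2 * (L * k 1 y * D 1 y) + L * (L * k 2 y) * D 0 y" for y
    define f1 where "f1 y = complex_of_real (y - t) * g1 y + 1 * (k 0 y * D 0 y)" for y
    define f2 where "f2 y = complex_of_real (y - t) * g2 y + 2 * g1 y" for y
    have k1: "(k 0 has_vector_derivative L * k 1 y) (at y)" 
      and k2: "(k 1 has_vector_derivative L * k 2 y) (at y)" for y 
      using kd'[of 0] kd'[of 1] by (simp_all add: numeral_2_eq_2)
    have D1: "(D 0 has_vector_derivative D 1 y) (at y)" 
      and D2: "(D 1 has_vector_derivative D 2 y) (at y)" for y 
      using D(2)[of 0] D(2)[of 1] by (simp_all add: numeral_2_eq_2)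
    have dy: "((\<lambda>y. complex_of_real (y - t)) has_vector_derivative 1) (at y)" for y
    proof -
      have "((\<lambda>y. y - t) has_field_derivative 1) (at y)" by (auto intro!: derivative_eq_intros)
      from has_vector_derivative_of_real[OF this] show ?thesis by simp
    qed
    have dg: "((\<lambda>y. k 0 y * D 0 y) has_vector_derivative g1 y) (at y)" for y
      unfolding g1_def by (rule has_vector_derivative_mult[OF k1 D1])
    have dg1: "(g1 has_vector_derivative g2 y) (at y)" for y
    proof -
      have "(g1 has_vector_derivative (k 0 y * D 2 y + (L * k 1 y) * D 1 y) +
          ((L * k 1 y) * D 1 y + (L * (L * k 2 y)) * D 0 y)) (at y)"
        unfolding g1_def[abs_def]
        by (intro has_vector_derivative_add has_vector_derivative_mult k1 D2 D1 
            has_vector_derivative_mult_right k2)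
      then show ?thesis by (simp add: g2_def algebra_simps)
    qed
    have df: "(f has_vector_derivative f1 y) (at y)" for y
      unfolding f1_def f_def[abs_def] by (rule has_vector_derivative_mult[OF dy dg])
    have df1: "(f1 has_vector_derivative f2 y) (at y)" for y
    proof -
      have "(f1 has_vector_derivative (of_real (y - t) * g2 y + 1 * g1 y) + 1 * g1 y) (at y)"
        unfolding f1_def[abs_def]
        by (intro has_vector_derivative_add has_vector_derivative_mult dg1 dy has_vector_derivative_mult_right dg)
      then show ?thesis by (simp add: f2_def algebra_simps)
    qed
    have cf2: "continuous_on UNIV f2"
      unfolding f2_def[abs_def] g2_def g1_def by (intro continuous_intros kc D(5))
    let ?p = "of_int j * l" and ?q = "of_int (j + 2) * l"
    have pq: "?q - ?p = 2 * l" by (simp add: algebra_simps)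
    have z: "f y = 0" if "y \<notin> {?p..?q}" for y
      using cell_scaled_nz[of y l j] that l by (auto simp: f_def k0)
    have dist: "\<bar>y - t\<bar> \<le> 2 * l" if "y \<in> {?p..?q}" for y
      using that t pq by (auto simp: abs_le_iff)
    have bg0: "norm (k 0 y * D 0 y) \<le> G0" for y
      unfolding norm_mult G0_def by (intro mult_mono kb D(6) c(7)) auto
    have bg1: "norm (g1 y) \<le> G1 / l" for y
    proof -
      have "norm (g1 y) \<le> X 0 * M 1 + 1 / l * X 1 * M 0"
        unfolding g1_def
        by (rule order_trans[OF norm_triangle_ineq], unfold norm_mult nL)
          (intro add_mono mult_mono kb D(6) c(7) order_refl mult_nonneg_nonneg norm_ge_zero, use l in auto)
      also have "\<dots> \<le> 1 / l * (X 0 * M 1) + 1 / l * (X 1 * M 0)"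
        using l mult_right_mono[of 1 "1 / l" "X 0 * M 1"] c(7)[of 0] D(7)[of 1] by simp
      finally show ?thesis by (simp add: G1_def add_divide_distrib)
    qed
    have bg2: "norm (g2 y) \<le> G2 / l\<^sup>2" for y
    proof -
      have m: "norm (k n y) * norm (D i y) \<le> X n * M i" for n i
        by (intro mult_mono kb D(6) c(7) norm_ge_zero)
      have "norm (g2 y) \<le> norm (k 0 y * D 2 y) + norm (2 * (L * k 1 y * D 1 y)) + norm (L * (L * k 2 y) * D 0 y)"
        unfolding g2_def by (intro order_trans[OF norm_triangle_ineq] add_mono order_refl norm_triangle_ineq)
      also have "\<dots> = norm (k 0 y) * norm (D 2 y) + 2 * (1 / l * (norm (k 1 y) * norm (D 1 y)))
           + 1 / l * (1 / l * (norm (k 2 y) * norm (D 0 y)))"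
        unfolding norm_mult nL norm_numeral by (simp only: mult.assoc)
      also have "\<dots> \<le> X 0 * M 2 + 2 * (1 / l * (X 1 * M 1)) + 1 / l * (1 / l * (X 2 * M 0))"
        by (intro add_mono mult_left_mono m) (use l in auto)
      also have "\<dots> = X 0 * M 2 + 2 * (1 / l * X 1 * M 1) + 1 / l * (1 / l * X 2) * M 0"
        by (simp only: mult.assoc)
      also have "\<dots> \<le> 1 / l\<^sup>2 * (X 0 * M 2) + 2 * (1 / l\<^sup>2 * (X 1 * M 1)) + 1 / l\<^sup>2 * (X 2 * M 0)"
      proof -
        have 1: "1 \<le> 1 / l\<^sup>2" using l power_le_one[of l 2] by simp
        have 2: "1 / l \<le> 1 / l\<^sup>2" using l by (simp add: power2_eq_square field_simps)
        have "X 0 * M 2 \<le> 1 / l\<^sup>2 * (X 0 * M 2)"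
          using mult_right_mono[OF 1, of "X 0 * M 2"] c(7)[of 0] D(7)[of 2] by simp
        moreover have "1 / l * (X 1 * M 1) \<le> 1 / l\<^sup>2 * (X 1 * M 1)"
          by (rule mult_right_mono[OF 2]) (use c(7)[of 1] D(7)[of 1] in simp)
        moreover have "1 / l * (1 / l * X 2) * M 0 = 1 / l\<^sup>2 * (X 2 * M 0)" by (simp add: power2_eq_square)
        ultimately show ?thesis by (simp only: mult.assoc)
      qed
      finally show ?thesis by (simp add: G2_def add_divide_distrib)
    qed
    have bf: "norm (f y) \<le> 2 * l * G0" for y
    proof (cases "y \<in> {?p..?q}")
      case True
      then have "norm (f y) \<le> 2 * l * G0" unfolding f_def norm_mult[of "of_real (y - t)"]
        by (intro mult_mono bg0) (use dist[OF True] l in \<open>auto simp flip: of_real_diff\<close>)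
      then show ?thesis .
    qed (use z l G in auto)
    \<comment> \<open>Here the zero of y - t pays off: on the cell it is at most 2 l, which turns
      the l^-2 of \<open>g2\<close> into l^-1. Off the cell there is no such control, so the bound
      is stated only there.\<close>
    have bf2: "norm (f2 y) \<le> (2 * G2 + 2 * G1) / l" if y: "y \<in> {?p..?q}" for y
    proof -
      have "norm (f2 y) \<le> norm (of_real (y - t) * g2 y) + norm (2 * g1 y)"
        unfolding f2_def by (rule norm_triangle_ineq)
      also have "\<dots> \<le> 2 * l * (G2 / l\<^sup>2) + 2 * (G1 / l)"
        unfolding norm_mult norm_numeral
        by (intro add_mono mult_mono bg1 bg2 order_refl) (use dist[OF y] l in \<open>auto simp flip: of_real_diff\<close>)
      also have "\<dots> = (2 * G2 + 2 * G1) / l" using l by (simp add: field_simps power2_eq_square)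
      finally show ?thesis .
    qed
    have "(LINT u|lborel. norm (fourier f u)) \<le> (?q - ?p) * (2 * l * G0 + l\<^sup>2 * ((2 * G2 + 2 * G1) / l)) * pi / l"
      by (rule fourier_L1_bound(2)[OF df df1 cf2 _ z bf bf2 l(1)]) (use pq l in auto)
    also have "\<dots> = ?C * l" unfolding pq using l by (simp add: field_simps power2_eq_square)
    finally show ?thesis unfolding f_def[abs_def] k0 D(1) .
  qed
  moreover have "?C \<ge> 0" using G by simp
  ultimately show thesis by (intro that[of ?C])
qed

section \<open>A nonnegative kernel that is the transform of a test function near 0\<close>

lemma integral_pos_continuous:
  fixes f :: "real \<Rightarrow> real"
  assumes i: "integrable lborel f" and "continuous_on UNIV f" "\<And>x. f x \<ge> 0" "f c > 0"
  shows "(LINT x|lborel. f x) > 0"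
proof -
  have "isCont f c" using assms(2) by (simp add: continuous_on_eq_continuous_at)
  then have "\<forall>\<^sub>F x in nhds c. f x > f c / 2"
    using assms(4) by (intro order_tendstoD) (auto simp: isCont_def tendsto_at_iff_tendsto_nhds)
  then obtain d where d: "d > 0" "\<And>x. dist x c < d \<Longrightarrow> f x > f c / 2"
    unfolding eventually_nhds_metric by blast
  let ?I = "{c - d / 2..c + d / 2}"
  have iI: "integrable lborel (\<lambda>x. f c / 2 * indicator ?I x)"
    by (intro integrable_mult_right integrable_real_indicator) (use d in auto)
  have "0 < f c / 2 * d" using d assms by simp
  also have "\<dots> = (LINT x|lborel. f c / 2 * indicator ?I x)" using d by simp
  also have "\<dots> \<le> (LINT x|lborel. f x)"
  proof (rule integral_mono[OF iI i])
    show "f c / 2 * indicator ?I x \<le> f x" for x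
      using d(2)[of x] assms(3)[of x] d(1) by (cases "x \<in> ?I") (auto simp: dist_real_def abs_le_iff abs_less_iff)
  qed
  finally show ?thesis .
qed

lemma integrable_mult_prod:
  fixes f g :: "real \<Rightarrow> complex"
  assumes [measurable]: "integrable lborel f" "integrable lborel g"
  shows "integrable (lborel \<Otimes>\<^sub>M lborel) (\<lambda>(x, y). f x * g y)"
proof (rule lborel_pair.Fubini_integrable)
  show "integrable lborel (\<lambda>x. LINT y|lborel. norm (case (x, y) of (x, y) \<Rightarrow> f x * g y))"
    using assms by (simp add: norm_mult)
qed (use assms in \<open>auto simp: norm_mult\<close>)

text \<open>The kernel is the squared modulus of the Fourier transform of a cell, which is the transform of
  the autocorrelation of that cell.\<close>

lemma nonneg_kernel_exists:
  assumes "a > (0::real)"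
  obtains \<phi> K N where "test_fun_on {-a<..<a} \<phi>" "\<And>u. fourier \<phi> u = complex_of_real (K u)" "\<And>u. K u \<ge> 0"
    "continuous_on UNIV K" "\<And>u. K u \<le> N / (1 + u\<^sup>2)\<^sup>2" "K 0 > 0" "N \<ge> 0"
proof -
  \<comment> \<open>The autocorrelation of a function supported in [0, h] lives in [-h, h], and h =
    a / 2 keeps this inside the open interval.\<close>
  define h where "h = a / 2"
  have h: "h > 0" "h < a" using assms by (auto simp: h_def)
  define w where "w t = cell (2 / h * t + 0)" for t
  have w_nz: "t \<in> {0..h}" if "w t \<noteq> 0" for t
  proof -
    have "\<not> (2 / h * t + 0 \<le> 0)" "\<not> (2 / h * t + 0 \<ge> 2)" using that cell_eq_0 unfolding w_def by blast+
    then show ?thesis using h by (auto simp: field_simps zero_less_mult_iff)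
  qed
  have w0: "0 \<le> w t" for t
  proof -
    have "cell x \<ge> 0" for x
      by (cases "x \<le> 1") (use step_fun_bounds[of x] step_fun_bounds[of "x - 1"] in \<open>auto simp: cell_def step_fun_0 step_fun_1\<close>)
    then show ?thesis by (simp add: w_def)
  qed
  let ?w = "\<lambda>t. complex_of_real (w t)"
  have tw: "test_fun_on UNIV ?w"
  proof (rule test_funI[where C="{0..h}"])
    show "smooth_fun ?w" unfolding w_def by (rule smooth_cell)
    show "bounded {x. ?w x \<noteq> 0}" by (rule bounded_subset[of "{0..h}"]) (use w_nz in auto)
  qed (use w_nz in auto)
  obtain D where D: "D 0 = ?w" "\<And>n x. (D n has_vector_derivative D (Suc n) x) (at x)" 
    "\<And>n. continuous_on UNIV (D n)" 
    by (rule test_fun_derivs[OF tw]) blast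
  \<comment> \<open>All derivatives are defined at once by putting the n-th derivative of
    \<open>w\<close> under the integral; differentiation under the integral sign then links
    consecutive orders, which is the form \<open>smooth_fun\<close> asks for.\<close>
  define \<phi> where "\<phi> n t = integral (cbox 0 h) (\<lambda>s. D n (t + s) * ?w s)" for n t
  have cw: "continuous_on A ?w" for A using smooth_fun_continuous[OF test_fun_smooth[OF tw]] .
  have c2: "continuous_on A (\<lambda>p. D n (fst p + snd p) * ?w (snd p))" for n A
    by (intro continuous_intros continuous_on_compose2[OF D(3)] continuous_on_compose2[OF cw[of UNIV]]) auto
  have cs: "continuous_on A (\<lambda>s. D n (t + s) * ?w s)" for n A t
    by (intro continuous_intros continuous_on_compose2[OF D(3)] cw) auto
  have "smooth_fun (\<phi> 0)"
    unfolding smooth_fun_def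
  proof (intro exI[of _ \<phi>] conjI allI refl)
    fix n x
    show "(\<phi> n has_vector_derivative \<phi> (Suc n) x) (at x)"
      unfolding \<phi>_def
    proof (rule leibniz_rule_vector_derivative[where U=UNIV])
      show "((\<lambda>x. D n (x + t) * ?w t) has_vector_derivative D (Suc n) (x + t) * ?w t) (at x within UNIV)" for x t
      proof -
        have "((\<lambda>x. x + t) has_vector_derivative 1) (at x)" by (auto intro!: derivative_eq_intros)
        from vector_diff_chain_at[OF this D(2)] have "((\<lambda>x. D n (x + t)) has_vector_derivative D (Suc n) (x + t)) (at x)"
          by (simp add: o_def)
        then show ?thesis by (rule has_vector_derivative_mult_left)
      qed
      show "(\<lambda>s. D n (x + s) * ?w s) integrable_on cbox 0 h" for x
        by (rule integrable_continuous[OF cs])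
      show "continuous_on (UNIV \<times> cbox 0 h) (\<lambda>(x, t). D (Suc n) (x + t) * ?w t)"
        using c2[of _ "Suc n"] by (simp add: split_def)
    qed auto
  qed
  moreover have z\<phi>: "t \<in> {-h..h}" if "\<phi> 0 t \<noteq> 0" for t
  proof (rule ccontr)
    assume "t \<notin> {-h..h}"
    then have "D 0 (t + s) * ?w s = 0" for s
      using w_nz[of "t + s"] w_nz[of s] by (cases "w s = 0"; cases "w (t + s) = 0") (auto simp: D(1))
    then have "(\<lambda>s. D 0 (t + s) * ?w s) = (\<lambda>s. 0)" by (rule ext)
    then show False using that unfolding \<phi>_def by (simp only: integral_0)
  qed
  ultimately have t\<phi>: "test_fun_on {-a<..<a} (\<phi> 0)"
    by (intro test_funI[where C="{-h..h}"]) (use h in \<open>auto intro: bounded_subset[of "{-h..h}"]\<close>)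
  have \<phi>_L: "\<phi> 0 t = (LINT s|lborel. ?w (t + s) * ?w s)" for t
  proof -
    have i: "integrable lborel (\<lambda>s. ?w (t + s) * ?w s)"
      by (rule integrable_compact_support[where S="{0..h}"]) (use cs[of UNIV 0 t] w_nz in \<open>auto simp: D(1)\<close>)
    have eq: "(\<lambda>s. indicator {0..h} s *\<^sub>R (?w (t + s) * ?w s)) = (\<lambda>s. ?w (t + s) * ?w s)"
      using w_nz by (fastforce simp: indicator_def)
    have "set_integrable lborel {0..h} (\<lambda>s. ?w (t + s) * ?w s)"
      unfolding set_integrable_def eq by (rule i)
    from set_borel_integral_eq_integral(2)[OF this] show ?thesis
      unfolding set_lebesgue_integral_def eq by (simp add: \<phi>_def D(1))
  qed
  have iw: "integrable lborel ?w" by (rule test_fun_integrable[OF tw])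
  have four: "fourier (\<phi> 0) u = of_real ((norm (fourier ?w u))\<^sup>2)" for u
  proof -
    let ?H = "\<lambda>t s. exp (- \<i> * of_real (u * t)) * (?w (t + s) * ?w s)"
    have "integrable lborel (\<lambda>p::real \<times> real. ?H (fst p) (snd p))"
    proof (rule integrable_compact_support[where S="cbox (-h, 0) (h, h)"])
      show "continuous_on UNIV (\<lambda>p::real \<times> real. ?H (fst p) (snd p))"
        by (intro continuous_on_mult[OF _ c2[of UNIV 0, unfolded D(1)]]) (intro continuous_intros)
      show "?H (fst p) (snd p) = 0" if "p \<notin> cbox (-h, 0) (h, h)" for p :: "real \<times> real"
        using that w_nz[of "fst p + snd p"] w_nz[of "snd p"] 
        by (cases p; cases "w (snd p) = 0"; cases "w (fst p + snd p) = 0") (auto simp: cbox_Pair_eq)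
    qed auto
    then have int: "integrable (lborel \<Otimes>\<^sub>M lborel) (case_prod ?H)"
      unfolding lborel_prod by (simp add: split_def)
    have inner: "(LINT t|lborel. ?H t s) = exp (\<i> * of_real (u * s)) * ?w s * fourier ?w u" for s
    proof -
      have "(LINT t|lborel. ?H t s) = (LINT t|lborel. ?H (- s + 1 * t) s)"
        by (subst lborel_integral_real_affine[of 1 _ "- s"]) auto
      also have "\<dots> = (LINT t|lborel. (exp (\<i> * of_real (u * s)) * ?w s) * (exp (- \<i> * of_real (u * t)) * ?w t))"
        by (rule Bochner_Integration.integral_cong) (auto simp: algebra_simps exp_diff exp_minus divide_inverse)
      finally show ?thesis by (simp add: fourier_def)
    qed
    have "fourier (\<phi> 0) u = (LINT t|lborel. LINT s|lborel. ?H t s)"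
      unfolding fourier_def \<phi>_L by simp
    also have "\<dots> = (LINT s|lborel. LINT t|lborel. ?H t s)"
      by (rule lborel_pair.Fubini_integral[OF int, symmetric])
    also have "\<dots> = (LINT s|lborel. exp (\<i> * of_real (u * s)) * ?w s * fourier ?w u)"
      unfolding inner ..
    \<comment> \<open>\<open>w\<close> is real, so the factor depending on s is the conjugate of the
      integrand of the transform of \<open>w\<close>.\<close>
    also have "\<dots> = (LINT s|lborel. cnj (exp (- \<i> * of_real (u * s)) * ?w s)) * fourier ?w u"
      by (subst integral_mult_left_zero[symmetric]) (simp add: exp_cnj)
    also have "\<dots> = cnj (fourier ?w u) * fourier ?w u" 
      unfolding fourier_def by (simp only: Bochner_Integration.integral_cnj)
    finally show ?thesis using complex_norm_square[of "fourier ?w u"] by (simp only: mult.commute of_real_power)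
  qed
  obtain N where N: "N > 0" "\<And>u. norm (fourier ?w u) \<le> N / (1 + u\<^sup>2)" using fourier_test_decay[OF tw] by blast
  show thesis
  proof (rule that[OF t\<phi> four])
    show "(norm (fourier ?w u))\<^sup>2 \<ge> 0" for u by simp
    show "continuous_on UNIV (\<lambda>u. (norm (fourier ?w u))\<^sup>2)"
      by (intro continuous_intros fourier_continuous iw)
    show "(norm (fourier ?w u))\<^sup>2 \<le> N\<^sup>2 / (1 + u\<^sup>2)\<^sup>2" for u
      using power_mono[OF N(2)[of u], of 2] by (simp add: power_divide)
    \<comment> \<open>The value of the kernel at 0 is the square of this integral. At h / 2 the
      argument of the cell is 1, where the cell equals 1.\<close>
    have "(LINT x|lborel. w x) > 0"
    proof (rule integral_pos_continuous)
      show "integrable lborel w" using iw by (simp add: complex_of_real_integrable_eq)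
      show "continuous_on UNIV w" using continuous_on_Re[OF cw[of UNIV]] by simp
      show "w (h / 2) > 0" using h cell_1 by (simp add: w_def)
    qed (rule w0)
    then show "0 < (norm (fourier ?w 0))\<^sup>2" by (simp add: fourier_def)
  qed simp
qed

section \<open>Laplace transforms and their boundary values\<close>

text \<open>Absolute convergence in the whole open half-plane is built in, so that Fubini is
  available for every \<sigma> > 0. The vanishing on the negative axis makes exp (- \<sigma> u) at
  most 1 wherever f is nonzero.\<close>

definition laplace_able :: "(real \<Rightarrow> complex) \<Rightarrow> bool" where
  "laplace_able f \<longleftrightarrow> f \<in> borel_measurable lborel \<and> (\<forall>x<0. f x = 0) \<and>
     (\<forall>\<sigma>>0. integrable lborel (\<lambda>x. of_real (exp (- \<sigma> * x)) * f x))"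

definition laplace :: "(real \<Rightarrow> complex) \<Rightarrow> complex \<Rightarrow> complex" where
  "laplace f s = (LINT x|lborel. exp (- s * of_real x) * f x)"

lemma laplace_ableD:
  assumes "laplace_able f"
  shows "f \<in> borel_measurable borel" "\<And>x. x < 0 \<Longrightarrow> f x = 0"
    "\<And>\<sigma>. \<sigma> > 0 \<Longrightarrow> integrable lborel (\<lambda>x. of_real (exp (- \<sigma> * x)) * f x)"
  using assms by (auto simp: laplace_able_def)

lemma norm_exp_minus: "norm (exp (- s * complex_of_real x)) = exp (- Re s * x)"
  by (simp add: norm_exp_eq_Re)

lemma laplace_integrable:
  assumes "laplace_able f" "Re s > 0"
  shows "integrable lborel (\<lambda>x. exp (- s * of_real x) * f x)"
proof (rule Bochner_Integration.integrable_bound[OF laplace_ableD(3)[OF assms]])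
  have [measurable]: "f \<in> borel_measurable borel" using laplace_ableD assms by auto
  have [measurable]: "(\<lambda>x::real. exp (- s * of_real x)) \<in> borel_measurable borel"
    by (intro borel_measurable_continuous_onI continuous_intros)
  show "(\<lambda>x. exp (- s * of_real x) * f x) \<in> borel_measurable lborel" by simp
qed (simp add: norm_mult norm_exp_minus del: mult_minus_left)

lemma laplace_able_diff:
  assumes "laplace_able f" "laplace_able g"
  shows "laplace_able (\<lambda>x. f x - g x)"
  unfolding laplace_able_def right_diff_distrib
  using assms by (auto simp: laplace_able_def intro!: Bochner_Integration.integrable_diff)

lemma laplace_diff:
  assumes "laplace_able f" "laplace_able g" "Re s > 0"
  shows "laplace (\<lambda>x. f x - g x) s = laplace f s - laplace g s"
  unfolding laplace_def right_diff_distrib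
  by (rule Bochner_Integration.integral_diff) (use laplace_integrable assms in auto)

lemma laplace_able_cmult: "laplace_able f \<Longrightarrow> laplace_able (\<lambda>x. c * f x)"
  unfolding laplace_able_def by (auto simp: mult.left_commute[of _ c])

lemma laplace_cmult: "laplace (\<lambda>x. c * f x) s = c * laplace f s"
  unfolding laplace_def by (simp add: mult.left_commute[of _ c])

lemma laplace_able_modulate:
  assumes "laplace_able f"
  shows "laplace_able (\<lambda>x. exp (\<i> * of_real (t * x)) * f x)"
proof -
  have [measurable]: "f \<in> borel_measurable borel" using laplace_ableD assms by auto
  have [measurable]: "(\<lambda>x::real. exp (\<i> * of_real (t * x))) \<in> borel_measurable borel"
    by (intro borel_measurable_continuous_onI continuous_intros)
  have "integrable lborel (\<lambda>x. of_real (exp (- \<sigma> * x)) * (exp (\<i> * of_real (t * x)) * f x))" if "\<sigma> > 0" for \<sigma>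
    by (rule Bochner_Integration.integrable_bound[OF laplace_ableD(3)[OF assms that]]) (auto simp: norm_mult)
  then show ?thesis using assms by (auto simp: laplace_able_def)
qed

lemma laplace_modulate: "laplace (\<lambda>x. exp (\<i> * of_real (t * x)) * f x) s = laplace f (s - \<i> * of_real t)"
proof -
  have "exp (- s * of_real x) * (exp (\<i> * of_real (t * x)) * f x) = exp (- (s - \<i> * of_real t) * of_real x) * f x" for x
    unfolding mult.assoc[symmetric] exp_add[symmetric] by (simp add: algebra_simps)
  then show ?thesis unfolding laplace_def by (simp only:)
qed

lemma laplace_indicator_atLeast:
  assumes "Re s > 0"
  shows "integrable lborel (\<lambda>x. indicator {u..} x *\<^sub>R exp (- s * of_real x))"
    "(LINT x|lborel. indicator {u..} x *\<^sub>R exp (- s * of_real x)) = exp (- s * of_real u) / s"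
proof -
  have s: "s \<noteq> 0" using assms by auto
  have [measurable]: "(\<lambda>x::real. exp (- s * of_real x)) \<in> borel_measurable borel"
    by (intro borel_measurable_continuous_onI continuous_intros)
  \<comment> \<open>The dominating exponential starts at u - 1 instead of u because the half-line
    \<open>{0<..}\<close> is open at its left end and the point u has to be covered.\<close>
  let ?v = "\<lambda>x. exp (- (Re s * (u - 1))) * (indicator {0<..} (- (u - 1) + 1 * x) *\<^sub>R exp (- ((- (u - 1) + 1 * x) * Re s)))"
  have "integrable lborel (\<lambda>x. indicator {0<..} x *\<^sub>R exp (- (x * Re s)))"
    using integrable_I0i_exp_mscale[OF assms] unfolding set_integrable_def by simp
  from lborel_integrable_real_affine[OF this, of 1 "- (u - 1)"] have iv: "integrable lborel ?v"
    by (intro integrable_mult_right) simp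
  have v: "norm (indicator {u..} x *\<^sub>R exp (- s * of_real x)) \<le> ?v x" for x
  proof (cases "u \<le> x")
    case True
    have "?v x = exp (- (Re s * (u - 1))) * exp (- ((- (u - 1) + 1 * x) * Re s))" using True by simp
    also have "\<dots> = exp (- (Re s * (u - 1)) + - ((- (u - 1) + 1 * x) * Re s))" by (simp only: exp_add)
    also have "\<dots> = exp (- Re s * x)" by (simp add: algebra_simps)
    finally show ?thesis using True by (simp add: norm_exp_eq_Re)
  qed simp
  show "integrable lborel (\<lambda>x. indicator {u..} x *\<^sub>R exp (- s * of_real x))"
    by (rule Bochner_Integration.integrable_bound[OF iv]) (use v in \<open>auto intro!: AE_I2 order_trans[OF v abs_ge_self, folded real_norm_def] simp del: mult_minus_left\<close>)
  have FTC: "(LINT x|lborel. indicator {u..T} x *\<^sub>R exp (- s * of_real x)) = - exp (- s * of_real T) / s - (- exp (- s * of_real u) / s)"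
    if "u \<le> T" for T
  proof (rule integral_FTC_Icc[OF that])
    fix x assume "u \<le> x" "x \<le> T"
    have "((\<lambda>z. - exp (- s * z) / s) has_field_derivative exp (- s * of_real x)) (at (of_real x))"
      using s by (auto intro!: derivative_eq_intros)
    from has_vector_derivative_real_field[OF this]
    show "((\<lambda>x. - exp (- s * of_real x) / s) has_vector_derivative exp (- s * of_real x)) (at x within {u..T})" .
  qed (intro continuous_intros)
  have "((\<lambda>T. LINT x|lborel. indicator {u..T} x *\<^sub>R exp (- s * of_real x)) \<longlongrightarrow>
      (LINT x|lborel. indicator {u..} x *\<^sub>R exp (- s * of_real x))) at_top"
  proof (rule integral_dominated_convergence_at_top[OF _ _ iv])
    show "AE x in lborel. ((\<lambda>T. indicator {u..T} x *\<^sub>R exp (- s * of_real x)) \<longlongrightarrow> indicator {u..} x *\<^sub>R exp (- s * of_real x)) at_top"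
    proof (rule AE_I2, rule tendsto_eventually)
      show "\<forall>\<^sub>F T in at_top. indicator {u..T} x *\<^sub>R exp (- s * of_real x) = indicator {u..} x *\<^sub>R exp (- s * of_real x)" for x :: real
        using eventually_ge_at_top[of x] by eventually_elim (auto simp: indicator_def)
    qed
    show "\<forall>\<^sub>F T in at_top. AE x in lborel. norm (indicator {u..T} x *\<^sub>R exp (- s * of_real x)) \<le> ?v x"
      by (intro always_eventually allI AE_I2 order_trans[OF _ v]) (auto simp: indicator_def)
  qed simp_all
  moreover have "((\<lambda>T. LINT x|lborel. indicator {u..T} x *\<^sub>R exp (- s * of_real x)) \<longlongrightarrow> exp (- s * of_real u) / s) at_top"
  proof (rule Lim_transform_eventually)
    have "((\<lambda>T. exp (- s * complex_of_real T)) \<longlongrightarrow> 0) at_top"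
    proof (rule tendsto_norm_zero_cancel)
      have "filterlim (\<lambda>T. - (Re s * T)) at_bot at_top"
        using filterlim_tendsto_pos_mult_at_top[OF tendsto_const assms filterlim_ident]
        by (simp add: filterlim_uminus_at_bot)
      then show "((\<lambda>T. norm (exp (- s * complex_of_real T))) \<longlongrightarrow> 0) at_top"
        unfolding norm_exp_eq_Re by (simp add: filterlim_compose[OF exp_at_bot])
    qed
    then have "((\<lambda>T. - exp (- s * of_real T) / s - (- exp (- s * of_real u) / s)) \<longlongrightarrow> - 0 / s - (- exp (- s * of_real u) / s)) at_top"
      by (intro tendsto_intros s)
    then show "((\<lambda>T. - exp (- s * of_real T) / s - (- exp (- s * of_real u) / s)) \<longlongrightarrow> exp (- s * of_real u) / s) at_top"
      by simp
    show "\<forall>\<^sub>F T in at_top. - exp (- s * of_real T) / s - (- exp (- s * of_real u) / s) = (LINT x|lborel. indicator {u..T} x *\<^sub>R exp (- s * of_real x))"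
      using eventually_ge_at_top[of u] by eventually_elim (simp only: FTC)
  qed
  ultimately show "(LINT x|lborel. indicator {u..} x *\<^sub>R exp (- s * of_real x)) = exp (- s * of_real u) / s"
    by (rule tendsto_unique[OF trivial_limit_at_top_linorder])
qed

lemma laplace_able_bounded:
  assumes [measurable]: "f \<in> borel_measurable lborel" and "\<And>x. x < 0 \<Longrightarrow> f x = 0" and "AE x in lborel. norm (f x) \<le> M"
  shows "laplace_able f"
proof -
  have "integrable lborel (\<lambda>x. of_real (exp (- \<sigma> * x)) * f x)" if "\<sigma> > 0" for \<sigma>
  proof (rule Bochner_Integration.integrable_bound)
    have "integrable lborel (\<lambda>x. norm (indicator {0..} x *\<^sub>R exp (- of_real \<sigma> * complex_of_real x)))"
      using laplace_indicator_atLeast(1)[of "of_real \<sigma>" 0] that by (intro integrable_norm) simp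
    also have "(\<lambda>x. norm (indicator {0..} x *\<^sub>R exp (- of_real \<sigma> * complex_of_real x))) = (\<lambda>x. indicator {0..} x * exp (- (x * \<sigma>)))"
      by (auto simp: norm_exp_eq_Re indicator_def mult.commute)
    finally show "integrable lborel (\<lambda>x. M * (indicator {0..} x * exp (- (x * \<sigma>))))"
      by (intro integrable_mult_right) simp
    show "AE x in lborel. norm (of_real (exp (- \<sigma> * x)) * f x) \<le> norm (M * (indicator {0..} x * exp (- (x * \<sigma>))))"
      using assms(3)
    proof eventually_elim
      case (elim x)
      then show ?case using assms(2)[of x] 
        by (cases "x < 0") (auto simp: norm_mult abs_mult mult.commute intro!: mult_right_mono order_trans[OF elim abs_ge_self])
    qed
  qed simp
  then show ?thesis using assms by (auto simp: laplace_able_def)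
qed

text \<open>Fubini: the weight exp (- \<sigma> u) makes the product of f(u) and \<phi>(t) integrable
  on the plane. Letting \<sigma> tend to 0 afterwards turns questions about boundary values into
  questions about integrals of f against \<open>fourier \<phi>\<close>.\<close>

lemma laplace_parseval:
  assumes f: "laplace_able f" and \<phi>: "test_fun_on U \<phi>" and "\<sigma> > 0"
  shows "integrable lborel (\<lambda>t. laplace f (Complex \<sigma> t) * \<phi> t)"
    "(LINT t|lborel. laplace f (Complex \<sigma> t) * \<phi> t) = (LINT u|lborel. of_real (exp (- \<sigma> * u)) * f u * fourier \<phi> u)"
proof -
  let ?H = "\<lambda>u t. exp (- Complex \<sigma> t * of_real u) * f u * \<phi> t"
  note i = laplace_ableD(3)[OF f \<open>\<sigma> > 0\<close>]
  note ip = test_fun_integrable[OF \<phi>]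
  have [measurable]: "f \<in> borel_measurable borel" "\<phi> \<in> borel_measurable borel" using laplace_ableD f ip by auto
  have [measurable]: "(\<lambda>p::real \<times> real. exp (- (Complex \<sigma> (snd p) * of_real (fst p)))) \<in> borel_measurable (borel \<Otimes>\<^sub>M borel)"
    unfolding borel_prod Complex_eq by (intro borel_measurable_continuous_onI continuous_intros)
  have int: "integrable (lborel \<Otimes>\<^sub>M lborel) (case_prod ?H)"
  proof (rule Bochner_Integration.integrable_bound[OF integrable_mult_prod[OF i ip]])
    show "case_prod ?H \<in> borel_measurable (lborel \<Otimes>\<^sub>M lborel)" by (simp add: split_def)
  qed (auto simp: norm_mult norm_exp_eq_Re)
  have 1: "(LINT u|lborel. ?H u t) = laplace f (Complex \<sigma> t) * \<phi> t" for t
    unfolding laplace_def by simp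
  have 2: "(LINT t|lborel. ?H u t) = of_real (exp (- \<sigma> * u)) * f u * fourier \<phi> u" for u
  proof -
    have "?H u t = (of_real (exp (- \<sigma> * u)) * f u) * (exp (- \<i> * of_real (u * t)) * \<phi> t)" for t
    proof -
      have "exp (- Complex \<sigma> t * of_real u) = of_real (exp (- \<sigma> * u)) * exp (- \<i> * of_real (u * t))"
        unfolding exp_of_real[symmetric] exp_add[symmetric] by (simp add: Complex_eq algebra_simps)
      then show ?thesis by (simp only: mult_ac)
    qed
    then show ?thesis unfolding fourier_def by (simp only: integral_mult_right_zero)
  qed
  show "integrable lborel (\<lambda>t. laplace f (Complex \<sigma> t) * \<phi> t)"
    using lborel_pair.integrable_snd[OF int] unfolding 1 .
  show "(LINT t|lborel. laplace f (Complex \<sigma> t) * \<phi> t) = (LINT u|lborel. of_real (exp (- \<sigma> * u)) * f u * fourier \<phi> u)"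
    using lborel_pair.Fubini_integral[OF int] unfolding 1 2 .
qed

lemma laplace_parseval_modulated:
  assumes f: "laplace_able f" and \<phi>: "test_fun_on U \<phi>" and "\<sigma> > 0"
  shows "(LINT t|lborel. laplace f (Complex \<sigma> t) * (exp (\<i> * of_real (x * t)) * \<phi> t)) 
    = (LINT u|lborel. of_real (exp (- \<sigma> * u)) * f u * fourier \<phi> (u - x))"
  using laplace_parseval(2)[OF f test_fun_exp[OF \<phi>] \<open>\<sigma> > 0\<close>] unfolding fourier_modulate .

section \<open>Primitives and division of the transform by \<open>s\<close>\<close>

definition primitive :: "(real \<Rightarrow> complex) \<Rightarrow> real \<Rightarrow> complex" where
  "primitive f x = (LINT u|lborel. indicator {..x} u *\<^sub>R f u)"

text \<open>For u \<le> x the weight exp (x - u) is at least 1, so the absolute convergence of the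
  transform at 1 controls the head.\<close>

lemma laplace_able_head:
  assumes "laplace_able f"
  shows "integrable lborel (\<lambda>u. indicator {..x} u *\<^sub>R f u)"
proof (rule Bochner_Integration.integrable_bound)
  have [measurable]: "f \<in> borel_measurable borel" using laplace_ableD assms by auto
  show "integrable lborel (\<lambda>u. of_real (exp x) * (of_real (exp (- 1 * u)) * f u))"
    using laplace_ableD(3)[OF assms, of 1] by (intro integrable_mult_right) auto
  show "AE u in lborel. norm (indicator {..x} u *\<^sub>R f u) \<le> norm (of_real (exp x) * (of_real (exp (- 1 * u)) * f u))"
  proof (rule AE_I2)
    fix u
    have "norm (f u) \<le> exp (x - u) * norm (f u)" if "u \<le> x"
      using mult_right_mono[of 1 "exp (x - u)" "norm (f u)"] that by simp
    moreover have "norm (of_real (exp x) * (of_real (exp (- 1 * u)) * f u)) = exp (x + - 1 * u) * norm (f u)"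
      by (simp only: exp_add norm_mult norm_of_real abs_exp_cancel mult.assoc)
    ultimately show "norm (indicator {..x} u *\<^sub>R f u) \<le> norm (of_real (exp x) * (of_real (exp (- 1 * u)) * f u))"
      by (auto simp: indicator_def)
  qed
qed (use laplace_ableD[OF assms] in auto)

text \<open>Exchanging the integrals over the region u \<le> x leaves, for each u, the transform of
  the half-line from u on, which is exp (- s u) / s. The absolute values obey the same computation
  with s replaced by its real part, which justifies the exchange.\<close>

lemma laplace_primitive:
  assumes f: "laplace_able f"
  shows "laplace_able (primitive f)" "Re s > 0 \<Longrightarrow> laplace (primitive f) s = laplace f s / s"
proof -
  have mf [measurable]: "f \<in> borel_measurable borel" using laplace_ableD f by auto
  define H where "H s u x = exp (- s * of_real x) * (indicator {..x} u *\<^sub>R f u)" for s u x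
  have H: "H s u x = f u * (indicator {u..} x *\<^sub>R exp (- s * of_real x))" for s u x
    by (auto simp: H_def indicator_def)
  have int: "integrable (lborel \<Otimes>\<^sub>M lborel) (case_prod (H s))" if s: "Re s > 0" for s
  proof (rule lborel_pair.Fubini_integrable)
    have [measurable]: "(\<lambda>p::real \<times> real. exp (- (s * of_real (snd p)))) \<in> borel_measurable (borel \<Otimes>\<^sub>M borel)"
      unfolding borel_prod by (intro borel_measurable_continuous_onI continuous_intros)
    have "case_prod (H s) = (\<lambda>p. exp (- s * of_real (snd p)) * ((if fst p \<le> snd p then 1 else 0) *\<^sub>R f (fst p)))"
      by (auto simp: H_def indicator_def)
    then show "case_prod (H s) \<in> borel_measurable (lborel \<Otimes>\<^sub>M lborel)" by simp
    have nH: "(LINT x|lborel. norm (H s u x)) = 1 / Re s * norm (of_real (exp (- Re s * u)) * f u)" for u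
    proof -
      have "(LINT x|lborel. of_real (norm (H s u x))) = complex_of_real (norm (f u)) * 
          (LINT x|lborel. indicator {u..} x *\<^sub>R exp (- of_real (Re s) * complex_of_real x))"
        by (subst integral_mult_right_zero[symmetric], rule Bochner_Integration.integral_cong)
          (auto simp: H norm_mult indicator_def norm_exp_eq_Re exp_of_real[symmetric])
      also have "\<dots> = complex_of_real (norm (f u) * (exp (- Re s * u) / Re s))"
        using laplace_indicator_atLeast(2)[of "of_real (Re s)" u] s by (simp add: exp_of_real[symmetric])
      finally show ?thesis by (simp add: norm_mult del: of_real_mult of_real_divide)
    qed
    show "integrable lborel (\<lambda>u. LINT x|lborel. norm (case (u, x) of (u, x) \<Rightarrow> H s u x))"
      using laplace_ableD(3)[OF f s] by (simp add: nH del: mult_minus_left)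
    show "AE u in lborel. integrable lborel (\<lambda>x. case (u, x) of (u, x) \<Rightarrow> H s u x)"
      unfolding H prod.case by (intro AE_I2 integrable_mult_right laplace_indicator_atLeast s)
  qed
  have in_u: "(LINT u|lborel. H s u x) = exp (- s * of_real x) * primitive f x" for s x
    unfolding H_def primitive_def by (rule integral_mult_right_zero)
  have neg: "primitive f x = 0" if "x < 0" for x
  proof -
    have "(\<lambda>u. indicator {..x} u *\<^sub>R f u) = (\<lambda>u. 0)" using that laplace_ableD(2)[OF f] by (auto simp: indicator_def)
    then show ?thesis by (simp add: primitive_def)
  qed
  \<comment> \<open>At s = 0 the exponential is 1, so the inner integral is the primitive itself and
    its measurability follows from joint measurability.\<close>
  have "(\<lambda>x. LINT u|lborel. H 0 u x) \<in> borel_measurable lborel"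
  proof (rule lborel.borel_measurable_lebesgue_integral)
    have "(\<lambda>p::real \<times> real. (if snd p \<le> fst p then 1 else 0::real) *\<^sub>R f (snd p)) \<in> borel_measurable (lborel \<Otimes>\<^sub>M lborel)"
      by simp
    also have "(\<lambda>p::real \<times> real. (if snd p \<le> fst p then 1 else 0::real) *\<^sub>R f (snd p)) = (\<lambda>(x, u). H 0 u x)"
      by (auto simp: H_def indicator_def)
    finally show "(\<lambda>(x, u). H 0 u x) \<in> borel_measurable (lborel \<Otimes>\<^sub>M lborel)" .
  qed
  then have m: "primitive f \<in> borel_measurable lborel" by (simp add: in_u)
  show "laplace_able (primitive f)"
    unfolding laplace_able_def
  proof (intro conjI allI impI m neg)
    fix \<sigma> :: real assume "\<sigma> > 0"
    then show "integrable lborel (\<lambda>x. of_real (exp (- \<sigma> * x)) * primitive f x)"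
      using lborel_pair.integrable_snd[OF int[of "of_real \<sigma>"]] unfolding in_u by (simp add: exp_of_real[symmetric])
  qed
  show "laplace (primitive f) s = laplace f s / s" if s: "Re s > 0"
  proof -
    have "laplace (primitive f) s = (LINT x|lborel. LINT u|lborel. H s u x)" by (simp add: laplace_def in_u)
    also have "\<dots> = (LINT u|lborel. LINT x|lborel. H s u x)" by (rule lborel_pair.Fubini_integral[OF int[OF s]])
    also have "\<dots> = (LINT u|lborel. f u * (exp (- s * of_real u) / s))"
      unfolding H integral_mult_right_zero laplace_indicator_atLeast(2)[OF s] ..
    also have "\<dots> = laplace f s / s" by (simp add: laplace_def mult.commute[of "f _"])
    finally show ?thesis .
  qed
qed

subsection \<open>Passing to the boundary\<close>

lemma dominated_convergence_at_right_0:
  fixes s :: "real \<Rightarrow> real \<Rightarrow> 'b::{banach, second_countable_topology}"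
  assumes m: "f \<in> borel_measurable lborel" "\<And>\<sigma>. s \<sigma> \<in> borel_measurable lborel" and w: "integrable lborel w"
    and lim: "\<And>x. ((\<lambda>\<sigma>. s \<sigma> x) \<longlongrightarrow> f x) (at_right 0)" and b: "\<And>\<sigma> x. \<sigma> > 0 \<Longrightarrow> norm (s \<sigma> x) \<le> w x"
  shows "((\<lambda>\<sigma>. LINT x|lborel. s \<sigma> x) \<longlongrightarrow> (LINT x|lborel. f x)) (at_right 0)"
  unfolding filterlim_at_right_to_top
proof (rule integral_dominated_convergence_at_top[OF m(1) _ w])
  show "AE x in lborel. ((\<lambda>i. s (inverse i) x) \<longlongrightarrow> f x) at_top"
    using lim unfolding filterlim_at_right_to_top by auto
  show "\<forall>\<^sub>F i in at_top. AE x in lborel. norm (s (inverse i) x) \<le> w x"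
    using eventually_gt_at_top[of 0] by eventually_elim (use b in auto)
qed (use m in auto)

text \<open>Since f vanishes on the negative axis, the weight is at most 1 on the rest, so the
  modulus of f W dominates the integrands for all \<sigma> > 0.\<close>

lemma laplace_weight_limit:
  assumes f: "laplace_able f" and i: "integrable lborel (\<lambda>u. f u * W u)" and [measurable]: "W \<in> borel_measurable borel"
  shows "((\<lambda>\<sigma>. LINT u|lborel. of_real (exp (- \<sigma> * u)) * f u * W u) \<longlongrightarrow> (LINT u|lborel. f u * W u)) (at_right 0)"
proof (rule dominated_convergence_at_right_0[where w="\<lambda>u. norm (f u * W u)"])
  have [measurable]: "f \<in> borel_measurable borel" using laplace_ableD f by auto
  show "(\<lambda>u. f u * W u) \<in> borel_measurable lborel" "(\<lambda>u. of_real (exp (- \<sigma> * u)) * f u * W u) \<in> borel_measurable lborel" for \<sigma>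
    by simp_all
  show "((\<lambda>\<sigma>. of_real (exp (- \<sigma> * u)) * f u * W u) \<longlongrightarrow> f u * W u) (at_right 0)" for u
  proof -
    have "((\<lambda>\<sigma>. of_real (exp (- \<sigma> * u)) * f u * W u) \<longlongrightarrow> of_real (exp (- 0 * u)) * f u * W u) (at_right 0)"
      by (intro tendsto_intros)
    then show ?thesis by simp
  qed
  show "norm (of_real (exp (- \<sigma> * u)) * f u * W u) \<le> norm (f u * W u)" if "\<sigma> > 0" for \<sigma> u
  proof (cases "u < 0")
    case False
    then have "exp (- \<sigma> * u) \<le> 1" using that by simp
    then show ?thesis unfolding norm_mult mult.assoc by (intro mult_left_le_one_le) auto
  qed (use laplace_ableD[OF f] in auto)
qed (use i in simp)

text \<open>Two regimes: up to X, f is integrable and W bounded; beyond X, f is bounded and W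
  integrable.\<close>

lemma tail_bounded_integrable:
  assumes f: "laplace_able f" and B: "\<And>x. x > X \<Longrightarrow> norm (f x) \<le> B" 
    and W: "integrable lborel W" "\<And>u. norm (W u) \<le> N"
  shows "integrable lborel (\<lambda>u. f u * W u)"
proof -
  have [measurable]: "f \<in> borel_measurable borel" "W \<in> borel_measurable borel" using laplace_ableD f W by auto
  let ?w = "\<lambda>u. N * norm (indicator {..X} u *\<^sub>R f u) + B * norm (W u)"
  show ?thesis
  proof (rule Bochner_Integration.integrable_bound)
    show "integrable lborel ?w"
      using laplace_able_head[OF f, of X] W by (intro Bochner_Integration.integrable_add integrable_mult_right integrable_norm) auto
    have N: "N \<ge> 0" using W(2)[of 0] by (rule order_trans[OF norm_ge_zero])
    have B0: "B \<ge> 0" using B[of "X + 1"] by (auto intro: order_trans[OF norm_ge_zero])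
    have "norm (f u * W u) \<le> ?w u" for u
    proof (cases "u \<le> X")
      case True
      have "norm (f u) * norm (W u) \<le> norm (f u) * N" by (intro mult_left_mono W) auto
      then show ?thesis using True B0 by (auto simp: norm_mult mult.commute intro: add_increasing2)
    next
      case False
      then show ?thesis using B[of u] by (auto simp: norm_mult intro!: mult_right_mono)
    qed
    then show "AE u in lborel. norm (f u * W u) \<le> norm (?w u)" by (intro AE_I2 order_trans[OF _ abs_ge_self[of "?w _", folded real_norm_def]])
  qed simp
qed

section \<open>Boundary values tested against modulated test functions\<close>

lemma boundary_behavior_cong:
  assumes "\<And>s. Re s > 0 \<Longrightarrow> F s = F' s"
  shows "boundary_behavior Q U F \<longleftrightarrow> boundary_behavior Q U F'"
proof -
  have "((\<lambda>\<sigma>. LINT t|lborel. F (Complex \<sigma> t) * \<phi> t) \<longlongrightarrow> l) (at_right 0) \<longleftrightarrow> 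
      ((\<lambda>\<sigma>. LINT t|lborel. F' (Complex \<sigma> t) * \<phi> t) \<longlongrightarrow> l) (at_right 0)" for \<phi> l
    by (rule tendsto_cong) (use assms in \<open>auto simp: eventually_at_filter\<close>)
  then show ?thesis unfolding boundary_behavior_def by simp
qed

text \<open>Modulating a fixed test function by exp (i x t) translates its Fourier transform by x.
  One local distribution thereby becomes a function of x, in which the behavior of \<open>h\<close>
  at infinity can be read off.\<close>

lemma boundary_behavior_action:
  assumes "boundary_behavior (local_pseudo P) U F" "t0 \<in> U"
  obtains V h where "open V" "t0 \<in> V" "P h" "V \<subseteq> U"
    "\<And>\<phi> x. test_fun_on V \<phi> \<Longrightarrow> ((\<lambda>\<sigma>. LINT t|lborel. F (Complex \<sigma> t) * (exp (\<i> * of_real (x * t)) * \<phi> t)) \<longlongrightarrow>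
       (1 / (2 * of_real pi)) * (LINT u|lborel. h u * fourier \<phi> (- u - x))) (at_right 0)"
proof -
  obtain T where T: "\<And>\<phi>. test_fun_on U \<phi> \<Longrightarrow> ((\<lambda>\<sigma>. LINT t|lborel. F (Complex \<sigma> t) * \<phi> t) \<longlongrightarrow> T \<phi>) (at_right 0)"
    "local_pseudo P U T" using assms(1) unfolding boundary_behavior_def by blast
  obtain V h where V: "open V" "t0 \<in> V" "P h" "V \<subseteq> U" and h: "\<And>\<phi>. test_fun_on V \<phi> \<Longrightarrow> T \<phi> = ft_action h \<phi>"
    using T(2) assms(2) unfolding local_pseudo_def by blast
  show thesis
  proof (rule that[OF V])
    fix \<phi> x assume "test_fun_on V \<phi>"
    then have t: "test_fun_on V (\<lambda>t. exp (\<i> * of_real (x * t)) * \<phi> t)" by (rule test_fun_exp)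
    show "((\<lambda>\<sigma>. LINT t|lborel. F (Complex \<sigma> t) * (exp (\<i> * of_real (x * t)) * \<phi> t)) \<longlongrightarrow>
       (1 / (2 * of_real pi)) * (LINT u|lborel. h u * fourier \<phi> (- u - x))) (at_right 0)"
      using T(1)[OF test_fun_mono[OF t V(4)]] unfolding h[OF t] ft_action_def fourier_modulate .
  qed
qed

text \<open>The consequence of pseudomeasure behavior that is kept: for each local test function,
  the limits of the modulated integrals exist and are bounded uniformly in x. Unlike the original
  notion it mentions no representing transform, so it passes easily through translation, scalar
  multiples and multiplication by s - i t.\<close>

definition pm_near :: "(complex \<Rightarrow> complex) \<Rightarrow> real \<Rightarrow> bool" where
  "pm_near F t0 \<longleftrightarrow> (\<exists>V. open V \<and> t0 \<in> V \<and> (\<forall>\<phi>. test_fun_on V \<phi> \<longrightarrow> (\<exists>C. \<forall>x. \<exists>l.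
     ((\<lambda>\<sigma>. LINT t|lborel. F (Complex \<sigma> t) * (exp (\<i> * of_real (x * t)) * \<phi> t)) \<longlongrightarrow> l) (at_right 0) \<and> norm l \<le> C)))"

lemma pm_near_cong:
  assumes "\<And>s. Re s > 0 \<Longrightarrow> F s = F' s"
  shows "pm_near F t \<longleftrightarrow> pm_near F' t"
proof -
  have "((\<lambda>\<sigma>. LINT t|lborel. F (Complex \<sigma> t) * \<phi> t) \<longlongrightarrow> l) (at_right 0) \<longleftrightarrow> 
      ((\<lambda>\<sigma>. LINT t|lborel. F' (Complex \<sigma> t) * \<phi> t) \<longlongrightarrow> l) (at_right 0)" for \<phi> l
    by (rule tendsto_cong) (use assms in \<open>auto simp: eventually_at_filter\<close>)
  then show ?thesis unfolding pm_near_def by simp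
qed

lemma norm_integral_mult_le:
  fixes h k :: "real \<Rightarrow> complex"
  assumes "\<And>u. norm (h u) \<le> H" "integrable lborel k"
  shows "norm (LINT u|lborel. h u * k u) \<le> H * (LINT u|lborel. norm (k u))"
proof -
  have "norm (LINT u|lborel. h u * k u) \<le> (LINT u|lborel. norm (h u * k u))" by (rule integral_norm_bound)
  also have "\<dots> \<le> (LINT u|lborel. H * norm (k u))"
  proof (rule Bochner_Integration.integral_mono')
    have "H \<ge> 0" using assms(1)[of 0] by (rule order_trans[OF norm_ge_zero])
    then show "0 \<le> H * norm (k u)" for u by simp
  qed (use assms in \<open>auto simp: norm_mult intro!: mult_right_mono\<close>)
  finally show ?thesis by simp
qed

lemma integral_reflect_shift:
  fixes k :: "real \<Rightarrow> 'b::{banach, second_countable_topology}"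
  shows "(LINT u|lborel. k (- u - x)) = (LINT u|lborel. k u)"
  by (subst (2) lborel_integral_real_affine[of "- 1" _ "- x"]) (auto simp: algebra_simps)

text \<open>The limit at x is at most 1 / (2 pi) times the supremum of \<open>h\<close> times the L1
  norm of a translate of \<open>fourier \<phi>\<close>, and that norm does not depend on x.\<close>

lemma boundary_behavior_pm_near:
  assumes "boundary_behavior (local_pseudo P) U F" "t0 \<in> U" "\<And>h. P h \<Longrightarrow> pm_transform h"
  shows "pm_near F t0"
proof -
  obtain V h where V: "open V" "t0 \<in> V" "P h" and lim:
    "\<And>\<phi> x. test_fun_on V \<phi> \<Longrightarrow> ((\<lambda>\<sigma>. LINT t|lborel. F (Complex \<sigma> t) * (exp (\<i> * of_real (x * t)) * \<phi> t)) \<longlongrightarrow>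
       (1 / (2 * of_real pi)) * (LINT u|lborel. h u * fourier \<phi> (- u - x))) (at_right 0)"
    by (rule boundary_behavior_action[OF assms(1,2)]) blast
  obtain H where H: "\<And>u. norm (h u) \<le> H" using assms(3)[OF V(3)] unfolding pm_transform_def bounded_iff by auto
  show ?thesis unfolding pm_near_def
  proof (intro exI[of _ V] conjI allI impI V)
    fix \<phi> assume \<phi>: "test_fun_on V \<phi>"
    let ?C = "(1 / (2 * pi)) * (H * (LINT u|lborel. norm (fourier \<phi> u)))"
    have "norm ((1 / (2 * complex_of_real pi)) * (LINT u|lborel. h u * fourier \<phi> (- u - x))) \<le> ?C" for x
    proof -
      have "integrable lborel (\<lambda>u. fourier \<phi> (- u - x))"
        using lborel_integrable_real_affine[OF fourier_test_integrable[OF \<phi>], of "- 1" "- x"] by (simp add: algebra_simps)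
      from norm_integral_mult_le[OF H this] show ?thesis
        unfolding integral_reflect_shift[of "\<lambda>u. norm (fourier \<phi> u)"] norm_mult
        by (intro mult_mono) (auto simp: norm_divide)
    qed
    then show "\<exists>C. \<forall>x. \<exists>l. ((\<lambda>\<sigma>. LINT t|lborel. F (Complex \<sigma> t) * (exp (\<i> * of_real (x * t)) * \<phi> t)) \<longlongrightarrow> l) (at_right 0) \<and> norm l \<le> C"
      using lim[OF \<phi>] by blast
  qed
qed

text \<open>The substitution t to t + t0 multiplies the integral by the phase exp (- i x t0) only,
  so the same constant serves.\<close>

lemma pm_near_shift:
  assumes "pm_near F t0"
  shows "pm_near (\<lambda>s. F (s + \<i> * of_real t0)) 0"
proof -
  obtain V where V: "open V" "t0 \<in> V" and pm: "\<And>\<phi>. test_fun_on V \<phi> \<Longrightarrow> (\<exists>C. \<forall>x. \<exists>l.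
     ((\<lambda>\<sigma>. LINT t|lborel. F (Complex \<sigma> t) * (exp (\<i> * of_real (x * t)) * \<phi> t)) \<longlongrightarrow> l) (at_right 0) \<and> norm l \<le> C)"
    using assms unfolding pm_near_def by blast
  let ?V = "{y. y + t0 \<in> V}"
  have "open ((\<lambda>y. y + t0) -` V)" by (rule open_vimage[OF V(1)]) (intro continuous_intros)
  then have oV: "open ?V" by (simp add: vimage_def)
  show ?thesis unfolding pm_near_def
  proof (intro exI[of _ ?V] conjI allI impI)
    fix \<phi> assume \<phi>: "test_fun_on ?V \<phi>"
    have "test_fun_on {x. 1 * x + - t0 \<in> ?V} (\<lambda>x. \<phi> (1 * x + - t0))" by (rule test_fun_affine[OF \<phi>]) simp
    then have "test_fun_on V (\<lambda>x. \<phi> (x - t0))" by simp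
    then obtain C where C: "\<And>x. \<exists>l. ((\<lambda>\<sigma>. LINT t|lborel. F (Complex \<sigma> t) * (exp (\<i> * of_real (x * t)) * \<phi> (t - t0))) \<longlongrightarrow> l) (at_right 0) \<and> norm l \<le> C"
      using pm by blast
    have eq: "(LINT t|lborel. F (Complex \<sigma> t + \<i> * of_real t0) * (exp (\<i> * of_real (x * t)) * \<phi> t)) =
        exp (- \<i> * of_real (x * t0)) * (LINT t|lborel. F (Complex \<sigma> t) * (exp (\<i> * of_real (x * t)) * \<phi> (t - t0)))" for \<sigma> x
    proof -
      have "(LINT t|lborel. F (Complex \<sigma> t) * (exp (\<i> * of_real (x * t)) * \<phi> (t - t0))) = 
        (LINT t|lborel. F (Complex \<sigma> (t0 + 1 * t)) * (exp (\<i> * of_real (x * (t0 + 1 * t))) * \<phi> (t0 + 1 * t - t0)))"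
        by (subst lborel_integral_real_affine[of 1 _ t0]) auto
      also have "\<dots> = (LINT t|lborel. exp (\<i> * of_real (x * t0)) * (F (Complex \<sigma> t + \<i> * of_real t0) * (exp (\<i> * of_real (x * t)) * \<phi> t)))"
        by (rule Bochner_Integration.integral_cong)
          (auto simp: Complex_eq algebra_simps exp_add)
      finally show ?thesis by (simp add: exp_minus)
    qed
    have "\<exists>l. ((\<lambda>\<sigma>. LINT t|lborel. F (Complex \<sigma> t + \<i> * of_real t0) * (exp (\<i> * of_real (x * t)) * \<phi> t)) \<longlongrightarrow> l) (at_right 0) \<and> norm l \<le> C" for x
    proof -
      obtain l where l: "((\<lambda>\<sigma>. LINT t|lborel. F (Complex \<sigma> t) * (exp (\<i> * of_real (x * t)) * \<phi> (t - t0))) \<longlongrightarrow> l) (at_right 0)" "norm l \<le> C"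
        using C by blast
      show ?thesis unfolding eq
        by (intro exI[of _ "exp (- \<i> * of_real (x * t0)) * l"] conjI tendsto_mult_left l(1)) (use l(2) in \<open>simp add: norm_mult\<close>)
    qed
    then show "\<exists>C. \<forall>x. \<exists>l. ((\<lambda>\<sigma>. LINT t|lborel. F (Complex \<sigma> t + \<i> * of_real t0) * (exp (\<i> * of_real (x * t)) * \<phi> t)) \<longlongrightarrow> l) (at_right 0) \<and> norm l \<le> C"
      by blast
  qed (use oV V in auto)
qed

lemma test_fun_linear_mult: "test_fun_on U \<phi> \<Longrightarrow> test_fun_on U (\<lambda>y. \<i> * of_real (y - t) * \<phi> y)"
  using test_fun_mult'[of U \<phi> "\<lambda>y. \<i> * of_real (1 * y + - t)"] 
    smooth_fun_mult[OF smooth_fun_const smooth_fun_affine[OF smooth_fun_of_real, of 1 "- t"], of \<i>] by simp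

text \<open>On the line with real part \<sigma> the divisor s - i t equals \<sigma> + i (y - t). The
  \<sigma> part disappears in the boundary limit, and the other part is moved onto the test
  function.\<close>

lemma laplace_quotient_action:
  assumes f: "laplace_able f" and R: "laplace_able R" and q: "\<And>s. Re s > 0 \<Longrightarrow> laplace R s = laplace f s / (s - \<i> * of_real t)"
    and \<phi>: "test_fun_on U \<phi>" and "\<sigma> > 0"
  shows "(LINT y|lborel. laplace f (Complex \<sigma> y) * \<phi> y) = of_real \<sigma> * (LINT y|lborel. laplace R (Complex \<sigma> y) * \<phi> y)
     + (LINT y|lborel. laplace R (Complex \<sigma> y) * (\<i> * of_real (y - t) * \<phi> y))"
proof -
  have "laplace f (Complex \<sigma> y) * \<phi> y = of_real \<sigma> * (laplace R (Complex \<sigma> y) * \<phi> y) + laplace R (Complex \<sigma> y) * (\<i> * of_real (y - t) * \<phi> y)" for y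
  proof -
    have ne: "Complex \<sigma> y - \<i> * of_real t \<noteq> 0" using \<open>\<sigma> > 0\<close> by (auto simp: complex_eq_iff)
    have "laplace f (Complex \<sigma> y) = laplace R (Complex \<sigma> y) * (Complex \<sigma> y - \<i> * of_real t)"
      using q[of "Complex \<sigma> y"] \<open>\<sigma> > 0\<close> ne by simp
    also have "Complex \<sigma> y - \<i> * of_real t = of_real \<sigma> + \<i> * of_real (y - t)" by (simp add: Complex_eq algebra_simps)
    finally have eq: "laplace f (Complex \<sigma> y) = laplace R (Complex \<sigma> y) * (of_real \<sigma> + \<i> * of_real (y - t))" .
    show ?thesis unfolding eq by (simp add: algebra_simps)
  qed
  then show ?thesis
    using laplace_parseval(1)[OF R \<phi> \<open>\<sigma> > 0\<close>] laplace_parseval(1)[OF R test_fun_linear_mult[OF \<phi>, of t] \<open>\<sigma> > 0\<close>]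
    by simp
qed

text \<open>Multiplication by s - i t preserves the bounds: the test function (y - t) \<phi>(y) is
  again admissible near t. The limits against \<phi> itself are also used, but merely to know that
  \<sigma> times a convergent quantity vanishes.\<close>

lemma pm_near_quotient:
  assumes f: "laplace_able f" and R: "laplace_able R" and q: "\<And>s. Re s > 0 \<Longrightarrow> laplace R s = laplace f s / (s - \<i> * of_real t)"
    and pm: "pm_near (laplace R) t"
  shows "pm_near (laplace f) t"
proof -
  let ?A = "\<lambda>F \<phi> x \<sigma>. LINT t|lborel. F (Complex \<sigma> t) * (exp (\<i> * of_real (x * t)) * \<phi> t)"
  obtain V where V: "open V" "t \<in> V" and pm: "\<And>\<phi>. test_fun_on V \<phi> \<Longrightarrow> (\<exists>C. \<forall>x. \<exists>l.
     (?A (laplace R) \<phi> x \<longlongrightarrow> l) (at_right 0) \<and> norm l \<le> C)"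
    using pm unfolding pm_near_def by blast
  show ?thesis unfolding pm_near_def
  proof (intro exI[of _ V] conjI allI impI V)
    fix \<phi> assume \<phi>: "test_fun_on V \<phi>"
    let ?\<psi> = "\<lambda>y. \<i> * of_real (y - t) * \<phi> y"
    obtain C where C: "\<And>x. \<exists>l. (?A (laplace R) ?\<psi> x \<longlongrightarrow> l) (at_right 0) \<and> norm l \<le> C"
      using pm[OF test_fun_linear_mult[OF \<phi>]] by blast
    have "\<exists>l. (?A (laplace f) \<phi> x \<longlongrightarrow> l) (at_right 0) \<and> norm l \<le> C" for x
    proof -
      obtain l where l: "(?A (laplace R) ?\<psi> x \<longlongrightarrow> l) (at_right 0)" "norm l \<le> C" using C by blast
      obtain l' where l': "(?A (laplace R) \<phi> x \<longlongrightarrow> l') (at_right 0)" using pm[OF \<phi>] by blast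
      have "((\<lambda>\<sigma>. of_real \<sigma> * ?A (laplace R) \<phi> x \<sigma> + ?A (laplace R) ?\<psi> x \<sigma>) \<longlongrightarrow> of_real 0 * l' + l) (at_right 0)"
        by (intro tendsto_intros l l')
      moreover have "\<forall>\<^sub>F \<sigma> in at_right 0. of_real \<sigma> * ?A (laplace R) \<phi> x \<sigma> + ?A (laplace R) ?\<psi> x \<sigma> = ?A (laplace f) \<phi> x \<sigma>"
      proof -
        have "of_real \<sigma> * ?A (laplace R) \<phi> x \<sigma> + ?A (laplace R) ?\<psi> x \<sigma> = ?A (laplace f) \<phi> x \<sigma>" if "\<sigma> > 0" for \<sigma>
          using laplace_quotient_action[OF f R q test_fun_exp[OF \<phi>] that, of x] by (simp add: mult_ac)
        then show ?thesis by (auto simp: eventually_at_filter)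
      qed
      ultimately have "(?A (laplace f) \<phi> x \<longlongrightarrow> of_real 0 * l' + l) (at_right 0)" by (rule Lim_transform_eventually)
      then show ?thesis using l(2) by (intro exI[of _ l]) simp
    qed
    then show "\<exists>C. \<forall>x. \<exists>l. (?A (laplace f) \<phi> x \<longlongrightarrow> l) (at_right 0) \<and> norm l \<le> C" by blast
  qed
qed

section \<open>Fourier inversion and the converse statement\<close>

lemma gaussian_fourier:
  "(LINT u|lborel. std_normal_density u *\<^sub>R exp (\<i> * of_real (v * u))) = complex_of_real (sqrt (2 * pi) * std_normal_density v)"
proof -
  have "(LINT u|lborel. std_normal_density u *\<^sub>R exp (\<i> * of_real (v * u))) = char std_normal_distribution v"
    unfolding char_def by (subst integral_density) (auto simp: normal_density_nonneg)
  also have "\<dots> = of_real (exp (- (v\<^sup>2) / 2))" unfolding char_std_normal_distribution ..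
  also have "exp (- (v\<^sup>2) / 2) = sqrt (2 * pi) * std_normal_density v" by (simp add: std_normal_density_def)
  finally show ?thesis .
qed

text \<open>Gaussian summation. With a Gaussian factor of argument e u under the integral, Fubini
  applies and the transform of the Gaussian is explicit; after rescaling, the other side averages
  \<phi> over a window of size e. Both sides converge by dominated convergence as e tends to
  0.\<close>

lemma fourier_inversion_0:
  assumes \<phi>: "test_fun_on U \<phi>"
  shows "(LINT u|lborel. fourier \<phi> u) = 2 * of_real pi * \<phi> 0"
proof -
  let ?g = std_normal_density
  define e where "e n = inverse (real (Suc n))" for n
  have e: "e n > 0" "e \<longlonglongrightarrow> 0" for n
    unfolding e_def using LIMSEQ_inverse_real_of_nat by auto
  have ig: "integrable lborel ?g" by (rule integrable_normal_density) simp
  have cg: "continuous_on UNIV ?g" unfolding normal_density_def by (intro continuous_intros) auto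
  have cg0: "isCont ?g 0" using cg by (simp add: continuous_on_eq_continuous_at)
  have mg [measurable]: "?g \<in> borel_measurable borel" by (rule borel_measurable_normal_density)
  note ip = test_fun_integrable[OF \<phi>]
  have mp [measurable]: "\<phi> \<in> borel_measurable borel" using ip by auto
  have cp: "continuous_on UNIV \<phi>" using smooth_fun_continuous[OF test_fun_smooth[OF \<phi>]] .
  have mf [measurable]: "fourier \<phi> \<in> borel_measurable borel" by (rule fourier_measurable[OF ip])
  have gb: "norm (?g z) \<le> 1" for z
  proof -
    have "?g z \<le> 1 / sqrt (2 * pi)" by (simp add: std_normal_density_def divide_right_mono)
    also have "\<dots> \<le> 1" using pi_gt3 by simp
    finally show ?thesis by (simp add: normal_density_nonneg)
  qed
  obtain D a M where "\<And>n::nat. \<And>x. norm (D n x) \<le> M n" "D 0 = \<phi>" using test_fun_derivs[OF \<phi>] by blast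
  then have M: "norm (\<phi> x) \<le> M 0" for x by metis
  have scaled: "(LINT u|lborel. of_real (?g (e n * u)) * fourier \<phi> u) = 
      of_real (sqrt (2 * pi)) * (LINT z|lborel. of_real (?g z) * \<phi> (e n * z))" for n
  proof -
    let ?H = "\<lambda>u y. of_real (?g (e n * u)) * (exp (- \<i> * of_real (u * y)) * \<phi> y)"
    have igs: "integrable lborel (\<lambda>u. complex_of_real (?g (0 + e n * u)))"
      using lborel_integrable_real_affine[OF ig, of "e n" 0] e(1)[of n] by (simp add: complex_of_real_integrable_eq)
    have [measurable]: "(\<lambda>p::real \<times> real. exp (- (\<i> * (complex_of_real (fst p) * of_real (snd p))))) \<in> borel_measurable (borel \<Otimes>\<^sub>M borel)"
      unfolding borel_prod by (intro borel_measurable_continuous_onI continuous_intros)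
    have int: "integrable (lborel \<Otimes>\<^sub>M lborel) (case_prod ?H)"
    proof (rule Bochner_Integration.integrable_bound[OF integrable_mult_prod[OF igs ip]])
      show "case_prod ?H \<in> borel_measurable (lborel \<Otimes>\<^sub>M lborel)" by (simp add: split_def)
    qed (auto simp: norm_mult)
    have inner: "(LINT u|lborel. ?H u y) = \<phi> y * of_real (sqrt (2 * pi) * ?g (y / e n) / e n)" for y
    proof -
      have "(LINT u|lborel. of_real (?g (e n * u)) * exp (- \<i> * of_real (u * y)))
          = \<bar>1 / e n\<bar> *\<^sub>R (LINT u|lborel. of_real (?g (e n * (0 + (1 / e n) * u))) * exp (- \<i> * of_real ((0 + (1 / e n) * u) * y)))"
        by (rule lborel_integral_real_affine) (use e(1)[of n] in simp)
      also have "\<dots> = of_real (1 / e n) * (LINT u|lborel. ?g u *\<^sub>R exp (\<i> * of_real ((- y / e n) * u)))"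
        using e(1)[of n] by (simp add: scaleR_conv_of_real mult_ac)
      also have "\<dots> = of_real (1 / e n) * of_real (sqrt (2 * pi) * ?g (- y / e n))"
        unfolding gaussian_fourier ..
      also have "?g (- y / e n) = ?g (y / e n)" by (simp add: std_normal_density_def)
      finally have "(LINT u|lborel. of_real (?g (e n * u)) * exp (- \<i> * of_real (u * y))) = of_real (1 / e n) * of_real (sqrt (2 * pi) * ?g (y / e n))" .
      moreover have "(LINT u|lborel. ?H u y) = (LINT u|lborel. of_real (?g (e n * u)) * exp (- \<i> * of_real (u * y))) * \<phi> y"
        by (subst integral_mult_left_zero[symmetric]) (simp add: mult.assoc)
      ultimately show ?thesis by simp
    qed
    have "(LINT u|lborel. of_real (?g (e n * u)) * fourier \<phi> u) = (LINT u|lborel. LINT y|lborel. ?H u y)"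
      unfolding fourier_def integral_mult_right_zero ..
    also have "\<dots> = (LINT y|lborel. LINT u|lborel. ?H u y)"
      by (rule lborel_pair.Fubini_integral[OF int, symmetric])
    also have "\<dots> = (LINT y|lborel. \<phi> y * of_real (sqrt (2 * pi) * ?g (y / e n) / e n))" unfolding inner ..
    also have "\<dots> = \<bar>e n\<bar> *\<^sub>R (LINT z|lborel. \<phi> (0 + e n * z) * of_real (sqrt (2 * pi) * ?g ((0 + e n * z) / e n) / e n))"
      by (rule lborel_integral_real_affine) (use e(1)[of n] in simp)
    also have "\<dots> = (LINT z|lborel. of_real (sqrt (2 * pi)) * (of_real (?g z) * \<phi> (e n * z)))"
      unfolding integral_scaleR_right[symmetric]
      by (rule Bochner_Integration.integral_cong[OF refl]) (use e(1)[of n] in \<open>simp add: scaleR_conv_of_real mult_ac\<close>)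
    finally show ?thesis by simp
  qed
  have "(\<lambda>n. LINT u|lborel. of_real (?g (e n * u)) * fourier \<phi> u) \<longlonglongrightarrow> (LINT u|lborel. of_real (?g 0) * fourier \<phi> u)"
  proof (rule integral_dominated_convergence[where w="\<lambda>u. norm (fourier \<phi> u)"])
    show "integrable lborel (\<lambda>u. norm (fourier \<phi> u))" using fourier_test_integrable[OF \<phi>] by simp
    show "AE u in lborel. (\<lambda>n. of_real (?g (e n * u)) * fourier \<phi> u) \<longlonglongrightarrow> of_real (?g 0) * fourier \<phi> u"
    proof (rule AE_I2)
      fix u
      have "(\<lambda>n. e n * u) \<longlonglongrightarrow> 0 * u" by (intro tendsto_intros e)
      then have "(\<lambda>n. ?g (e n * u)) \<longlonglongrightarrow> ?g 0" by (intro isCont_tendsto_compose[OF cg0]) simp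
      then show "(\<lambda>n. of_real (?g (e n * u)) * fourier \<phi> u) \<longlonglongrightarrow> of_real (?g 0) * fourier \<phi> u" by (intro tendsto_intros)
    qed
    show "AE u in lborel. norm (of_real (?g (e n * u)) * fourier \<phi> u) \<le> norm (fourier \<phi> u)" for n
      using gb by (intro AE_I2) (simp add: norm_mult mult_left_le_one_le)
  qed simp_all
  moreover have "(\<lambda>n. of_real (sqrt (2 * pi)) * (LINT z|lborel. of_real (?g z) * \<phi> (e n * z))) \<longlonglongrightarrow> 
      of_real (sqrt (2 * pi)) * (LINT z|lborel. of_real (?g z) * \<phi> 0)"
  proof (rule tendsto_mult_left, rule integral_dominated_convergence[where w="\<lambda>z. M 0 * ?g z"])
    show "integrable lborel (\<lambda>z. M 0 * ?g z)" using ig by simp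
    show "AE z in lborel. (\<lambda>n. of_real (?g z) * \<phi> (e n * z)) \<longlonglongrightarrow> of_real (?g z) * \<phi> 0"
    proof (rule AE_I2)
      fix z
      have "(\<lambda>n. e n * z) \<longlonglongrightarrow> 0 * z" by (intro tendsto_intros e)
      then have "(\<lambda>n. \<phi> (e n * z)) \<longlonglongrightarrow> \<phi> 0"
        using cp by (intro isCont_tendsto_compose[where g=\<phi>]) (auto simp: continuous_on_eq_continuous_at)
      then show "(\<lambda>n. of_real (?g z) * \<phi> (e n * z)) \<longlonglongrightarrow> of_real (?g z) * \<phi> 0" by (intro tendsto_intros)
    qed
    show "AE z in lborel. norm (of_real (?g z) * \<phi> (e n * z)) \<le> M 0 * ?g z" for n
    proof (rule AE_I2)
      fix z
      have "?g z * norm (\<phi> (e n * z)) \<le> ?g z * M 0" by (intro mult_left_mono M) (simp add: normal_density_nonneg)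
      then show "norm (of_real (?g z) * \<phi> (e n * z)) \<le> M 0 * ?g z"
        by (simp add: norm_mult normal_density_nonneg mult.commute)
    qed
  qed simp_all
  ultimately have "(LINT u|lborel. of_real (?g 0) * fourier \<phi> u) = of_real (sqrt (2 * pi)) * (LINT z|lborel. of_real (?g z) * \<phi> 0)"
    unfolding scaled by (rule LIMSEQ_unique)
  then have "of_real (?g 0) * (LINT u|lborel. fourier \<phi> u) = of_real (sqrt (2 * pi)) * \<phi> 0"
    using integral_normal_density[of 1 0] by (simp add: integral_complex_of_real)
  \<comment> \<open>The density at 0 is 1 / sqrt (2 pi). Multiplying by its reciprocal isolates the
    integral and collects 2 pi on the right.\<close>
  then have "of_real (sqrt (2 * pi)) * (of_real (?g 0) * (LINT u|lborel. fourier \<phi> u)) = of_real (sqrt (2 * pi) * sqrt (2 * pi)) * \<phi> 0"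
    by (simp only: of_real_mult mult.assoc)
  moreover have "of_real (sqrt (2 * pi)) * complex_of_real (?g 0) = 1"
    unfolding of_real_mult[symmetric] by (simp add: std_normal_density_def)
  ultimately have "(LINT u|lborel. fourier \<phi> u) = of_real (sqrt (2 * pi) * sqrt (2 * pi)) * \<phi> 0"
    by (simp only: mult.assoc[symmetric] mult_1_left)
  also have "sqrt (2 * pi) * sqrt (2 * pi) = 2 * pi" by simp
  finally show ?thesis by simp
qed

lemma fourier_translate: "fourier (\<lambda>s. \<phi> (s + t)) u = exp (\<i> * of_real (u * t)) * fourier \<phi> u"
proof -
  have "fourier (\<lambda>s. \<phi> (s + t)) u = (LINT x|lborel. exp (- \<i> * of_real (u * (- t + 1 * x))) * \<phi> (- t + 1 * x + t))"
    unfolding fourier_def by (subst lborel_integral_real_affine[of 1 _ "- t"]) auto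
  also have "\<dots> = (LINT x|lborel. exp (\<i> * of_real (u * t)) * (exp (- \<i> * of_real (u * x)) * \<phi> x))"
    unfolding mult.assoc[symmetric] exp_add[symmetric] by (rule Bochner_Integration.integral_cong) (auto simp: algebra_simps)
  finally show ?thesis by (simp add: fourier_def)
qed

lemma fourier_inversion:
  assumes \<phi>: "test_fun_on U \<phi>"
  shows "(LINT u|lborel. fourier \<phi> u * exp (\<i> * of_real (u * t))) = 2 * of_real pi * \<phi> t"
proof -
  have "test_fun_on {x. 1 * x + t \<in> U} (\<lambda>x. \<phi> (1 * x + t))" by (rule test_fun_affine[OF \<phi>]) simp
  from fourier_inversion_0[OF this] show ?thesis by (simp add: fourier_translate mult.commute)
qed

text \<open>Convolution on the transform side is multiplication on the other: Fubini moves the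
  u-integral inside, where it is the inversion formula for \<phi> at t.\<close>

lemma fourier_product:
  assumes \<phi>: "test_fun_on U \<phi>" and \<psi>: "test_fun_on V \<psi>"
  shows "(LINT u|lborel. fourier \<psi> (x - u) * fourier \<phi> u) = 2 * of_real pi * fourier (\<lambda>t. \<psi> t * \<phi> t) x"
proof -
  let ?H = "\<lambda>u t. (fourier \<phi> u * \<psi> t) * exp (\<i> * of_real ((u - x) * t))"
  note i\<psi> = test_fun_integrable[OF \<psi>]
  have [measurable]: "fourier \<phi> \<in> borel_measurable borel" "\<psi> \<in> borel_measurable borel"
    using fourier_measurable[OF test_fun_integrable[OF \<phi>]] i\<psi> by auto
  have [measurable]: "(\<lambda>p::real \<times> real. exp (\<i> * ((complex_of_real (fst p) - of_real x) * of_real (snd p)))) \<in> borel_measurable (borel \<Otimes>\<^sub>M borel)"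
    unfolding borel_prod by (intro borel_measurable_continuous_onI continuous_intros)
  have int: "integrable (lborel \<Otimes>\<^sub>M lborel) (case_prod ?H)"
  proof (rule Bochner_Integration.integrable_bound[OF integrable_mult_prod[OF fourier_test_integrable[OF \<phi>] i\<psi>]])
    show "case_prod ?H \<in> borel_measurable (lborel \<Otimes>\<^sub>M lborel)" by (simp add: split_def)
  qed (auto simp: norm_mult)
  have "(LINT u|lborel. fourier \<psi> (x - u) * fourier \<phi> u) = (LINT u|lborel. LINT t|lborel. ?H u t)"
  proof (rule Bochner_Integration.integral_cong[OF refl])
    fix u
    have "?H u t = (exp (- \<i> * of_real ((x - u) * t)) * \<psi> t) * fourier \<phi> u" for t
      by (simp add: algebra_simps)
    then show "fourier \<psi> (x - u) * fourier \<phi> u = (LINT t|lborel. ?H u t)"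
      unfolding fourier_def[of \<psi>] by (simp only: integral_mult_left_zero)
  qed
  also have "\<dots> = (LINT t|lborel. LINT u|lborel. ?H u t)"
    by (rule lborel_pair.Fubini_integral[OF int, symmetric])
  also have "\<dots> = (LINT t|lborel. 2 * of_real pi * (exp (- \<i> * of_real (x * t)) * (\<psi> t * \<phi> t)))"
  proof (rule Bochner_Integration.integral_cong[OF refl])
    fix t
    have "?H u t = (exp (- \<i> * of_real (x * t)) * \<psi> t) * (fourier \<phi> u * exp (\<i> * of_real (u * t)))" for u
      by (simp add: algebra_simps exp_diff exp_minus divide_inverse)
    then have "(LINT u|lborel. ?H u t) = (exp (- \<i> * of_real (x * t)) * \<psi> t) * (LINT u|lborel. fourier \<phi> u * exp (\<i> * of_real (u * t)))"
      by (simp only: integral_mult_right_zero)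
    then show "(LINT u|lborel. ?H u t) = 2 * of_real pi * (exp (- \<i> * of_real (x * t)) * (\<psi> t * \<phi> t))"
      unfolding fourier_inversion[OF \<phi>] by (simp add: mult_ac)
  qed
  finally show ?thesis by (simp only: fourier_def integral_mult_right_zero)
qed

lemma cutoff_exists:
  obtains \<psi> where "test_fun_on UNIV \<psi>" "\<And>t. \<bar>t - t0\<bar> \<le> 1 \<Longrightarrow> \<psi> t = 1"
proof -
  let ?\<psi> = "\<lambda>t. complex_of_real (step_fun (1 * t + (2 - t0))) * complex_of_real (step_fun ((- 1) * t + (2 + t0)))"
  have nz: "t \<in> {t0 - 2..t0 + 2}" if "?\<psi> t \<noteq> 0" for t
    using that step_fun_0[of "1 * t + (2 - t0)"] step_fun_0[of "(- 1) * t + (2 + t0)"] by force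
  have "test_fun_on UNIV ?\<psi>"
  proof (rule test_funI[where C="{t0 - 2..t0 + 2}"])
    show "smooth_fun ?\<psi>"
      by (intro smooth_fun_mult smooth_fun_affine[OF smooth_step])
    show "bounded {x. ?\<psi> x \<noteq> 0}" by (rule bounded_subset[of "{t0 - 2..t0 + 2}"]) (use nz in auto)
  qed (use nz in auto)
  moreover have "?\<psi> t = 1" if "\<bar>t - t0\<bar> \<le> 1" for t
    using that by (simp add: step_fun_1)
  ultimately show thesis by (rule that)
qed

text \<open>The natural candidate for the transform is 2 pi f(- u). Its part beyond X is bounded and
  small at infinity, as required, but the head \<open>f1\<close> need not be bounded. Near t0 the
  head may be replaced by its convolution with the transform of a cutoff \<psi>: this does not
  change the action on test functions on which \<psi> is 1, and the convolution is bounded and tends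
  to 0.\<close>

theorem local_pf_boundary_of_tendsto_0:
  assumes f: "laplace_able f" and lim: "(f \<longlongrightarrow> 0) at_top"
  shows "local_pf_boundary UNIV (laplace f)"
proof -
  obtain X0 where X0: "\<And>x. x \<ge> X0 \<Longrightarrow> norm (f x) < 1"
    using tendstoD[OF lim, of 1] unfolding eventually_at_top_linorder by auto
  define X where "X = max X0 0"
  have X: "X \<ge> 0" "\<And>x. x > X \<Longrightarrow> norm (f x) \<le> 1" using X0 by (auto simp: X_def less_imp_le)
  have [measurable]: "f \<in> borel_measurable borel" using laplace_ableD f by auto
  define f1 where "f1 u = indicator {..X} u *\<^sub>R f u" for u
  define f2 where "f2 u = f u - f1 u" for u
  have [measurable]: "f1 \<in> borel_measurable borel" "f2 \<in> borel_measurable borel"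
    unfolding f1_def[abs_def] f2_def[abs_def] by measurable
  have if1: "integrable lborel f1" unfolding f1_def[abs_def] by (rule laplace_able_head[OF f])
  have f1_0: "f1 u = 0" if "u \<notin> {0..X}" for u using that laplace_ableD(2)[OF f] by (auto simp: f1_def indicator_def)
  have f2_eq: "f2 u = (if u \<le> X then 0 else f u)" for u by (simp add: f2_def f1_def)
  define I1 where "I1 = (LINT x|lborel. norm (f1 x))"
  have I1: "I1 \<ge> 0" unfolding I1_def by simp
  define T where "T \<phi> = (LINT u|lborel. f u * fourier \<phi> u)" for \<phi>
  have if\<phi>: "integrable lborel (\<lambda>u. f u * fourier \<phi> u)" if "test_fun_on U \<phi>" for U \<phi>
    by (rule tail_bounded_integrable[OF f X(2) fourier_test_integrable[OF that] fourier_norm_le])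
  show ?thesis unfolding local_pf_boundary_def boundary_behavior_def
  proof (intro exI[of _ T] conjI allI impI)
    fix \<phi> assume \<phi>: "test_fun_on UNIV \<phi>"
    have ev: "\<forall>\<^sub>F \<sigma> in at_right 0. (LINT u|lborel. of_real (exp (- \<sigma> * u)) * f u * fourier \<phi> u) = (LINT t|lborel. laplace f (Complex \<sigma> t) * \<phi> t)"
      using laplace_parseval(2)[OF f \<phi>] by (auto simp: eventually_at_filter simp del: mult_minus_left)
    show "((\<lambda>\<sigma>. LINT t|lborel. laplace f (Complex \<sigma> t) * \<phi> t) \<longlongrightarrow> T \<phi>) (at_right 0)"
      unfolding T_def
      by (rule Lim_transform_eventually[OF laplace_weight_limit[OF f if\<phi>[OF \<phi>]] ev])
        (rule fourier_measurable[OF test_fun_integrable[OF \<phi>]])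
  next
    show "local_pseudofunction UNIV T" unfolding local_pseudo_def
    proof (intro ballI)
      fix t0 :: real
      obtain \<psi> where \<psi>: "test_fun_on UNIV \<psi>" "\<And>t. \<bar>t - t0\<bar> \<le> 1 \<Longrightarrow> \<psi> t = 1" using cutoff_exists by blast
      have [measurable]: "fourier \<psi> \<in> borel_measurable borel" by (rule fourier_measurable[OF test_fun_integrable[OF \<psi>(1)]])
      obtain N where N: "N > 0" "\<And>u. norm (fourier \<psi> u) \<le> N / (1 + u\<^sup>2)" using fourier_test_decay[OF \<psi>(1)] by blast
      \<comment> \<open>\<open>k\<close> is the head convolved with the transform of \<psi>,
        reflected. The factor 2 pi is attached to \<open>f2\<close> only, since for \<open>k\<close>
        the product formula supplies it.\<close>
      define k where "k u = (LINT x|lborel. f1 x * fourier \<psi> (x + u))" for u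
      define h where "h u = 2 * of_real pi * f2 (- u) + k u" for u
      have [measurable]: "k \<in> borel_measurable borel"
        unfolding k_def[abs_def] by measurable
      \<comment> \<open>For x in [0, X] the modulus of x + u is at least \<bar>u\<bar> - X. Clipping
        at 0 keeps the quadratic bound valid for small u.\<close>
      have k_le: "norm (k u) \<le> I1 * (N / (1 + (max 0 (\<bar>u\<bar> - X))\<^sup>2))" for u
      proof -
        let ?m = "max 0 (\<bar>u\<bar> - X)"
        have "norm (k u) \<le> (LINT x|lborel. norm (f1 x * fourier \<psi> (x + u)))" unfolding k_def by (rule integral_norm_bound)
        also have "\<dots> \<le> (LINT x|lborel. norm (f1 x) * (N / (1 + ?m\<^sup>2)))"
        proof (rule Bochner_Integration.integral_mono')
          show "norm (f1 x * fourier \<psi> (x + u)) \<le> norm (f1 x) * (N / (1 + ?m\<^sup>2))" for x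
          proof (cases "x \<in> {0..X}")
            case True
            have "?m \<le> \<bar>x + u\<bar>" using True by auto
            then have "?m\<^sup>2 \<le> (x + u)\<^sup>2" by (metis abs_le_square_iff abs_of_nonneg max.cobounded1)
            then have "N / (1 + (x + u)\<^sup>2) \<le> N / (1 + ?m\<^sup>2)" using N(1) by (intro divide_left_mono) (auto intro!: mult_pos_pos add_pos_nonneg)
            then have "norm (fourier \<psi> (x + u)) \<le> N / (1 + ?m\<^sup>2)" using N(2) by (rule order_trans[rotated])
            then show ?thesis unfolding norm_mult by (intro mult_left_mono) auto
          qed (simp add: f1_0)
        qed (use if1 N in auto)
        also have "\<dots> = I1 * (N / (1 + ?m\<^sup>2))" unfolding I1_def by (rule integral_mult_left_zero)
        finally show ?thesis .
      qed
      have k_lim: "(k \<longlongrightarrow> 0) at_infinity"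
      proof (rule Lim_null_comparison)
        show "\<forall>\<^sub>F u in at_infinity. norm (k u) \<le> I1 * (N / (1 + (max 0 (\<bar>u\<bar> - X))\<^sup>2))" using k_le by simp
        have "filterlim (\<lambda>u::real. norm u) at_top at_infinity" by (rule filterlim_norm_at_top)
        moreover have "((\<lambda>v. I1 * (N / (1 + (max 0 (v - X))\<^sup>2))) \<longlongrightarrow> 0) at_top"
        proof (rule Lim_transform_eventually)
          show "((\<lambda>v. I1 * (N / (1 + (v - X)\<^sup>2))) \<longlongrightarrow> 0) at_top" by real_asymp
          show "\<forall>\<^sub>F v in at_top. I1 * (N / (1 + (v - X)\<^sup>2)) = I1 * (N / (1 + (max 0 (v - X))\<^sup>2))"
            using eventually_ge_at_top[of X] by eventually_elim (simp add: max_def)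
        qed
        ultimately have "((\<lambda>u. I1 * (N / (1 + (max 0 (norm u - X))\<^sup>2))) \<longlongrightarrow> 0) (at_infinity :: real filter)"
          by (rule filterlim_compose[rotated])
        then show "((\<lambda>u. I1 * (N / (1 + (max 0 (\<bar>u\<bar> - X))\<^sup>2))) \<longlongrightarrow> 0) at_infinity" by simp
      qed
      \<comment> \<open>Both ends of the line occur. As u tends to plus infinity, f2(- u) is 0
        because - u \<le> X; only at minus infinity is the limit of f used.\<close>
      have f2_lim: "((\<lambda>u. f2 (- u)) \<longlongrightarrow> 0) at_infinity"
        unfolding tendsto_iff eventually_at_infinity
      proof (intro allI impI)
        fix e :: real assume e: "e > 0"
        obtain B where B: "\<And>x. x \<ge> B \<Longrightarrow> dist (f x) 0 < e"
          using tendstoD[OF lim e] unfolding eventually_at_top_linorder by auto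
        have "dist (f2 (- u)) 0 < e" if "norm u \<ge> max B 0" for u
          using that B[of "- u"] e X(1) by (auto simp: f2_eq abs_if split: if_splits)
        then show "\<exists>b. \<forall>x. b \<le> norm x \<longrightarrow> dist (f2 (- x)) 0 < e" by blast
      qed
      have pf: "pf_transform h" unfolding pf_transform_def pm_transform_def
      proof (intro conjI)
        show "h \<in> borel_measurable lborel" unfolding h_def[abs_def] by measurable
        have "norm (h u) \<le> 2 * pi * 1 + I1 * N" for u
        proof -
          have "1 \<le> 1 + (max 0 (\<bar>u\<bar> - X))\<^sup>2" by simp
          then have "N / (1 + (max 0 (\<bar>u\<bar> - X))\<^sup>2) \<le> N / 1" using N(1) by (intro divide_left_mono) (auto intro: add_pos_nonneg)
          then have "norm (k u) \<le> I1 * N"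
            using I1 by (intro order_trans[OF k_le] mult_left_mono) auto
          moreover have "norm (2 * complex_of_real pi * f2 (- u)) \<le> 2 * pi * 1"
            using X(2)[of "- u"] unfolding norm_mult by (intro mult_mono) (auto simp: f2_eq)
          ultimately show ?thesis unfolding h_def by (intro order_trans[OF norm_triangle_ineq] add_mono)
        qed
        then show "bounded (range h)" unfolding bounded_iff by blast
        have "(h \<longlongrightarrow> 2 * complex_of_real pi * 0 + 0) at_infinity"
          unfolding h_def[abs_def] by (intro tendsto_intros f2_lim k_lim)
        then show "(h \<longlongrightarrow> 0) at_infinity" by simp
      qed
      have "T \<phi> = ft_action h \<phi>" if \<phi>: "test_fun_on {t0 - 1<..<t0 + 1} \<phi>" for \<phi>
      proof -
        note i\<phi> = fourier_test_integrable[OF \<phi>]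
        have [measurable]: "fourier \<phi> \<in> borel_measurable borel" by (rule fourier_measurable[OF test_fun_integrable[OF \<phi>]])
        have \<psi>\<phi>: "(\<lambda>t. \<psi> t * \<phi> t) = \<phi>"
        proof
          fix t
          have "t \<in> {t0 - 1<..<t0 + 1}" if "\<phi> t \<noteq> 0" 
            using \<phi> that closure_subset[of "{x. \<phi> x \<noteq> 0}"] unfolding test_fun_on_def by blast
          then show "\<psi> t * \<phi> t = \<phi> t" using \<psi>(2)[of t] by (cases "\<phi> t = 0") (auto simp: abs_le_iff)
        qed
        let ?H = "\<lambda>x u. f1 x * fourier \<psi> (x - u) * fourier \<phi> u"
        have int: "integrable (lborel \<Otimes>\<^sub>M lborel) (case_prod ?H)"
        proof (rule Bochner_Integration.integrable_bound)
          show "integrable (lborel \<Otimes>\<^sub>M lborel) (\<lambda>p. of_real N * (case p of (x, u) \<Rightarrow> f1 x * fourier \<phi> u))"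
            by (intro integrable_mult_right integrable_mult_prod if1 i\<phi>)
          have N': "norm (fourier \<psi> v) \<le> N" for v
          proof -
            have "N / (1 + v\<^sup>2) \<le> N / 1" using N(1) by (intro divide_left_mono) (auto intro: add_pos_nonneg)
            then show ?thesis using N(2)[of v] by simp
          qed
          show "AE p in lborel \<Otimes>\<^sub>M lborel. norm (case_prod ?H p) \<le> norm (of_real N * (case p of (x, u) \<Rightarrow> f1 x * fourier \<phi> u))"
          proof (rule AE_I2, clarify)
            fix x u
            have "norm (f1 x) * norm (fourier \<psi> (x - u)) * norm (fourier \<phi> u) \<le> norm (f1 x) * N * norm (fourier \<phi> u)"
              by (intro mult_right_mono mult_left_mono N') auto
            then show "norm (?H x u) \<le> norm (of_real N * (f1 x * fourier \<phi> u))" using N(1) by (simp add: norm_mult mult_ac)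
          qed
        qed simp
        have neg: "(LINT u|lborel. q (- u)) = (LINT u|lborel. q u)" for q :: "real \<Rightarrow> complex"
          using integral_reflect_shift[of q 0] by simp
        have i1: "integrable lborel (\<lambda>u. f1 u * fourier \<phi> u)"
        proof (rule Bochner_Integration.integrable_bound)
          show "integrable lborel (\<lambda>u. f1 u * of_real (LINT x|lborel. norm (\<phi> x)))" using if1 by simp
          show "AE u in lborel. norm (f1 u * fourier \<phi> u) \<le> norm (f1 u * of_real (LINT x|lborel. norm (\<phi> x)))"
            by (rule AE_I2) (simp add: norm_mult mult_left_mono fourier_norm_le)
        qed simp
        have i2: "integrable lborel (\<lambda>u. f2 u * fourier \<phi> u)"
          unfolding f2_def left_diff_distrib by (intro Bochner_Integration.integrable_diff if\<phi>[OF \<phi>] i1)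
        have kint: "integrable lborel (\<lambda>u. k (- u) * fourier \<phi> u)"
          using lborel_pair.integrable_snd[OF int] by (simp add: k_def)
        have "ft_action h \<phi> = (1 / (2 * of_real pi)) * (LINT u|lborel. h (- u) * fourier \<phi> u)"
          unfolding ft_action_def using neg[of "\<lambda>u. h (- u) * fourier \<phi> u"] by simp
        also have "(LINT u|lborel. h (- u) * fourier \<phi> u) = 2 * of_real pi * (LINT u|lborel. f2 u * fourier \<phi> u) + (LINT u|lborel. k (- u) * fourier \<phi> u)"
          using i2 kint by (simp add: h_def distrib_right mult.assoc)
        also have "(LINT u|lborel. k (- u) * fourier \<phi> u) = (LINT u|lborel. LINT x|lborel. ?H x u)" by (simp add: k_def)
        also have "\<dots> = (LINT x|lborel. LINT u|lborel. ?H x u)" by (rule lborel_pair.Fubini_integral[OF int])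
        also have "\<dots> = 2 * of_real pi * (LINT x|lborel. f1 x * fourier \<phi> x)"
        proof -
          have "(LINT u|lborel. ?H x u) = 2 * of_real pi * (f1 x * fourier \<phi> x)" for x
            unfolding mult.assoc[of "f1 x"] integral_mult_right_zero fourier_product[OF \<phi> \<psi>(1)] \<psi>\<phi>
            by (simp only: mult.left_commute)
          then show ?thesis by (simp only: integral_mult_right_zero)
        qed
        finally have "ft_action h \<phi> = (LINT u|lborel. f2 u * fourier \<phi> u) + (LINT x|lborel. f1 x * fourier \<phi> x)"
          by (simp add: ring_distribs)
        also have "\<dots> = (LINT u|lborel. f2 u * fourier \<phi> u + f1 u * fourier \<phi> u)"
          by (rule Bochner_Integration.integral_add[OF i2 i1, symmetric])
        also have "\<dots> = T \<phi>" unfolding T_def f2_def by (simp add: algebra_simps)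
        finally show ?thesis ..
      qed
      then show "\<exists>V. open V \<and> t0 \<in> V \<and> V \<subseteq> UNIV \<and> (\<exists>h. pf_transform h \<and> (\<forall>\<phi>. test_fun_on V \<phi> \<longrightarrow> T \<phi> = ft_action h \<phi>))"
        using pf by (intro exI[of _ "{t0 - 1<..<t0 + 1}"]) auto
    qed
  qed
qed

section \<open>Boundedness from pseudomeasure behavior at one point\<close>

text \<open>If \<open>P\<close> bounds \<open>- r\<close> up to \<open>N\<close>, averaging to the right of \<open>x\<close> gives \<open>r x \<le> c + P / 3\<close>, and
  averaging to the left then improves the bound to \<open>- r x \<le> c' + P / 9\<close>, so \<open>P\<close> is bounded
  independently of \<open>N\<close>.\<close>

lemma boundedly_decreasing_average_bounded:
  fixes r K :: "real \<Rightarrow> real"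
  assumes K: "\<And>u. K u \<ge> 0" "integrable lborel K" "integrable lborel (\<lambda>u. \<bar>u\<bar> * K u)" "(LINT u|lborel. K u) > 0"
    and r0: "\<And>u. u < X \<Longrightarrow> r u = 0"
    and bd: "\<And>x h. x \<ge> X \<Longrightarrow> h \<ge> 0 \<Longrightarrow> r (x + h) \<ge> r x - C * (1 + h)" and C: "C \<ge> 0"
    and int: "\<And>x. integrable lborel (\<lambda>u. r u * K (u - x))"
    and A: "\<And>x. \<bar>LINT u|lborel. r u * K (u - x)\<bar> \<le> C0"
  shows "\<exists>B. \<forall>x\<ge>X. \<bar>r x\<bar> \<le> B"
proof -
  define \<kappa> where "\<kappa> = (LINT u|lborel. K u)"
  define m where "m = (LINT u|lborel. \<bar>u\<bar> * K u)"
  have \<kappa>: "\<kappa> > 0" using K by (simp add: \<kappa>_def)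
  have m: "m \<ge> 0" unfolding m_def using K by (intro Bochner_Integration.integral_nonneg) auto
  have C0: "C0 \<ge> 0" using A[of 0] by (rule order_trans[OF abs_ge_zero])
  have [measurable]: "K \<in> borel_measurable borel" using K(2) by auto
  \<comment> \<open>With three quarters of the mass inside [-H, H], at most one quarter is left
    outside. The ratio of the two is the factor 1/3 by which each averaging shrinks the a priori
    bound.\<close>
  obtain H where H: "H > 0" "(LINT u|lborel. indicator {-H..H} u * K u) \<ge> 3 / 4 * \<kappa>"
  proof -
    have "((\<lambda>T. LINT u|lborel. indicator {-T..T} u * K u) \<longlongrightarrow> (LINT u|lborel. K u)) at_top"
    proof (rule integral_dominated_convergence_at_top[OF _ _ K(2)])
      show "AE u in lborel. ((\<lambda>T. indicator {-T..T} u * K u) \<longlongrightarrow> K u) at_top"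
      proof (rule AE_I2, rule tendsto_eventually)
        show "\<forall>\<^sub>F T in at_top. indicator {-T..T} u * K u = K u" for u
          using eventually_ge_at_top[of "\<bar>u\<bar>"] by eventually_elim (auto simp: indicator_def)
      qed
      show "\<forall>\<^sub>F T in at_top. AE u in lborel. norm (indicator {-T..T} u * K u) \<le> K u"
        using K(1) by (intro always_eventually allI AE_I2) (auto simp: indicator_def)
    qed simp_all
    then have "\<forall>\<^sub>F T in at_top. 3 / 4 * \<kappa> < (LINT u|lborel. indicator {-T..T} u * K u)"
    proof (rule order_tendstoD(1))
      show "3 / 4 * \<kappa> < (LINT u|lborel. K u)" using \<kappa> unfolding \<kappa>_def by linarith
    qed
    then have "\<forall>\<^sub>F T in at_top. 3 / 4 * \<kappa> < (LINT u|lborel. indicator {-T..T} u * K u) \<and> T > 0"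
      using eventually_gt_at_top[of 0] by (rule eventually_conj)
    then obtain T where "3 / 4 * \<kappa> < (LINT u|lborel. indicator {-T..T} u * K u)" "T > 0"
      unfolding eventually_at_top_linorder by blast
    then show thesis by (intro that[of T]) auto
  qed
  define \<kappa>1 where "\<kappa>1 = (LINT u|lborel. indicator {-H..H} u * K u)"
  have \<kappa>1: "\<kappa>1 \<ge> 3 / 4 * \<kappa>" using H by (simp add: \<kappa>1_def)
  have iK1: "integrable lborel (\<lambda>u. indicator {-H..H} u * K u)"
    by (rule Bochner_Integration.integrable_bound[OF K(2)]) (use K in \<open>auto simp: indicator_def\<close>)
  have w: "integrable lborel (\<lambda>v. (\<alpha> * indicator {-H..H} v + \<beta> + \<gamma> * \<bar>v\<bar> + p * (1 - indicator {-H..H} v)) * K v)"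
    "(LINT v|lborel. (\<alpha> * indicator {-H..H} v + \<beta> + \<gamma> * \<bar>v\<bar> + p * (1 - indicator {-H..H} v)) * K v) = \<alpha> * \<kappa>1 + \<beta> * \<kappa> + \<gamma> * m + p * (\<kappa> - \<kappa>1)"
    for \<alpha> \<beta> \<gamma> p
  proof -
    have eq: "(\<alpha> * indicator {-H..H} v + \<beta> + \<gamma> * \<bar>v\<bar> + p * (1 - indicator {-H..H} v)) * K v
      = \<alpha> * (indicator {-H..H} v * K v) + \<beta> * K v + \<gamma> * (\<bar>v\<bar> * K v) + p * (K v - indicator {-H..H} v * K v)" for v
      by (simp add: algebra_simps)
    show "integrable lborel (\<lambda>v. (\<alpha> * indicator {-H..H} v + \<beta> + \<gamma> * \<bar>v\<bar> + p * (1 - indicator {-H..H} v)) * K v)"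
      unfolding eq by (intro Bochner_Integration.integrable_add integrable_mult_right Bochner_Integration.integrable_diff K iK1)
    show "(LINT v|lborel. (\<alpha> * indicator {-H..H} v + \<beta> + \<gamma> * \<bar>v\<bar> + p * (1 - indicator {-H..H} v)) * K v) = \<alpha> * \<kappa>1 + \<beta> * \<kappa> + \<gamma> * m + p * (\<kappa> - \<kappa>1)"
      unfolding eq \<kappa>_def \<kappa>1_def m_def by (simp add: K iK1)
  qed
  have shift: "(LINT u|lborel. r u * K (u - y)) = (LINT v|lborel. r (y + v) * K v)" 
    "integrable lborel (\<lambda>v. r (y + v) * K v)" for y
    using lborel_integral_real_affine[of 1 "\<lambda>u. r u * K (u - y)" y] lborel_integrable_real_affine[OF int[of y], of 1 y] by simp_all
  let ?b = "C * (1 + H)"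
  define c1 where "c1 = (C0 + ?b * \<kappa> + C * m) / (3 / 4 * \<kappa>)"
  have c1: "c1 \<ge> 0" unfolding c1_def using C0 C H m \<kappa> by (intro divide_nonneg_nonneg add_nonneg_nonneg mult_nonneg_nonneg) auto
  have c1_eq: "3 / 4 * \<kappa> * c1 = C0 + ?b * \<kappa> + C * m" using \<kappa> by (simp add: c1_def)
  \<comment> \<open>The average is centered at x + H. For v \<ge> - H the point x + H + v lies to
    the right of x, where bounded decrease bounds r from below; for v < - H it lies to the left of x
    \<le> N, where the bound - P applies.\<close>
  have upper: "r x \<le> c1 + P / 3" if x: "X \<le> x" "x \<le> N" and P: "P \<ge> 0" "\<And>u. X \<le> u \<Longrightarrow> u \<le> N \<Longrightarrow> - r u \<le> P" for x N P
  proof (cases "r x \<ge> 0")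
    case True
    have "(LINT v|lborel. (r x * indicator {-H..H} v + - ?b + - C * \<bar>v\<bar> + - P * (1 - indicator {-H..H} v)) * K v) \<le> (LINT v|lborel. r (x + H + v) * K v)"
    proof (rule integral_mono[OF w(1) shift(2)], rule mult_right_mono)
      fix v
      show "r x * indicator {-H..H} v + - ?b + - C * \<bar>v\<bar> + - P * (1 - indicator {-H..H} v) \<le> r (x + H + v)"
      proof (cases "v \<ge> - H")
        case v: True
        have "r x - C * (1 + (H + v)) \<le> r (x + (H + v))" using v x by (intro bd) auto
        moreover have "C * v \<le> C * \<bar>v\<bar>" using C by (intro mult_left_mono) auto
        moreover have "r x * indicator {-H..H} v \<le> r x" using True by (auto simp: indicator_def)
        moreover have "P * (1 - indicator {-H..H} v) \<ge> 0" using P by (auto simp: indicator_def)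
        ultimately show ?thesis by (simp add: algebra_simps)
      next
        case False
        then have "- P \<le> r (x + H + v)"
        proof (cases "x + H + v < X")
          case True
          then show ?thesis using P r0 by simp
        next
          case False
          then show ?thesis using P(2)[of "x + H + v"] x \<open>\<not> v \<ge> - H\<close> by simp
        qed
        moreover have "?b \<ge> 0" "C * \<bar>v\<bar> \<ge> 0" using C H by auto
        ultimately show ?thesis using False by (simp add: indicator_def del: mult_minus_left)
      qed
    qed (rule K)
    also have "\<dots> \<le> C0" using A[of "x + H"] unfolding shift(1) by simp
    finally have "r x * \<kappa>1 \<le> C0 + ?b * \<kappa> + C * m + P * (\<kappa> - \<kappa>1)" unfolding w(2) by simp
    moreover have "r x * (3 / 4 * \<kappa>) \<le> r x * \<kappa>1" using \<kappa>1 True by (rule mult_left_mono)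
    moreover have "P * (\<kappa> - \<kappa>1) \<le> P * (\<kappa> / 4)" using \<kappa>1 P by (intro mult_left_mono) auto
    ultimately have "(3 / 4 * \<kappa>) * r x \<le> (3 / 4 * \<kappa>) * (c1 + P / 3)" using c1_eq by (simp add: algebra_simps)
    then show ?thesis using \<kappa> by (simp add: mult_le_cancel_left)
  qed (use c1 P in auto)
  \<comment> \<open>The first entry treats x within 2 H of X, where the window [x - 2 H, x] sticks
    out to the left of X. In the second entry, c1 is the averaging constant and c1 / 3 is the share
    of \<open>upper\<close> outside the window.\<close>
  define c2 where "c2 = max (\<bar>r X\<bar> + C * (1 + 2 * H)) (c1 + c1 / 3)"
  have lower: "- r x \<le> c2 + P / 9" if x: "X \<le> x" "x \<le> N" and P: "P \<ge> 0" "\<And>u. X \<le> u \<Longrightarrow> u \<le> N \<Longrightarrow> - r u \<le> P" for x N P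
  proof -
    consider "x < X + 2 * H" | "r x \<ge> 0" | "x \<ge> X + 2 * H" "r x < 0" by linarith
    then show ?thesis
    proof cases
      case 1
      have "r X - C * (1 + (x - X)) \<le> r (X + (x - X))" using x by (intro bd) auto
      moreover have "C * (1 + (x - X)) \<le> C * (1 + 2 * H)" using C 1 by (intro mult_left_mono) auto
      ultimately have "- r x \<le> \<bar>r X\<bar> + C * (1 + 2 * H)" by simp
      then show ?thesis using P by (simp add: c2_def)
    next
      case 2
      then show ?thesis using P c1 by (simp add: c2_def)
    next
      case 3
      let ?p = "c1 + P / 3"
      \<comment> \<open>Mirror image of \<open>upper\<close>: the average is centered at x - H.
        Inside the window r exceeds r x by at most the admissible decrease, and to the right of x
        the bound from \<open>upper\<close> is inserted.\<close>
      have "(LINT v|lborel. r (x - H + v) * K v) \<le> (LINT v|lborel. (r x * indicator {-H..H} v + ?b + C * \<bar>v\<bar> + ?p * (1 - indicator {-H..H} v)) * K v)"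
      proof (rule integral_mono[OF shift(2) w(1)], rule mult_right_mono)
        fix v
        have p0: "?p * (1 - indicator {-H..H} v) \<ge> 0" using P c1 by (auto simp: indicator_def)
        show "r (x - H + v) \<le> r x * indicator {-H..H} v + ?b + C * \<bar>v\<bar> + ?p * (1 - indicator {-H..H} v)"
        proof (cases "v \<le> H")
          case True
          show ?thesis
          proof (cases "x - H + v < X")
            case True
            then have "v \<notin> {-H..H}" using 3 by auto
            moreover have "?b \<ge> 0" "C * \<bar>v\<bar> \<ge> 0" using C H by auto
            ultimately show ?thesis using p0 r0[OF True] by simp
          next
            case False
            have "r (x - H + v) - C * (1 + (H - v)) \<le> r (x - H + v + (H - v))" using True False by (intro bd) auto
            moreover have "C * (- v) \<le> C * \<bar>v\<bar>" using C by (intro mult_left_mono) auto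
            moreover have "r x \<le> r x * indicator {-H..H} v" using 3 by (auto simp: indicator_def)
            ultimately show ?thesis using p0 by (simp add: algebra_simps)
          qed
        next
          case False
          define u where "u = x - H + v"
          have u: "u \<ge> x" using False by (simp add: u_def)
          \<comment> \<open>The point u may lie beyond N, where P gives no information. Bounded
            decrease starting from N extends the bound to u at a loss that is linear in v, and the
            first moment of K absorbs this loss.\<close>
          define P' where "P' = P + C * (1 + \<bar>v\<bar>)"
          have P': "P' \<ge> P" using C by (simp add: P'_def)
          have "- r w \<le> P'" if w: "X \<le> w" "w \<le> max u N" for w
          proof (cases "w \<le> N")
            case True
            then show ?thesis using P(2)[of w] w P' by simp
          next
            case wN: False
            have "r N - C * (1 + (w - N)) \<le> r (N + (w - N))" using wN x by (intro bd) auto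
            moreover have "C * (1 + (w - N)) \<le> C * (1 + \<bar>v\<bar>)"
              using C wN w x H(1) False by (intro mult_left_mono) (auto simp: u_def max_def split: if_splits)
            moreover have "- r N \<le> P" using P(2)[of N] x by simp
            ultimately show ?thesis by (simp add: P'_def)
          qed
          then have "r u \<le> c1 + P' / 3" using u x P' P by (intro upper[of u "max u N"]) auto
          moreover have "C * (1 + \<bar>v\<bar>) / 3 \<le> C * (1 + \<bar>v\<bar>)" using C by simp
          moreover have "C * (1 + \<bar>v\<bar>) \<le> ?b + C * \<bar>v\<bar>" using C H by (simp add: algebra_simps)
          ultimately have "r u \<le> ?p + ?b + C * \<bar>v\<bar>" unfolding P'_def add_divide_distrib by linarith
          then show ?thesis using False by (simp add: u_def)
        qed
      qed (rule K)
      moreover have "- C0 \<le> (LINT v|lborel. r (x - H + v) * K v)" using A[of "x - H"] unfolding shift(1) by simp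
      ultimately have "- (r x * \<kappa>1) \<le> C0 + ?b * \<kappa> + C * m + ?p * (\<kappa> - \<kappa>1)" unfolding w(2) by simp
      moreover have "- r x * (3 / 4 * \<kappa>) \<le> - r x * \<kappa>1" using \<kappa>1 3 by (intro mult_left_mono) auto
      moreover have "?p * (\<kappa> - \<kappa>1) \<le> ?p * (\<kappa> / 4)" using \<kappa>1 P c1 by (intro mult_left_mono) auto
      ultimately have "- r x * (3 / 4 * \<kappa>) \<le> (C0 + ?b * \<kappa> + C * m) + ?p * (\<kappa> / 4)" by linarith
      also have "\<dots> = (3 / 4 * \<kappa>) * (c1 + c1 / 3 + P / 9)"
        unfolding c1_eq[symmetric] by (simp add: field_simps)
      finally have "(3 / 4 * \<kappa>) * (- r x) \<le> (3 / 4 * \<kappa>) * (c1 + c1 / 3 + P / 9)" by (simp only: mult.commute)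
      then have "- r x \<le> c1 + c1 / 3 + P / 9" using \<kappa> by (simp only: mult_le_cancel_left_pos)
      then show ?thesis by (simp add: c2_def)
    qed
  qed
  have c2: "c2 \<ge> 0" using c1 by (simp add: c2_def)
  have lb: "- r x \<le> 2 * c2" if "x \<ge> X" for x
  proof -
    \<comment> \<open>The supremum over [X, x] is finite by bounded decrease from X, and the
      inserted 0 makes it nonnegative. It satisfies S \<le> c2 + S / 9, hence S \<le> 2 c2,
      independently of x.\<close>
    define S where "S = insert 0 ((\<lambda>u. - r u) ` {X..x})"
    have "bdd_above S" unfolding S_def bdd_above_insert
    proof (intro bdd_aboveI[of _ "\<bar>r X\<bar> + C * (1 + (x - X))"])
      fix y assume "y \<in> (\<lambda>u. - r u) ` {X..x}"
      then obtain u where u: "u \<in> {X..x}" "y = - r u" by auto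
      have "r X - C * (1 + (u - X)) \<le> r (X + (u - X))" using u by (intro bd) auto
      moreover have "C * (1 + (u - X)) \<le> C * (1 + (x - X))" using C u by (intro mult_left_mono) auto
      ultimately show "y \<le> \<bar>r X\<bar> + C * (1 + (x - X))" using u by simp
    qed
    then have S: "y \<le> Sup S" if "y \<in> S" for y using cSup_upper that by blast
    have S0: "Sup S \<ge> 0" by (rule S) (simp add: S_def)
    have SP: "- r u \<le> Sup S" if "X \<le> u" "u \<le> x" for u using that by (intro S) (auto simp: S_def)
    have "Sup S \<le> c2 + Sup S / 9"
    proof (rule cSup_least)
      show "S \<noteq> {}" by (simp add: S_def)
      show "y \<le> c2 + Sup S / 9" if "y \<in> S" for y
        using that S0 c2 lower[of _ x "Sup S", OF _ _ S0 SP] by (auto simp: S_def)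
    qed
    then show ?thesis using SP[of x] that c2 by simp
  qed
  have "\<bar>r x\<bar> \<le> c1 + 2 * c2" if "x \<ge> X" for x
  proof -
    have "r x \<le> c1 + 2 * c2 / 3" using upper[of x x "2 * c2"] lb that c2 by simp
    then show ?thesis using lb[OF that] c1 c2 by (intro abs_leI) linarith+
  qed
  then show ?thesis by blast
qed

lemma linear_weight_integrable:
  fixes K :: "real \<Rightarrow> real"
  assumes "integrable lborel K" "integrable lborel (\<lambda>u. \<bar>u\<bar> * K u)"
  shows "integrable lborel (\<lambda>u. (1 + \<bar>u\<bar>) * K (u - x))"
proof -
  have [measurable]: "K \<in> borel_measurable borel" using assms by auto
  have i1: "integrable lborel (\<lambda>u. K (- x + 1 * u))" using assms(1) by (rule lborel_integrable_real_affine) simp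
  have i2: "integrable lborel (\<lambda>u. \<bar>- x + 1 * u\<bar> * K (- x + 1 * u))" using assms(2) by (rule lborel_integrable_real_affine) simp
  have "integrable lborel (\<lambda>u. (1 + \<bar>x\<bar>) * norm (K (- x + 1 * u)) + norm (\<bar>- x + 1 * u\<bar> * K (- x + 1 * u)))"
    by (intro Bochner_Integration.integrable_add integrable_mult_right integrable_norm i1 i2)
  then show ?thesis
  proof (rule Bochner_Integration.integrable_bound)
    have "norm ((1 + \<bar>u\<bar>) * K (u - x)) \<le> (1 + \<bar>x\<bar>) * norm (K (- x + 1 * u)) + norm (\<bar>- x + 1 * u\<bar> * K (- x + 1 * u))" for u
    proof -
      have "(1 + \<bar>u\<bar>) * \<bar>K (u - x)\<bar> \<le> (1 + \<bar>x\<bar> + \<bar>u - x\<bar>) * \<bar>K (u - x)\<bar>" by (rule mult_right_mono) auto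
      moreover have "\<bar>1 + \<bar>u\<bar>\<bar> = 1 + \<bar>u\<bar>" by simp
      ultimately show ?thesis unfolding real_norm_def abs_mult by (simp add: distrib_right del: abs_add_one_gt_zero)
    qed
    then show "AE u in lborel. norm ((1 + \<bar>u\<bar>) * K (u - x)) \<le> norm ((1 + \<bar>x\<bar>) * norm (K (- x + 1 * u)) + norm (\<bar>- x + 1 * u\<bar> * K (- x + 1 * u)))"
      by (intro AE_I2 order_trans[OF _ abs_ge_self[where 'a=real, folded real_norm_def]])
  qed simp
qed

text \<open>The hypothesis controls averages with the weight exp (- \<sigma> u) in the limit, but
  convergence of the unweighted integral is not given. Bounded decrease yields a linear lower bound
  for the tail; adding an integrable majorant makes the integrand nonnegative, and monotone
  convergence as \<sigma> decreases to 0 gives both integrability and the value.\<close>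

lemma pm_near_Re_bounded:
  assumes f: "laplace_able f" and pm: "pm_near (laplace f) 0" and X: "X \<ge> 0" and C: "C \<ge> 0"
    and bd: "\<And>x h. x \<ge> X \<Longrightarrow> h \<ge> 0 \<Longrightarrow> Re (f (x + h)) \<ge> Re (f x) - C * (1 + h)"
  shows "\<exists>B. \<forall>x\<ge>X. \<bar>Re (f x)\<bar> \<le> B"
proof -
  obtain V where V: "open V" "0 \<in> V" and pm: "\<And>\<phi>. test_fun_on V \<phi> \<Longrightarrow> (\<exists>C. \<forall>x. \<exists>l.
     ((\<lambda>\<sigma>. LINT t|lborel. laplace f (Complex \<sigma> t) * (exp (\<i> * of_real (x * t)) * \<phi> t)) \<longlongrightarrow> l) (at_right 0) \<and> norm l \<le> C)"
    using pm unfolding pm_near_def by blast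
  obtain a where a: "a > 0" "ball 0 a \<subseteq> V" using V openE by blast
  obtain \<phi> K N where k: "test_fun_on {-a<..<a} \<phi>" "\<And>u. fourier \<phi> u = complex_of_real (K u)" "\<And>u. K u \<ge> 0"
    "continuous_on UNIV K" "\<And>u. K u \<le> N / (1 + u\<^sup>2)\<^sup>2" "K 0 > 0" "N \<ge> 0"
    using nonneg_kernel_exists[OF a(1)] by blast
  have "{-a<..<a} \<subseteq> V" using a(2) by (auto simp: ball_def dist_real_def abs_less_iff subset_iff)
  then have \<phi>: "test_fun_on V \<phi>" using k(1) test_fun_mono by blast
  obtain C1 where C1: "\<And>x. \<exists>l. ((\<lambda>\<sigma>. LINT t|lborel. laplace f (Complex \<sigma> t) * (exp (\<i> * of_real (x * t)) * \<phi> t)) \<longlongrightarrow> l) (at_right 0) \<and> norm l \<le> C1"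
    using pm[OF \<phi>] by blast
  have [measurable]: "K \<in> borel_measurable borel" using k(4) by (rule borel_measurable_continuous_onI)
  have [measurable]: "f \<in> borel_measurable borel" using laplace_ableD f by auto
  have q1: "1 + u\<^sup>2 \<ge> 1" for u :: real by simp
  have iN: "integrable lborel (\<lambda>u. N * (1 / (1 + 1\<^sup>2 * u\<^sup>2)))" using lorentz_integral[of 1] by (intro integrable_mult_right) simp
  \<comment> \<open>The kernel decays like u^-4, being the square of a transform with quadratic
    decay. This leaves room for the linear weight and hence for a finite first moment.\<close>
  have KN: "(1 + \<bar>u\<bar>) * K u \<le> 2 * (N / (1 + u\<^sup>2))" for u
  proof -
    have "1 + \<bar>u\<bar> \<le> 2 * (1 + u\<^sup>2)"
    proof -
      have "0 \<le> u\<^sup>2 - 2 * \<bar>u\<bar> + 1" using zero_le_power2[of "\<bar>u\<bar> - 1"] by (simp add: power2_diff)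
      moreover have "1 + v \<le> 2 * (1 + w)" if "0 \<le> w - 2 * v + 1" "0 \<le> w" for v w :: real
        using that by argo
      ultimately show ?thesis by (metis zero_le_power2)
    qed
    then have "(1 + \<bar>u\<bar>) * K u \<le> 2 * (1 + u\<^sup>2) * (N / (1 + u\<^sup>2)\<^sup>2)" using k(5) by (rule mult_mono) (use k(3) in auto)
    also have "\<dots> = 2 * (N / (1 + u\<^sup>2))" 
    proof -
      have "2 * w * (N / w\<^sup>2) = 2 * (N / w)" if "w \<ge> 1" for w :: real
        using that by (simp add: power2_eq_square)
      then show ?thesis using q1[of u] by blast
    qed
    finally show ?thesis .
  qed
  have iK: "integrable lborel K" 
  proof (rule Bochner_Integration.integrable_bound[OF integrable_mult_right[OF iN, of 2]])
    show "AE u in lborel. norm (K u) \<le> norm (2 * (N * (1 / (1 + 1\<^sup>2 * u\<^sup>2))))"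
    proof (rule AE_I2)
      fix u
      have "K u \<le> (1 + \<bar>u\<bar>) * K u" using k(3)[of u] by (simp add: algebra_simps)
      then show "norm (K u) \<le> norm (2 * (N * (1 / (1 + 1\<^sup>2 * u\<^sup>2))))" using KN[of u] k(3)[of u] k(7) q1[of u] by simp
    qed
  qed simp
  have iK1: "integrable lborel (\<lambda>u. \<bar>u\<bar> * K u)" 
  proof (rule Bochner_Integration.integrable_bound[OF integrable_mult_right[OF iN, of 2]])
    show "AE u in lborel. norm (\<bar>u\<bar> * K u) \<le> norm (2 * (N * (1 / (1 + 1\<^sup>2 * u\<^sup>2))))"
    proof (rule AE_I2)
      fix u
      have "\<bar>u\<bar> * K u \<le> (1 + \<bar>u\<bar>) * K u" using k(3)[of u] by (simp add: algebra_simps)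
      then show "norm (\<bar>u\<bar> * K u) \<le> norm (2 * (N * (1 / (1 + 1\<^sup>2 * u\<^sup>2))))" using KN[of u] k(3)[of u] k(7) q1[of u] by (simp add: abs_mult)
    qed
  qed simp
  have Kpos: "(LINT u|lborel. K u) > 0" by (rule integral_pos_continuous[OF iK k(4,3,6)])
  have Kb: "K u \<le> N" for u
  proof -
    have "(1::real) \<le> (1 + u\<^sup>2)\<^sup>2" using q1[of u] by (rule one_le_power)
    then have "N / (1 + u\<^sup>2)\<^sup>2 \<le> N" using k(7) by (simp add: divide_le_eq mult_le_cancel_left1)
    then show ?thesis using k(5)[of u] by linarith
  qed
  \<comment> \<open>Bounded decrease starts at X only. The head \<open>r0\<close> is integrable, so
    its averages are bounded by N times its L1 norm and can be subtracted from the given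
    bound.\<close>
  define r0 where "r0 u = (if u < X then Re (f u) else 0)" for u
  define r where "r u = (if u < X then 0 else Re (f u))" for u
  have [measurable]: "r0 \<in> borel_measurable borel" "r \<in> borel_measurable borel" unfolding r0_def[abs_def] r_def[abs_def] by measurable
  have ir0: "integrable lborel r0"
  proof (rule Bochner_Integration.integrable_bound[OF integrable_norm[OF laplace_able_head[OF f, of X]]])
    show "AE x in lborel. norm (r0 x) \<le> norm (norm (indicator {..X} x *\<^sub>R f x))"
      by (rule AE_I2) (auto simp: r0_def abs_Re_le_cmod)
  qed simp
  \<comment> \<open>A decreasing sequence is chosen for \<sigma>, so that the weights increase with
    n and monotone convergence applies.\<close>
  define e where "e n = inverse (real (Suc n))" for n
  have e: "e n > 0" "e \<longlonglongrightarrow> 0" for n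
    unfolding e_def using LIMSEQ_inverse_real_of_nat by auto
  have e_right: "filterlim e (at_right 0) sequentially"
    unfolding filterlim_at using e by (auto simp: less_imp_neq[symmetric])
  define c where "c = \<bar>Re (f X)\<bar> + C"
  have c: "c \<ge> 0" using C by (simp add: c_def)
  have r_lb: "r u \<ge> - (c * (1 + \<bar>u\<bar>))" for u
  proof (cases "u < X")
    case False
    have "Re (f X) - C * (1 + (u - X)) \<le> Re (f (X + (u - X)))" using False by (intro bd) auto
    moreover have "C * (1 + (u - X)) \<le> C * (1 + \<bar>u\<bar>)" using C X False by (intro mult_left_mono) auto
    moreover have "\<bar>Re (f X)\<bar> \<le> \<bar>Re (f X)\<bar> * (1 + \<bar>u\<bar>)" by (simp add: algebra_simps)
    ultimately have "- (\<bar>Re (f X)\<bar> * (1 + \<bar>u\<bar>) + C * (1 + \<bar>u\<bar>)) \<le> Re (f (X + (u - X)))"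
      using abs_ge_minus_self[of "Re (f X)"] by linarith
    then show ?thesis using False unfolding c_def distrib_right[of "\<bar>Re (f X)\<bar>"] by (simp add: r_def)
  qed (use c in \<open>simp add: r_def\<close>)
  have main: "integrable lborel (\<lambda>u. r u * K (u - x)) \<and> \<bar>LINT u|lborel. r u * K (u - x)\<bar> \<le> C1 + N * (LINT u|lborel. norm (r0 u))" for x
  proof -
    obtain l where l: "((\<lambda>\<sigma>. LINT t|lborel. laplace f (Complex \<sigma> t) * (exp (\<i> * of_real (x * t)) * \<phi> t)) \<longlongrightarrow> l) (at_right 0)" "norm l \<le> C1"
      using C1 by blast
    have iE: "integrable lborel (\<lambda>u. of_real (exp (- e n * u)) * f u * complex_of_real (K (u - x)))" for n
    proof (rule Bochner_Integration.integrable_bound)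
      show "integrable lborel (\<lambda>u. of_real N * (of_real (exp (- e n * u)) * f u))" 
        using laplace_ableD(3)[OF f e(1)] by (rule integrable_mult_right)
      show "AE u in lborel. norm (of_real (exp (- e n * u)) * f u * complex_of_real (K (u - x))) \<le> norm (of_real N * (of_real (exp (- e n * u)) * f u))"
      proof (rule AE_I2)
        have "norm (A * complex_of_real (K v)) \<le> norm (of_real N * A)" for A v
        proof -
          have "\<bar>K v\<bar> * norm A \<le> \<bar>N\<bar> * norm A" using Kb[of v] k(3)[of v] by (intro mult_right_mono) auto
          then show ?thesis by (simp add: norm_mult mult.commute)
        qed
        then show "norm (of_real (exp (- e n * u)) * f u * complex_of_real (K (u - x))) \<le> norm (of_real N * (of_real (exp (- e n * u)) * f u))" for u .
      qed
    qed simp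
    have "(\<lambda>n. LINT t|lborel. laplace f (Complex (e n) t) * (exp (\<i> * of_real (x * t)) * \<phi> t)) \<longlonglongrightarrow> l"
      by (rule filterlim_compose[OF l(1) e_right])
    then have "(\<lambda>n. LINT u|lborel. of_real (exp (- e n * u)) * f u * complex_of_real (K (u - x))) \<longlonglongrightarrow> l"
      unfolding laplace_parseval_modulated[OF f \<phi> e(1)] k(2) .
    then have "(\<lambda>n. Re (LINT u|lborel. of_real (exp (- e n * u)) * f u * complex_of_real (K (u - x)))) \<longlonglongrightarrow> Re l"
      by (rule tendsto_Re)
    moreover have "Re (LINT u|lborel. of_real (exp (- e n * u)) * f u * complex_of_real (K (u - x))) = (LINT u|lborel. exp (- e n * u) * Re (f u) * K (u - x))" for n
      using integral_Re[OF iE[of n]] by simp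
    ultimately have lim: "(\<lambda>n. LINT u|lborel. exp (- e n * u) * Re (f u) * K (u - x)) \<longlonglongrightarrow> Re l" by simp
    have iRe: "integrable lborel (\<lambda>u. exp (- e n * u) * Re (f u) * K (u - x))" for n
      using integrable_Re[OF iE[of n]] by simp
    have e_le: "exp (- e n * u) * \<bar>w\<bar> \<le> \<bar>w\<bar>" if "u \<ge> 0 \<or> w = 0" for n u w
    proof (cases "w = 0")
      case False
      then show ?thesis using that e(1)[of n] by (intro mult_left_le_one_le) auto
    qed simp
    have e_lim: "(\<lambda>n. exp (- e n * u) * w) \<longlonglongrightarrow> w" for u w
    proof -
      have "(\<lambda>n. exp (- e n * u) * w) \<longlonglongrightarrow> exp (- 0 * u) * w" by (intro tendsto_intros e)
      then show ?thesis by simp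
    qed
    have neg0: "Re (f u) = 0" if "u < 0" for u using laplace_ableD(2)[OF f that] by simp
    have ir0K: "integrable lborel (\<lambda>u. N * r0 u)" using ir0 by simp
    have b0: "norm (r0 u * K (u - x)) \<le> \<bar>N * r0 u\<bar>" for u
    proof -
      have "\<bar>r0 u\<bar> * K (u - x) \<le> \<bar>r0 u\<bar> * N" using Kb by (rule mult_left_mono) simp
      then show ?thesis using k(3)[of "u - x"] k(7) by (simp add: abs_mult mult.commute)
    qed
    have i0: "integrable lborel (\<lambda>u. r0 u * K (u - x))"
      by (rule Bochner_Integration.integrable_bound[OF ir0K]) (use b0 in auto)
    have i0e: "integrable lborel (\<lambda>u. exp (- e n * u) * (r0 u * K (u - x)))" for n
    proof (rule Bochner_Integration.integrable_bound[OF i0])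
      show "AE u in lborel. norm (exp (- e n * u) * (r0 u * K (u - x))) \<le> norm (r0 u * K (u - x))"
      proof (rule AE_I2)
        fix u
        have "exp (- e n * u) * \<bar>r0 u * K (u - x)\<bar> \<le> \<bar>r0 u * K (u - x)\<bar>" 
          by (rule e_le) (use neg0[of u] in \<open>auto simp: r0_def not_less[symmetric]\<close>)
        then show "norm (exp (- e n * u) * (r0 u * K (u - x))) \<le> norm (r0 u * K (u - x))" by (simp add: abs_mult)
      qed
    qed simp
    have lim0: "(\<lambda>n. LINT u|lborel. exp (- e n * u) * (r0 u * K (u - x))) \<longlonglongrightarrow> (LINT u|lborel. r0 u * K (u - x))"
    proof (rule integral_dominated_convergence[where w="\<lambda>u. \<bar>r0 u * K (u - x)\<bar>"])
      show "AE u in lborel. norm (exp (- e n * u) * (r0 u * K (u - x))) \<le> \<bar>r0 u * K (u - x)\<bar>" for n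
      proof (rule AE_I2)
        fix u
        have "exp (- e n * u) * \<bar>r0 u * K (u - x)\<bar> \<le> \<bar>r0 u * K (u - x)\<bar>" 
          by (rule e_le) (use neg0[of u] in \<open>auto simp: r0_def not_less[symmetric]\<close>)
        then show "norm (exp (- e n * u) * (r0 u * K (u - x))) \<le> \<bar>r0 u * K (u - x)\<bar>" by (simp add: abs_mult)
      qed
    qed (use i0 e_lim in auto)
    \<comment> \<open>By \<open>r_lb\<close> this dominates the negative part of the tail times the
      kernel, and it is integrable because the kernel has a first moment.\<close>
    define q where "q u = c * (1 + \<bar>u\<bar>) * indicator {X..} u * K (u - x)" for u
    have iq: "integrable lborel q"
    proof (rule Bochner_Integration.integrable_bound[OF integrable_mult_right[OF linear_weight_integrable[OF iK iK1, of x], of c]])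
      show "q \<in> borel_measurable lborel" unfolding q_def[abs_def] by measurable
      show "AE u in lborel. norm (q u) \<le> norm (c * ((1 + \<bar>u\<bar>) * K (u - x)))"
        by (rule AE_I2) (auto simp: q_def indicator_def)
    qed
    have [measurable]: "q \<in> borel_measurable borel" using iq by auto
    have q_nz: "u \<ge> 0 \<or> q u = 0" for u using X by (auto simp: q_def indicator_def)
    have iqe: "integrable lborel (\<lambda>u. exp (- e n * u) * q u)" for n
    proof (rule Bochner_Integration.integrable_bound[OF iq])
      show "AE u in lborel. norm (exp (- e n * u) * q u) \<le> norm (q u)"
        using e_le q_nz by (intro AE_I2) (auto simp: abs_mult)
    qed simp
    have limq: "(\<lambda>n. LINT u|lborel. exp (- e n * u) * q u) \<longlonglongrightarrow> (LINT u|lborel. q u)"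
    proof (rule integral_dominated_convergence[where w="\<lambda>u. \<bar>q u\<bar>"])
      show "AE u in lborel. norm (exp (- e n * u) * q u) \<le> \<bar>q u\<bar>" for n
        using e_le q_nz by (intro AE_I2) (auto simp: abs_mult)
    qed (use iq e_lim in auto)
    define g where "g u = r u * K (u - x) + q u" for u
    have g0: "g u \<ge> 0" for u
    proof (cases "u < X")
      case False
      have "0 \<le> (r u + c * (1 + \<bar>u\<bar>)) * K (u - x)" using r_lb[of u] k(3) by (intro mult_nonneg_nonneg) auto
      then show ?thesis using False by (simp add: g_def q_def algebra_simps)
    qed (simp add: g_def q_def r_def)
    have g_nz: "u \<ge> 0 \<or> g u = 0" for u using X by (auto simp: g_def r_def q_def indicator_def)
    have ge: "exp (- e n * u) * g u = exp (- e n * u) * Re (f u) * K (u - x) - exp (- e n * u) * (r0 u * K (u - x)) + exp (- e n * u) * q u" for n u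
      by (auto simp: g_def r_def r0_def algebra_simps)
    have ige: "integrable lborel (\<lambda>u. exp (- e n * u) * g u)" for n
      unfolding ge by (intro Bochner_Integration.integrable_add Bochner_Integration.integrable_diff iRe i0e iqe)
    have limg: "(\<lambda>n. LINT u|lborel. exp (- e n * u) * g u) \<longlonglongrightarrow> Re l - (LINT u|lborel. r0 u * K (u - x)) + (LINT u|lborel. q u)"
    proof -
      have "(LINT u|lborel. exp (- e n * u) * g u) = (LINT u|lborel. exp (- e n * u) * Re (f u) * K (u - x))
          - (LINT u|lborel. exp (- e n * u) * (r0 u * K (u - x))) + (LINT u|lborel. exp (- e n * u) * q u)" for n
        unfolding ge Bochner_Integration.integral_add[OF Bochner_Integration.integrable_diff[OF iRe i0e] iqe]
          Bochner_Integration.integral_diff[OF iRe i0e] ..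
      then show ?thesis using tendsto_add[OF tendsto_diff[OF lim lim0] limq] by (simp only:)
    qed
    have mono: "AE u in lborel. mono (\<lambda>n. exp (- e n * u) * g u)"
    proof (rule AE_I2)
      fix u
      show "mono (\<lambda>n. exp (- e n * u) * g u)"
      proof (cases "g u = 0")
        case False
        then have "u \<ge> 0" using g_nz by blast
        then show ?thesis using g0[of u] by (auto simp: mono_def e_def intro!: mult_right_mono le_imp_inverse_le)
      qed (simp add: mono_def)
    qed
    have mg: "g \<in> borel_measurable lborel" unfolding g_def[abs_def] by measurable
    have ig: "integrable lborel g"
      by (rule integrable_monotone_convergence[OF ige mono _ limg mg]) (use e_lim in auto)
    have vg: "(LINT u|lborel. g u) = Re l - (LINT u|lborel. r0 u * K (u - x)) + (LINT u|lborel. q u)"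
      by (rule integral_monotone_convergence[OF ige mono _ limg mg]) (use e_lim in auto)
    have gr: "r u * K (u - x) = g u - q u" for u by (simp add: g_def)
    have "integrable lborel (\<lambda>u. r u * K (u - x))" unfolding gr using ig iq by (rule Bochner_Integration.integrable_diff)
    moreover have "(LINT u|lborel. r u * K (u - x)) = Re l - (LINT u|lborel. r0 u * K (u - x))"
      unfolding gr using ig iq vg by simp
    moreover have "\<bar>LINT u|lborel. r0 u * K (u - x)\<bar> \<le> N * (LINT u|lborel. norm (r0 u))"
    proof -
      have "norm (LINT u|lborel. r0 u * K (u - x)) \<le> (LINT u|lborel. norm (r0 u * K (u - x)))" by (rule integral_norm_bound)
      also have "\<dots> \<le> (LINT u|lborel. \<bar>N * r0 u\<bar>)" by (rule integral_mono) (use i0 ir0K b0 in auto)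
      also have "\<dots> = N * (LINT u|lborel. norm (r0 u))" using k(7) by (simp add: abs_mult)
      finally show ?thesis by simp
    qed
    ultimately show ?thesis using l(2) abs_Re_le_cmod[of l] by auto
  qed
  have "\<exists>B. \<forall>x\<ge>X. \<bar>r x\<bar> \<le> B"
  proof (rule boundedly_decreasing_average_bounded[OF k(3) iK iK1 Kpos _ _ C])
    show "r (x + h) \<ge> r x - C * (1 + h)" if "x \<ge> X" "h \<ge> 0" for x h using bd[OF that] that by (simp add: r_def)
  qed (use main in \<open>auto simp: r_def\<close>)
  then show ?thesis by (simp add: r_def)
qed

lemma pm_near_cmult:
  assumes "pm_near F t"
  shows "pm_near (\<lambda>s. c * F s) t"
proof -
  obtain V where V: "open V" "t \<in> V" and pm: "\<And>\<phi>. test_fun_on V \<phi> \<Longrightarrow> (\<exists>C. \<forall>x. \<exists>l.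
     ((\<lambda>\<sigma>. LINT t|lborel. F (Complex \<sigma> t) * (exp (\<i> * of_real (x * t)) * \<phi> t)) \<longlongrightarrow> l) (at_right 0) \<and> norm l \<le> C)"
    using assms unfolding pm_near_def by blast
  show ?thesis unfolding pm_near_def mult.assoc integral_mult_right_zero
  proof (intro exI[of _ V] conjI allI impI V)
    fix \<phi> assume "test_fun_on V \<phi>"
    then obtain C where C: "\<And>x. \<exists>l. ((\<lambda>\<sigma>. LINT t|lborel. F (Complex \<sigma> t) * (exp (\<i> * of_real (x * t)) * \<phi> t)) \<longlongrightarrow> l) (at_right 0) \<and> norm l \<le> C"
      using pm by blast
    have "\<exists>l. ((\<lambda>\<sigma>. c * (LINT t|lborel. F (Complex \<sigma> t) * (exp (\<i> * of_real (x * t)) * \<phi> t))) \<longlongrightarrow> l) (at_right 0) \<and> norm l \<le> norm c * C" for x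
    proof -
      obtain l where "((\<lambda>\<sigma>. LINT t|lborel. F (Complex \<sigma> t) * (exp (\<i> * of_real (x * t)) * \<phi> t)) \<longlongrightarrow> l) (at_right 0)" "norm l \<le> C"
        using C by blast
      then show ?thesis by (intro exI[of _ "c * l"] conjI tendsto_mult_left) (auto simp: norm_mult intro: mult_left_mono)
    qed
    then show "\<exists>C. \<forall>x. \<exists>l. ((\<lambda>\<sigma>. c * (LINT t|lborel. F (Complex \<sigma> t) * (exp (\<i> * of_real (x * t)) * \<phi> t))) \<longlongrightarrow> l) (at_right 0) \<and> norm l \<le> C"
      by blast
  qed
qed

text \<open>The imaginary part of f is the real part of - i f, and the local bounds are invariant
  under scalar multiples, so the result for real parts is used twice.\<close>

lemma pm_near_bounded:
  assumes f: "laplace_able f" and pm: "pm_near (laplace f) 0" and X: "X \<ge> 0" and C: "C \<ge> 0"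
    and Re: "\<And>x h. x \<ge> X \<Longrightarrow> h \<ge> 0 \<Longrightarrow> Re (f (x + h)) \<ge> Re (f x) - C * (1 + h)"
    and Im: "\<And>x h. x \<ge> X \<Longrightarrow> h \<ge> 0 \<Longrightarrow> Im (f (x + h)) \<ge> Im (f x) - C * (1 + h)"
  obtains B where "\<And>x. x \<ge> X \<Longrightarrow> norm (f x) \<le> B"
proof -
  obtain B1 where B1: "\<And>x. x \<ge> X \<Longrightarrow> \<bar>Re (f x)\<bar> \<le> B1"
    using pm_near_Re_bounded[OF f pm X C Re] by blast
  have "pm_near (laplace (\<lambda>x. - \<i> * f x)) 0"
    unfolding laplace_cmult by (rule pm_near_cmult[OF pm])
  from pm_near_Re_bounded[OF laplace_able_cmult[OF f] this X C] Im
  obtain B2 where B2: "\<And>x. x \<ge> X \<Longrightarrow> \<bar>Im (f x)\<bar> \<le> B2" by auto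
  have "norm (f x) \<le> B1 + B2" if "x \<ge> X" for x
    using cmod_le[of "f x"] B1[OF that] B2[OF that] by linarith
  then show thesis by (rule that)
qed

section \<open>Vanishing of averages at infinity\<close>

definition average :: "(real \<Rightarrow> complex) \<Rightarrow> (real \<Rightarrow> complex) \<Rightarrow> real \<Rightarrow> complex" where
  "average f \<phi> x = (LINT u|lborel. f u * fourier \<phi> (u - x))"

text \<open>The trace of local pseudofunction behavior that matters here: averages vanish at plus
  infinity. It is a property of the test functions on V alone, hence can be localized by partitions
  of unity.\<close>

definition regular_on :: "(real \<Rightarrow> complex) \<Rightarrow> real set \<Rightarrow> bool" where
  "regular_on f V \<longleftrightarrow> (\<forall>\<phi>. test_fun_on V \<phi> \<longrightarrow> (average f \<phi> \<longlongrightarrow> 0) at_top)"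

lemma fourier_shift_integrable:
  "test_fun_on U \<phi> \<Longrightarrow> integrable lborel (\<lambda>u. fourier \<phi> (u - x))"
  using lborel_integrable_real_affine[OF fourier_test_integrable, of U \<phi> 1 "- x"] by simp

context
  fixes f :: "real \<Rightarrow> complex" and X B :: real
  assumes f: "laplace_able f" and B: "\<And>x. x > X \<Longrightarrow> norm (f x) \<le> B"
begin

lemma average_integrable:
  assumes "test_fun_on U \<phi>"
  shows "integrable lborel (\<lambda>u. f u * fourier \<phi> (u - x))"
  by (rule tail_bounded_integrable[OF f B fourier_shift_integrable[OF assms] fourier_norm_le])

lemma average_boundary:
  assumes \<phi>: "test_fun_on U \<phi>"
  shows "((\<lambda>\<sigma>. LINT t|lborel. laplace f (Complex \<sigma> t) * (exp (\<i> * of_real (x * t)) * \<phi> t)) \<longlongrightarrow> average f \<phi> x) (at_right 0)"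
proof (rule Lim_transform_eventually)
  show "((\<lambda>\<sigma>. LINT u|lborel. of_real (exp (- \<sigma> * u)) * f u * fourier \<phi> (u - x)) \<longlongrightarrow> average f \<phi> x) (at_right 0)"
    unfolding average_def
    by (rule laplace_weight_limit[OF f average_integrable[OF \<phi>]]) (use fourier_shift_integrable[OF \<phi>] in auto)
  show "\<forall>\<^sub>F \<sigma> in at_right 0. (LINT u|lborel. of_real (exp (- \<sigma> * u)) * f u * fourier \<phi> (u - x)) =
      (LINT t|lborel. laplace f (Complex \<sigma> t) * (exp (\<i> * of_real (x * t)) * \<phi> t))"
    using laplace_parseval_modulated[OF f \<phi>] by (auto simp: eventually_at_filter simp del: mult_minus_left)
qed

lemma average_sum:
  assumes "\<And>i. i \<in> I \<Longrightarrow> test_fun_on U (\<phi> i)"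
  shows "average f (\<lambda>t. \<Sum>i\<in>I. \<phi> i t) x = (\<Sum>i\<in>I. average f (\<phi> i) x)"
proof -
  have "fourier (\<lambda>t. \<Sum>i\<in>I. \<phi> i t) u = (\<Sum>i\<in>I. fourier (\<phi> i) u)" for u
    using assms test_fun_integrable by (intro fourier_sum) blast
  then show ?thesis unfolding average_def
    by (simp only: sum_distrib_left) (intro Bochner_Integration.integral_sum average_integrable[OF assms])
qed

text \<open>After a reflection the average is the integral of h(- v - x) against the integrable
  \<open>fourier \<phi>\<close>. For each v the first factor tends to 0 as x grows, and h is
  bounded, so dominated convergence applies.\<close>

lemma pseudofunction_regular:
  assumes "boundary_behavior local_pseudofunction U (laplace f)" "t0 \<in> U"
  shows "\<exists>V. open V \<and> t0 \<in> V \<and> regular_on f V"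
proof -
  obtain V h where V: "open V" "t0 \<in> V" and h: "pf_transform h" and lim:
    "\<And>\<phi> x. test_fun_on V \<phi> \<Longrightarrow> ((\<lambda>\<sigma>. LINT t|lborel. laplace f (Complex \<sigma> t) * (exp (\<i> * of_real (x * t)) * \<phi> t)) \<longlongrightarrow>
       (1 / (2 * of_real pi)) * (LINT u|lborel. h u * fourier \<phi> (- u - x))) (at_right 0)"
    by (rule boundary_behavior_action[OF assms]) blast
  obtain H where H: "\<And>u. norm (h u) \<le> H" using h unfolding pf_transform_def pm_transform_def bounded_iff by auto
  have [measurable]: "h \<in> borel_measurable borel" using h by (simp add: pf_transform_def pm_transform_def)
  have "regular_on f V" unfolding regular_on_def
  proof (intro allI impI)
    fix \<phi> assume \<phi>: "test_fun_on V \<phi>"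
    have [measurable]: "fourier \<phi> \<in> borel_measurable borel" by (rule fourier_measurable[OF test_fun_integrable[OF \<phi>]])
    have eq: "average f \<phi> x = (1 / (2 * of_real pi)) * (LINT v|lborel. h (- v - x) * fourier \<phi> v)" for x
    proof -
      have "average f \<phi> x = (1 / (2 * of_real pi)) * (LINT u|lborel. h u * fourier \<phi> (- u - x))"
        by (rule tendsto_unique[OF _ average_boundary[OF \<phi>] lim[OF \<phi>]]) simp
      also have "(LINT u|lborel. h u * fourier \<phi> (- u - x)) = (LINT v|lborel. h (- v - x) * fourier \<phi> v)"
        using integral_reflect_shift[of "\<lambda>v. h (- v - x) * fourier \<phi> v" x] by simp
      finally show ?thesis .
    qed
    have iw: "integrable lborel (\<lambda>v. H * norm (fourier \<phi> v))" using fourier_test_integrable[OF \<phi>] by simp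
    have "((\<lambda>x. LINT v|lborel. h (- v - x) * fourier \<phi> v) \<longlongrightarrow> (LINT v|(lborel :: real measure). 0)) at_top"
    proof (rule integral_dominated_convergence_at_top[OF _ _ iw])
      show "AE v in lborel. ((\<lambda>x. h (- v - x) * fourier \<phi> v) \<longlongrightarrow> 0) at_top"
      proof (rule AE_I2)
        fix v :: real
        have "filterlim (\<lambda>x::real. - v - x) at_bot at_top" by real_asymp
        then have "filterlim (\<lambda>x::real. - v - x) at_infinity at_top" by (rule filterlim_at_bot_imp_at_infinity)
        then have "((\<lambda>x. h (- v - x)) \<longlongrightarrow> 0) at_top" 
          using h unfolding pf_transform_def by (blast intro: filterlim_compose)
        then show "((\<lambda>x. h (- v - x) * fourier \<phi> v) \<longlongrightarrow> 0) at_top" by (rule tendsto_mult_left_zero)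
      qed
      show "\<forall>\<^sub>F x in at_top. AE v in lborel. norm (h (- v - x) * fourier \<phi> v) \<le> H * norm (fourier \<phi> v)"
        by (intro always_eventually allI AE_I2) (simp add: norm_mult mult_right_mono H)
    qed simp_all
    then have "((\<lambda>x. (1 / (2 * of_real pi)) * (LINT v|lborel. h (- v - x) * fourier \<phi> v)) \<longlongrightarrow> (1 / (2 * of_real pi)) * 0) at_top"
      by (intro tendsto_mult_left) simp
    then show "(average f \<phi> \<longlongrightarrow> 0) at_top" unfolding eq[abs_def] by simp
  qed
  then show ?thesis using V by blast
qed

text \<open>Compactness of the support gives a Lebesgue number e for the regular open sets. With
  mesh e / 3 a cell has length below e, so a cell that meets the support lies in a single regular
  set, and the others contribute nothing.\<close>

lemma regular_local:
  assumes \<phi>: "test_fun_on U \<phi>" and loc: "\<And>t. t \<in> closure {x. \<phi> x \<noteq> 0} \<Longrightarrow> \<exists>V. open V \<and> t \<in> V \<and> regular_on f V"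
  shows "(average f \<phi> \<longlongrightarrow> 0) at_top"
proof -
  let ?S = "closure {x. \<phi> x \<noteq> 0}"
  have "compact ?S" using \<phi> by (simp add: test_fun_on_def)
  moreover have "?S \<subseteq> \<Union>{V. open V \<and> regular_on f V}" using loc by blast
  ultimately obtain e where e: "e > 0" "\<And>x. x \<in> ?S \<Longrightarrow> \<exists>G\<in>{V. open V \<and> regular_on f V}. ball x e \<subseteq> G"
    by (rule Heine_Borel_lemma) auto
  define l where "l = e / 3"
  have l: "l > 0" "2 * l < e" using e(1) by (auto simp: l_def)
  let ?c = "\<lambda>j t. of_real (cell (t / l - of_int j)) * \<phi> t"
  obtain N :: int where N: "\<And>t. \<phi> t = (\<Sum>j\<in>{-N..<N}. ?c j t)" using cell_decomposition[OF \<phi> l(1)] by blast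
  have tc: "test_fun_on (U \<inter> {of_int j * l..of_int (j + 2) * l}) (?c j)" for j
    by (rule test_fun_mult[OF \<phi> smooth_cell_scaled]) (use cell_scaled_nz[of _ l j] l in auto)
  have "(average f (?c j) \<longlongrightarrow> 0) at_top" for j
  proof (cases "{of_int j * l..of_int (j + 2) * l} \<inter> ?S = {}")
    case True
    have "?c j t = 0" for t
      using True cell_scaled_nz[of t l j] l closure_subset[of "{x. \<phi> x \<noteq> 0}"] by fastforce
    then have "?c j = (\<lambda>t. 0)" by (rule ext)
    then show ?thesis by (simp add: average_def[abs_def] fourier_def)
  next
    case False
    then obtain t where t: "t \<in> {of_int j * l..of_int (j + 2) * l}" "t \<in> ?S" by blast
    obtain V where V: "regular_on f V" "ball t e \<subseteq> V" using e(2)[OF t(2)] by blast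
    have "{of_int j * l..of_int (j + 2) * l} \<subseteq> ball t e"
    proof
      fix y assume "y \<in> {of_int j * l..of_int (j + 2) * l}"
      then have "\<bar>t - y\<bar> \<le> 2 * l" using t(1) by (auto simp: algebra_simps abs_le_iff)
      then show "y \<in> ball t e" using l by (simp add: dist_real_def)
    qed
    then have "test_fun_on V (?c j)" using V(2) by (intro test_fun_mono[OF tc]) auto
    then show ?thesis using V(1) by (simp add: regular_on_def)
  qed
  then have "((\<lambda>x. \<Sum>j\<in>{-N..<N}. average f (?c j) x) \<longlongrightarrow> (\<Sum>j\<in>{-N..<N}. 0)) at_top" by (intro tendsto_sum)
  moreover have "average f \<phi> = (\<lambda>x. \<Sum>j\<in>{-N..<N}. average f (?c j) x)"
  proof
    fix x
    have "average f \<phi> x = average f (\<lambda>t. \<Sum>j\<in>{-N..<N}. ?c j t) x" using N by (simp only:)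
    also have "\<dots> = (\<Sum>j\<in>{-N..<N}. average f (?c j) x)" 
      by (rule average_sum[where U=U]) (use tc in \<open>auto intro: test_fun_mono\<close>)
    finally show "average f \<phi> x = (\<Sum>j\<in>{-N..<N}. average f (?c j) x)" .
  qed
  ultimately show ?thesis by (simp only: sum.neutral_const)
qed

end

section \<open>Twisted primitives and the set of singular frequencies\<close>

definition twisted_primitive :: "(real \<Rightarrow> complex) \<Rightarrow> real \<Rightarrow> real \<Rightarrow> complex" where
  "twisted_primitive f t x = primitive (\<lambda>u. exp (\<i> * of_real (- t * u)) * f u) x"

text \<open>For fixed x this exhibits the dependence on t as the Fourier transform of an integrable
  function, hence as continuous. The closed sets for Baire's theorem come from here.\<close>

lemma twisted_primitive_fourier:
  "twisted_primitive f t x = fourier (\<lambda>u. indicator {..x} u *\<^sub>R f u) t"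
  unfolding twisted_primitive_def primitive_def fourier_def
  by (rule Bochner_Integration.integral_cong) (auto simp: indicator_def)

lemma twisted_primitive_laplace:
  assumes f: "laplace_able f"
  shows "laplace_able (twisted_primitive f t)"
    "Re s > 0 \<Longrightarrow> laplace (twisted_primitive f t) s = laplace f (s + \<i> * of_real t) / s"
proof -
  have m: "laplace_able (\<lambda>u. exp (\<i> * of_real (- t * u)) * f u)" by (rule laplace_able_modulate[OF f])
  show "laplace_able (twisted_primitive f t)" 
    unfolding twisted_primitive_def[abs_def] by (rule laplace_primitive(1)[OF m])
  show "laplace (twisted_primitive f t) s = laplace f (s + \<i> * of_real t) / s" if "Re s > 0"
    unfolding twisted_primitive_def[abs_def] laplace_primitive(2)[OF m that] laplace_modulate by simp
qed

text \<open>The function \<open>R\<close>, the twisted primitive modulated back by exp (i t x), has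
  transform \<open>laplace f\<close> divided by s - i t and is bounded by M. Passing to the
  boundary, the average of f against \<phi> equals the average of \<open>R\<close> against i (y - t)
  \<phi>(y). The resulting bound depends neither on x nor on B.\<close>

lemma average_le_twisted:
  assumes f: "laplace_able f" and B: "\<And>x. x > X \<Longrightarrow> norm (f x) \<le> B" and M: "\<And>x. norm (twisted_primitive f t x) \<le> M"
    and \<phi>: "test_fun_on U \<phi>"
  shows "norm (average f \<phi> x) \<le> M * (LINT u|lborel. norm (fourier (\<lambda>y. of_real (y - t) * \<phi> y) u))"
proof -
  define R where "R x = exp (\<i> * of_real (t * x)) * twisted_primitive f t x" for x
  have R: "laplace_able R" unfolding R_def[abs_def] by (intro laplace_able_modulate twisted_primitive_laplace f)
  have q: "laplace R s = laplace f s / (s - \<i> * of_real t)" if "Re s > 0" for s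
    unfolding R_def[abs_def] laplace_modulate using twisted_primitive_laplace(2)[OF f, of "s - \<i> * of_real t" t] that by simp
  have RM: "norm (R x) \<le> M" for x using M[of x] by (simp add: R_def norm_mult)
  let ?\<psi> = "\<lambda>y. \<i> * of_real (y - t) * \<phi> y"
  let ?A = "\<lambda>F \<phi> x \<sigma>. LINT t|lborel. F (Complex \<sigma> t) * (exp (\<i> * of_real (x * t)) * \<phi> t)"
  have t\<psi>: "test_fun_on U ?\<psi>" by (rule test_fun_linear_mult[OF \<phi>])
  have "((\<lambda>\<sigma>. of_real \<sigma> * ?A (laplace R) \<phi> x \<sigma> + ?A (laplace R) ?\<psi> x \<sigma>) \<longlongrightarrow> of_real 0 * average R \<phi> x + average R ?\<psi> x) (at_right 0)"
    by (intro tendsto_add tendsto_mult tendsto_of_real tendsto_ident_at average_boundary[OF R RM \<phi>] average_boundary[OF R RM t\<psi>])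
  moreover have "\<forall>\<^sub>F \<sigma> in at_right 0. of_real \<sigma> * ?A (laplace R) \<phi> x \<sigma> + ?A (laplace R) ?\<psi> x \<sigma> = ?A (laplace f) \<phi> x \<sigma>"
  proof -
    have "of_real \<sigma> * ?A (laplace R) \<phi> x \<sigma> + ?A (laplace R) ?\<psi> x \<sigma> = ?A (laplace f) \<phi> x \<sigma>" if "\<sigma> > 0" for \<sigma>
      using laplace_quotient_action[OF f R q test_fun_exp[OF \<phi>] that, of x] by (simp add: mult_ac)
    then show ?thesis by (auto simp: eventually_at_filter)
  qed
  ultimately have "(?A (laplace f) \<phi> x \<longlongrightarrow> of_real 0 * average R \<phi> x + average R ?\<psi> x) (at_right 0)" by (rule Lim_transform_eventually)
  then have "average f \<phi> x = average R ?\<psi> x"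
    using tendsto_unique[OF _ average_boundary[OF f B \<phi>]] by fastforce
  also have "norm (average R ?\<psi> x) \<le> M * (LINT u|lborel. norm (fourier ?\<psi> (u - x)))"
    unfolding average_def by (rule norm_integral_mult_le[OF RM fourier_shift_integrable[OF t\<psi>]])
  also have "(LINT u|lborel. norm (fourier ?\<psi> (u - x))) = (LINT u|lborel. norm (fourier ?\<psi> u))"
    by (subst (2) lborel_integral_real_affine[of 1 _ "- x"]) auto
  also have "\<dots> = (LINT u|lborel. norm (fourier (\<lambda>y. of_real (y - t) * \<phi> y) u))"
    unfolding mult.assoc[of \<i>] fourier_mult_left norm_mult by simp
  finally show ?thesis .
qed

text \<open>Beyond X the integrand is bounded by B, so the primitive is Lipschitz there and its real
  and imaginary parts decrease boundedly with constant B. The hypothesis at t, translated to 0, is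
  the local bound for its transform, and the boundedness result at 0 applies.\<close>

lemma twisted_primitive_bounded:
  assumes f: "laplace_able f" and B: "\<And>x. x \<ge> X \<Longrightarrow> norm (f x) \<le> B" and X: "X \<ge> 0"
    and pm: "pm_boundary_at t (\<lambda>s. laplace f s / (s - \<i> * of_real t))"
  obtains M where "\<And>x. norm (twisted_primitive f t x) \<le> M"
proof -
  let ?S = "twisted_primitive f t"
  note S = twisted_primitive_laplace(1)[OF f, of t] twisted_primitive_laplace(2)[OF f, of _ t]
  obtain a b where ab: "a < t" "t < b" "boundary_behavior local_pseudomeasure {a<..<b} (\<lambda>s. laplace f s / (s - \<i> * of_real t))"
    using pm unfolding pm_boundary_at_def by blast
  have "pm_near (\<lambda>s. laplace f s / (s - \<i> * of_real t)) t"
    by (rule boundary_behavior_pm_near[OF ab(3)]) (use ab in auto)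
  then have "pm_near (\<lambda>s. laplace f (s + \<i> * of_real t) / ((s + \<i> * of_real t) - \<i> * of_real t)) 0"
    by (rule pm_near_shift)
  then have pm0: "pm_near (laplace ?S) 0"
    by (subst pm_near_cong[OF S(2)]) auto
  let ?g = "\<lambda>u. exp (\<i> * of_real (- t * u)) * f u"
  have g: "laplace_able ?g" by (rule laplace_able_modulate[OF f])
  have B0: "B \<ge> 0" using B[of X] by (auto intro: order_trans[OF norm_ge_zero])
  have lip: "norm (?S (x + h) - ?S x) \<le> B * h" if "x \<ge> X" "h \<ge> 0" for x h
  proof -
    have "?S (x + h) - ?S x = (LINT u|lborel. indicator {..x + h} u *\<^sub>R ?g u - indicator {..x} u *\<^sub>R ?g u)"
      unfolding twisted_primitive_def primitive_def
      by (rule Bochner_Integration.integral_diff[symmetric]) (rule laplace_able_head[OF g])+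
    also have "norm \<dots> \<le> ((x + h) - x) * B"
    proof (rule norm_integral_le_length)
      show "norm (indicator {..x + h} u *\<^sub>R ?g u - indicator {..x} u *\<^sub>R ?g u) \<le> B" for u
        using B[of u] B0 that by (auto simp: indicator_def norm_mult)
    qed (use that in \<open>auto simp: indicator_def\<close>)
    finally show ?thesis by (simp add: mult.commute)
  qed
  have bd: "c (?S (x + h)) \<ge> c (?S x) - B * (1 + h)" if "x \<ge> X" "h \<ge> 0" "c = Re \<or> c = Im" for x h c
  proof -
    have "\<bar>c (?S (x + h) - ?S x)\<bar> \<le> B * h"
      using that lip[of x h] abs_Re_le_cmod[of "?S (x + h) - ?S x"] abs_Im_le_cmod[of "?S (x + h) - ?S x"] by auto
    moreover have "c (?S (x + h) - ?S x) = c (?S (x + h)) - c (?S x)" using that by auto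
    ultimately show ?thesis using B0 by (simp add: algebra_simps)
  qed
  obtain B1 where B1: "\<And>x. x \<ge> X \<Longrightarrow> norm (?S x) \<le> B1"
    by (rule pm_near_bounded[OF S(1) pm0 X B0 bd bd]) auto
  \<comment> \<open>The Lipschitz argument says nothing on the initial segment; there the L1 norm of
    the head bounds the primitive.\<close>
  define B2 where "B2 = (LINT u|lborel. norm (indicator {..X} u *\<^sub>R ?g u))"
  have B2: "norm (?S x) \<le> B2" if "x \<le> X" for x
  proof -
    have "norm (?S x) \<le> (LINT u|lborel. norm (indicator {..x} u *\<^sub>R ?g u))"
      unfolding twisted_primitive_def primitive_def by (rule integral_norm_bound)
    also have "\<dots> \<le> B2" unfolding B2_def
      by (intro integral_mono integrable_norm laplace_able_head[OF g]) (use that in \<open>auto simp: indicator_def\<close>)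
    finally show ?thesis .
  qed
  have "norm (?S x) \<le> max B1 B2" for x using B1[of x] B2[of x] by (cases "x \<le> X") auto
  then show thesis by (rule that)
qed

text \<open>If no C n contained a nonempty relatively open part of K, the sets K - C n would be
  relatively open and dense. Their intersection would then be dense in K, but the covering makes it
  empty.\<close>

lemma Baire_closed_cover:
  fixes K :: "real set"
  assumes K: "closed K" "K \<noteq> {}" and C: "\<And>n::nat. closed (C n)" and cov: "K \<subseteq> (\<Union>n. C n)"
  obtains n I where "open I" "I \<inter> K \<noteq> {}" "I \<inter> K \<subseteq> C n"
proof (rule ccontr)
  assume contra: "\<not> thesis"
  have no: "I \<inter> K \<subseteq> C n \<Longrightarrow> open I \<Longrightarrow> I \<inter> K = {}" for n I
    using contra that by blast
  have "K \<subseteq> closure (\<Inter>(range (\<lambda>n. K - C n)))"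
  proof (rule Baire[OF K(1)])
    fix T assume "T \<in> range (\<lambda>n. K - C n)"
    then obtain n where T: "T = K - C n" by blast
    have "openin (top_of_set K) T" unfolding T using C[of n] by (metis Diff_eq open_Compl openin_open_Int)
    moreover have "K \<subseteq> closure T"
    proof
      fix t assume t: "t \<in> K"
      show "t \<in> closure T"
      proof (rule ccontr)
        assume nt: "t \<notin> closure T"
        have "(- closure T) \<inter> K \<subseteq> C n" unfolding T using closure_subset[of "K - C n"] by blast
        from no[OF this] t nt show False by blast
      qed
    qed
    ultimately show "openin (top_of_set K) T \<and> K \<subseteq> closure T" by blast
  qed simp
  moreover have inter: "\<Inter>(range (\<lambda>n. K - C n)) = {}" using cov by blast
  ultimately have "K \<subseteq> closure {}" by (simp only: inter)
  then show False using K(2) by simp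
qed

text \<open>Neighboring cells overlap, so their left halves are measured instead. These have length
  l, are pairwise disjoint when taken half-open, and stay within 2 l of a point of K.\<close>

lemma null_cells_measure:
  fixes K :: "real set" and l e :: real and J :: "int set"
  assumes l: "l > 0" and J: "finite J" and O: "open O'" "emeasure lborel O' < ennreal e"
    and sub: "\<And>t. t \<in> K \<Longrightarrow> cball t (2 * l) \<subseteq> O'"
    and meet: "\<And>j. j \<in> J \<Longrightarrow> {of_int j * l..of_int (j + 2) * l} \<inter> K \<noteq> {}"
  shows "real (card J) * l < e"
proof -
  let ?I = "\<lambda>j::int. {of_int j * l..<of_int (j + 1) * l}"
  have m: "emeasure lborel (?I j) = ennreal l" for j using l by (simp add: algebra_simps)
  have disj: "disjoint_family_on ?I J"
  proof (unfold disjoint_family_on_def, intro ballI impI)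
    fix i j :: int assume "i \<noteq> j"
    then have "i + 1 \<le> j \<or> j + 1 \<le> i" by linarith
    then have "of_int (i + 1) * l \<le> of_int j * l \<or> of_int (j + 1) * l \<le> of_int i * l"
      using l by (metis mult_right_mono of_int_le_iff less_imp_le)
    then show "?I i \<inter> ?I j = {}" by (meson disjoint_iff atLeastLessThan_iff not_less order_trans)
  qed
  have "ennreal (real (card J) * l) = (\<Sum>j\<in>J. emeasure lborel (?I j))" unfolding m using l by (simp add: ennreal_mult ennreal_of_nat_eq_real_of_nat)
  also have "\<dots> = emeasure lborel (\<Union>j\<in>J. ?I j)" by (rule sum_emeasure) (use J disj in auto)
  also have "\<dots> \<le> emeasure lborel O'"
  proof (rule emeasure_mono)
    show "(\<Union>j\<in>J. ?I j) \<subseteq> O'"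
    proof
      fix y assume "y \<in> (\<Union>j\<in>J. ?I j)"
      then obtain j where j: "j \<in> J" "y \<in> ?I j" by blast
      obtain t where t: "t \<in> {of_int j * l..of_int (j + 2) * l}" "t \<in> K" using meet[OF j(1)] by blast
      have "dist t y \<le> 2 * l" using t(1) j(2) l by (auto simp: dist_real_def algebra_simps abs_le_iff)
      then show "y \<in> O'" using sub[OF t(2)] by auto
    qed
  qed (use O in auto)
  also have "\<dots> < ennreal e" by (rule O)
  finally show ?thesis using l by (simp add: ennreal_less_iff)
qed

text \<open>The singular set is closed and null. If it is nonempty, Baire's theorem makes the bounds on
  the twisted primitives uniform on a relatively open part of it; there, the cells of mesh \<open>l\<close>
  that meet the singular set contribute \<open>O(l)\<close> each, and their total length tends to \<open>0\<close>.\<close>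

lemma no_singular_points:
  assumes f: "laplace_able f" and B: "\<And>x. x \<ge> X \<Longrightarrow> norm (f x) \<le> B" and X: "X \<ge> 0"
    and E: "closed E" "E \<in> null_sets lborel" and pf: "local_pf_boundary (- E) (laplace f)"
    and pm: "\<And>t. t \<in> E \<Longrightarrow> pm_boundary_at t (\<lambda>s. laplace f s / (s - \<i> * of_real t))"
  shows "\<exists>V. open V \<and> t0 \<in> V \<and> regular_on f V"
proof -
  have B': "norm (f x) \<le> B" if "x > X" for x using B that by simp
  define Sing where "Sing = {t. \<not> (\<exists>V. open V \<and> t \<in> V \<and> regular_on f V)}"
  have Sing_eq: "- Sing = \<Union>{V. open V \<and> regular_on f V}" by (auto simp: Sing_def)
  have "open (- Sing)" unfolding Sing_eq by (rule open_Union) auto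
  then have cS: "closed Sing" by (simp add: closed_def)
  have SE: "Sing \<subseteq> E"
  proof
    fix t assume t: "t \<in> Sing"
    show "t \<in> E"
    proof (rule ccontr)
      assume "t \<notin> E"
      then have "\<exists>V. open V \<and> t \<in> V \<and> regular_on f V"
        using pseudofunction_regular[OF f B' pf[unfolded local_pf_boundary_def], of X t] by simp
      then show False using t unfolding Sing_def by blast
    qed
  qed
  have "Sing = {}"
  proof (rule ccontr)
    assume ne: "Sing \<noteq> {}"
    \<comment> \<open>One natural number has to bound the twisted primitive for all x at once. As an
      intersection over x of closed sets, \<open>C n\<close> is closed.\<close>
    define C where "C n = {t. \<forall>x. norm (twisted_primitive f t x) \<le> real n}" for n
    have cC: "closed (C n)" for n
    proof -
      have "C n = (\<Inter>x. {t. norm (fourier (\<lambda>u. indicator {..x} u *\<^sub>R f u) t) \<le> real n})"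
        by (auto simp: C_def twisted_primitive_fourier)
      also have "closed \<dots>"
        by (intro closed_INT ballI closed_Collect_le continuous_on_norm continuous_on_const fourier_continuous laplace_able_head[OF f])
      finally show ?thesis .
    qed
    have cov: "Sing \<subseteq> (\<Union>n. C n)"
    proof
      fix t assume "t \<in> Sing"
      then have tE: "t \<in> E" using SE by blast
      obtain M where M: "\<And>x. norm (twisted_primitive f t x) \<le> M" 
        using twisted_primitive_bounded[OF f B X pm[OF tE]] by blast
      obtain n where n: "M \<le> real n" using real_arch_simple by blast
      have "t \<in> C n" unfolding C_def by (intro CollectI allI order_trans[OF M n])
      then show "t \<in> (\<Union>n. C n)" by blast
    qed
    obtain n I where I: "open I" "I \<inter> Sing \<noteq> {}" "I \<inter> Sing \<subseteq> C n"
      by (rule Baire_closed_cover[OF cS ne cC cov])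
    have "regular_on f I" unfolding regular_on_def
    proof (intro allI impI)
      fix \<phi> assume \<phi>: "test_fun_on I \<phi>"
      let ?S = "closure {x. \<phi> x \<noteq> 0}"
      have S: "compact ?S" "?S \<subseteq> I" using \<phi> by (auto simp: test_fun_on_def)
      define K where "K = ?S \<inter> Sing"
      have K: "compact K" unfolding K_def using S cS by (intro compact_Int_closed)
      have KC: "K \<subseteq> C n" using S I by (auto simp: K_def)
      have nullK: "emeasure lborel K = 0"
      proof -
        have "K \<in> sets lborel" "K \<subseteq> E" using K SE by (auto simp: borel_compact K_def)
        then show ?thesis by (intro null_setsD1[OF null_sets_subset[OF E(2)]])
      qed
      obtain A where A: "A \<ge> 0" "\<And>l j t. 0 < l \<Longrightarrow> l \<le> 1 \<Longrightarrow> t \<in> {of_int j * l..of_int (j + 2) * l} \<Longrightarrow>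
          (LINT u|lborel. norm (fourier (\<lambda>y. of_real (y - t) * (of_real (cell (y / l - of_int j)) * \<phi> y)) u)) \<le> A * l"
        using cell_fourier_bound[OF \<phi>] by blast
      show "(average f \<phi> \<longlongrightarrow> 0) at_top"
      proof (rule tendstoI)
        fix e :: real assume e: "e > 0"
        \<comment> \<open>Chosen so that n A \<eta> is at most e / 2; the added 1 keeps the
          denominator positive when n A is 0.\<close>
        define \<eta> where "\<eta> = e / (2 * (real n * A + 1))"
        have nA: "real n * A + 1 > 0" using A(1) by (intro add_nonneg_pos) auto
        have \<eta>: "\<eta> > 0" "real n * A * \<eta> \<le> e / 2"
        proof -
          show "\<eta> > 0" unfolding \<eta>_def using e nA by simp
          have "real n * A * \<eta> \<le> (real n * A + 1) * \<eta>" using \<open>\<eta> > 0\<close> by (intro mult_right_mono) auto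
          also have "\<dots> = e / 2"
          proof -
            have "w * (e / (2 * w)) = e / 2" if "w > 0" for w :: real using that by simp
            then show ?thesis unfolding \<eta>_def using nA by blast
          qed
          finally show "real n * A * \<eta> \<le> e / 2" .
        qed
        obtain O' where O': "K \<subseteq> O'" "open O'" "emeasure lborel (O' - K) < ennreal \<eta>"
          using outer_regular_lborel[OF borel_compact[OF K] \<eta>(1)] by blast
        have "emeasure lborel O' \<le> emeasure lborel (O' - K) + emeasure lborel K"
        proof -
          have "emeasure lborel ((O' - K) \<union> K) \<le> emeasure lborel (O' - K) + emeasure lborel K"
            by (rule emeasure_subadditive) (use O'(2) K in \<open>auto simp: borel_compact\<close>)
          also have "(O' - K) \<union> K = O'" using O'(1) by blast
          finally show ?thesis .
        qed
        then have mO: "emeasure lborel O' < ennreal \<eta>" using O'(3) nullK by simp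
        obtain d where d: "d > 0" "(\<Union>x\<in>K. cball x d) \<subseteq> O'"
          using compact_subset_open_imp_cball_epsilon_subset[OF K O'(2,1)] by blast
        \<comment> \<open>The cell estimate requires l \<le> 1, and 2 l \<le> d keeps every cell
          that meets K inside the small open set.\<close>
        define l where "l = min 1 (d / 2)"
        have l: "l > 0" "l \<le> 1" "2 * l \<le> d" using d(1) by (auto simp: l_def)
        let ?Q = "\<lambda>j. {of_int j * l..of_int (j + 2) * l}"
        let ?c = "\<lambda>j t. of_real (cell (t / l - of_int j)) * \<phi> t"
        obtain N :: int where N: "\<And>t. \<phi> t = (\<Sum>j\<in>{-N..<N}. ?c j t)" using cell_decomposition[OF \<phi> l(1)] by blast
        have tc: "test_fun_on (I \<inter> ?Q j) (?c j)" for j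
          by (rule test_fun_mult[OF \<phi> smooth_cell_scaled]) (use cell_scaled_nz[of _ l j] l in auto)
        have tcI: "test_fun_on I (?c j)" for j by (rule test_fun_mono[OF tc]) auto
        define J where "J = {-N..<N}"
        \<comment> \<open>Cells outside \<open>J1\<close> carry no singular point in the support of
          \<phi>, so their finitely many averages vanish in the limit by localization. The cells in
          \<open>J1\<close> are estimated in size only.\<close>
        define J1 where "J1 = {j \<in> J. ?Q j \<inter> K \<noteq> {}}"
        have fin: "finite J" "J1 \<subseteq> J" by (auto simp: J_def J1_def)
        have fin1: "finite J1" by (rule finite_subset[OF fin(2,1)])
        have av: "average f \<phi> x = (\<Sum>j\<in>J - J1. average f (?c j) x) + (\<Sum>j\<in>J1. average f (?c j) x)" for x
        proof -
          have "average f \<phi> x = average f (\<lambda>t. \<Sum>j\<in>{-N..<N}. ?c j t) x" using N by (simp only:)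
          also have "\<dots> = (\<Sum>j\<in>{-N..<N}. average f (?c j) x)" 
            by (rule average_sum[OF f B' tcI])
          finally show ?thesis unfolding J_def[symmetric] using sum.subset_diff[OF fin(2,1)] by simp
        qed
        have "(average f (?c j) \<longlongrightarrow> 0) at_top" if j: "j \<in> J - J1" for j
        proof (rule regular_local[OF f B' tcI])
          fix t assume t: "t \<in> closure {x. ?c j x \<noteq> 0}"
          have "closure {x. ?c j x \<noteq> 0} \<subseteq> I \<inter> ?Q j" using tc[of j] by (simp only: test_fun_on_def)
          then have "t \<in> ?Q j" using t by blast
          moreover have "t \<in> ?S"
          proof (rule subsetD[OF closure_mono t])
            show "{x. ?c j x \<noteq> 0} \<subseteq> {x. \<phi> x \<noteq> 0}" by auto
          qed
          ultimately have "t \<notin> Sing" using j by (auto simp: J1_def K_def)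
          then show "\<exists>V. open V \<and> t \<in> V \<and> regular_on f V" unfolding Sing_def by blast
        qed
        then have "((\<lambda>x. \<Sum>j\<in>J - J1. average f (?c j) x) \<longlongrightarrow> (\<Sum>j\<in>J - J1. 0)) at_top" by (intro tendsto_sum)
        from tendstoD[OF this, of "e / 2"]
        have ev: "\<forall>\<^sub>F x in at_top. norm (\<Sum>j\<in>J - J1. average f (?c j) x) < e / 2"
          using e by (simp only: sum.neutral_const dist_norm diff_zero half_gt_zero)
        \<comment> \<open>The frequency t is taken in the cell itself, so the factor y - t is small
          there, and from the set where the bound n holds. The estimate is uniform in x.\<close>
        have small: "norm (average f (?c j) x) \<le> real n * (A * l)" if j: "j \<in> J1" for j x
        proof -
          obtain t where t: "t \<in> ?Q j" "t \<in> K" using j unfolding J1_def by blast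
          have tn: "norm (twisted_primitive f t x) \<le> real n" for x using KC t(2) by (auto simp: C_def)
          show ?thesis
            by (rule order_trans[OF average_le_twisted[OF f B' tn tcI] mult_left_mono[OF A(2)[OF l(1,2) t(1)]]]) auto
        qed
        have cardJ: "real (card J1) * l < \<eta>"
        proof (rule null_cells_measure[OF l(1) fin1 O'(2) mO])
          show "cball t (2 * l) \<subseteq> O'" if "t \<in> K" for t
          proof -
            have "cball t (2 * l) \<subseteq> cball t d" using l(3) by auto
            then show ?thesis using d(2) that by blast
          qed
        qed (auto simp: J1_def)
        have "norm (\<Sum>j\<in>J1. average f (?c j) x) \<le> e / 2" for x
        proof -
          have "norm (\<Sum>j\<in>J1. average f (?c j) x) \<le> (\<Sum>j\<in>J1. real n * (A * l))" by (rule sum_norm_le[OF small])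
          also have "\<dots> = real n * A * (real (card J1) * l)" by (simp add: mult_ac)
          also have "\<dots> \<le> real n * A * \<eta>" using cardJ A(1) by (intro mult_left_mono) auto
          also note \<eta>(2)
          finally show ?thesis .
        qed
        then show "\<forall>\<^sub>F x in at_top. dist (average f \<phi> x) 0 < e"
          using ev
        proof (elim eventually_mono)
          fix x assume "norm (\<Sum>j\<in>J - J1. average f (?c j) x) < e / 2"
          moreover have "norm (\<Sum>j\<in>J1. average f (?c j) x) \<le> e / 2" by fact
          ultimately show "dist (average f \<phi> x) 0 < e"
            using norm_triangle_ineq[of "\<Sum>j\<in>J - J1. average f (?c j) x" "\<Sum>j\<in>J1. average f (?c j) x"] by (simp add: av)
        qed
      qed
    qed
    moreover obtain t where "t \<in> I" "t \<in> Sing" using I(2) by blast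
    ultimately show False using I(1) unfolding Sing_def by blast
  qed
  then show ?thesis unfolding Sing_def by blast
qed

section \<open>The Tauberian step\<close>

definition slow_decrease :: "(real \<Rightarrow> real) \<Rightarrow> bool" where
  "slow_decrease r \<longleftrightarrow> (\<forall>\<epsilon>>0. \<exists>\<delta>>0. \<exists>X. \<forall>x\<ge>X. \<forall>h\<in>{0..\<delta>}. r (x + h) \<ge> r x - \<epsilon>)"

text \<open>With \<epsilon> = 1, each step of length d loses at most 1. About h / d steps and one
  remainder are needed, and 1 + h / d is at most (1 + 1 / d) (1 + h).\<close>

lemma slow_decrease_imp_bounded_decrease:
  assumes "slow_decrease r"
  obtains X C where "X \<ge> 0" "C \<ge> 0" "\<And>x h. x \<ge> X \<Longrightarrow> h \<ge> 0 \<Longrightarrow> r (x + h) \<ge> r x - C * (1 + h)"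
proof -
  obtain d X0 where d: "d > 0" and X0: "\<And>x h. x \<ge> X0 \<Longrightarrow> h \<in> {0..d} \<Longrightarrow> r (x + h) \<ge> r x - 1"
    using assms unfolding slow_decrease_def by (metis zero_less_one)
  have step: "r (x + real n * d) \<ge> r x - real n" if "x \<ge> X0" for x n
  proof (induction n)
    case (Suc n)
    have "x + real n * d \<ge> X0" using that d by (simp add: add_increasing2)
    then have "r (x + real n * d + d) \<ge> r (x + real n * d) - 1" using d by (intro X0) auto
    then show ?case using Suc by (simp add: algebra_simps)
  qed simp
  have "r (x + h) \<ge> r x - (1 + 1 / d) * (1 + h)" if "x \<ge> X0" "h \<ge> 0" for x h
  proof -
    define n where "n = nat \<lfloor>h / d\<rfloor>"
    have n: "real n \<le> h / d" "h / d < real n + 1" using that d by (auto simp: n_def)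
    define k where "k = h - real n * d"
    have k: "k \<in> {0..d}" using n d by (auto simp: k_def field_simps)
    have "x + real n * d \<ge> X0" using that d by (simp add: add_increasing2)
    then have "r (x + real n * d + k) \<ge> r (x + real n * d) - 1" using k by (intro X0)
    then have "r (x + h) \<ge> r x - (real n + 1)" using step[OF that(1), of n] by (simp add: k_def)
    moreover have "real n + 1 \<le> (1 + 1 / d) * (1 + h)"
    proof -
      have "(1 + 1 / d) * (1 + h) = 1 + h / d + (h + 1 / d)" using d by (simp add: field_simps)
      then show ?thesis using n that d by (simp add: add_increasing2)
    qed
    ultimately show ?thesis by linarith
  qed
  then show thesis using d by (intro that[of "max X0 0" "1 + 1 / d"]) auto
qed

text \<open>Within distance d of y the function is at least c - \<epsilon>. Elsewhere it is at least
  - B, hence at least c - \<epsilon> - 2 B, so the loss is 2 B times the mass of K outside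
  [-d, d].\<close>

lemma average_lower_bound:
  fixes r K :: "real \<Rightarrow> real"
  assumes K: "\<And>u. K u \<ge> 0" "integrable lborel K" and [measurable]: "r \<in> borel_measurable borel"
    and B: "\<And>u. \<bar>r u\<bar> \<le> B" "\<bar>c\<bar> \<le> B" and c: "\<And>v. \<bar>v\<bar> \<le> d \<Longrightarrow> r (y + v) \<ge> c - \<epsilon>" and "\<epsilon> \<ge> 0"
  shows "(LINT v|lborel. r (y + v) * K v) \<ge> (c - \<epsilon>) * (LINT v|lborel. K v)
     - 2 * B * ((LINT v|lborel. K v) - (LINT v|lborel. indicator {-d..d} v * K v))"
proof -
  have [measurable]: "K \<in> borel_measurable borel" using K by auto
  have iK1: "integrable lborel (\<lambda>u. indicator {-d..d} u * K u)"
    by (rule Bochner_Integration.integrable_bound[OF K(2)]) (use K in \<open>auto simp: indicator_def\<close>)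
  have i: "integrable lborel (\<lambda>v. r (y + v) * K v)"
  proof (rule Bochner_Integration.integrable_bound[OF integrable_mult_right[OF K(2), of B]])
    show "AE v in lborel. norm (r (y + v) * K v) \<le> norm (B * K v)"
    proof (rule AE_I2)
      fix v
      have "\<bar>r (y + v)\<bar> * \<bar>K v\<bar> \<le> \<bar>B\<bar> * \<bar>K v\<bar>" using B(1)[of "y + v"] by (intro mult_right_mono) auto
      then show "norm (r (y + v) * K v) \<le> norm (B * K v)" by (simp add: abs_mult)
    qed
  qed simp
  let ?w = "\<lambda>v. (c - \<epsilon>) * K v - 2 * B * (K v - indicator {-d..d} v * K v)"
  have iw: "integrable lborel ?w" 
    by (intro Bochner_Integration.integrable_diff integrable_mult_right K iK1)
  have "(LINT v|lborel. ?w v) \<le> (LINT v|lborel. r (y + v) * K v)"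
  proof (rule integral_mono[OF iw i])
    fix v
    show "?w v \<le> r (y + v) * K v"
    proof (cases "\<bar>v\<bar> \<le> d")
      case True
      then show ?thesis using mult_right_mono[OF c[OF True] K(1)[of v]] by (simp add: indicator_def abs_le_iff)
    next
      case False
      have "(c - \<epsilon> - 2 * B) * K v \<le> r (y + v) * K v"
        using B(1)[of "y + v"] B(2) \<open>\<epsilon> \<ge> 0\<close> by (intro mult_right_mono K) linarith
      then show ?thesis using False by (auto simp: indicator_def algebra_simps)
    qed
  qed
  then show ?thesis using K iK1 by simp
qed

text \<open>The kernel is dilated until nearly all its mass lies in a window of length \<delta>.
  Averaging over the window to the right of x bounds r x from above, and the window to its left
  bounds it from below. Dilation widens the support of the test function, which is why all test
  functions on the line must be admissible.\<close>

lemma slow_decrease_tendsto_0: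
  assumes f: "laplace_able f" and B: "\<And>x. x > X \<Longrightarrow> norm (f x) \<le> B" 
    and reg: "\<And>\<phi>. test_fun_on UNIV \<phi> \<Longrightarrow> (average f \<phi> \<longlongrightarrow> 0) at_top"
    and c: "c = Re \<or> c = Im" and sd: "slow_decrease (\<lambda>x. c (f x))"
  shows "((\<lambda>x. c (f x)) \<longlongrightarrow> 0) at_top"
proof -
  have [measurable]: "f \<in> borel_measurable borel" using laplace_ableD f by auto
  have [measurable]: "c \<in> borel_measurable borel" using c by auto
  have c_le: "\<bar>c z\<bar> \<le> norm z" for z using c abs_Re_le_cmod abs_Im_le_cmod by auto
  have c_mult: "c (z * of_real k) = c z * k" for z k using c by auto
  have c0: "c 0 = 0" using c by auto
  obtain \<phi> K N where k: "test_fun_on {-1<..<1} \<phi>" "\<And>u. fourier \<phi> u = complex_of_real (K u)" "\<And>u. K u \<ge> 0"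
    "continuous_on UNIV K" "\<And>u. K u \<le> N / (1 + u\<^sup>2)\<^sup>2" "K 0 > 0" "N \<ge> 0"
    using nonneg_kernel_exists[OF zero_less_one] by blast
  have mK [measurable]: "K \<in> borel_measurable borel" using k(4) by (rule borel_measurable_continuous_onI)
  have iK: "integrable lborel K" 
    using integrable_Re[OF fourier_test_integrable[OF k(1)]] by (simp add: k(2))
  define \<kappa> where "\<kappa> = (LINT u|lborel. K u)"
  have \<kappa>: "\<kappa> > 0" unfolding \<kappa>_def by (rule integral_pos_continuous[OF iK k(4,3,6)])
  have B0: "B \<ge> 0" using B[of "X + 1"] by (auto intro: order_trans[OF norm_ge_zero])
  define r0 where "r0 u = (if u \<le> X then c (f u) else 0)" for u
  define r where "r u = (if u \<le> X then 0 else c (f u))" for u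
  have [measurable]: "r0 \<in> borel_measurable borel" "r \<in> borel_measurable borel" unfolding r0_def[abs_def] r_def[abs_def] by measurable
  have rB: "\<bar>r u\<bar> \<le> B" for u using B[of u] B0 c_le[of "f u"] by (auto simp: r_def)
  have ir0: "integrable lborel r0"
  proof (rule Bochner_Integration.integrable_bound[OF integrable_norm[OF laplace_able_head[OF f, of X]]])
    show "AE x in lborel. norm (r0 x) \<le> norm (norm (indicator {..X} x *\<^sub>R f x))"
      by (rule AE_I2) (use c_le in \<open>auto simp: r0_def\<close>)
  qed simp
  show ?thesis
  proof (rule tendstoI)
    fix e :: real assume e: "e > 0"
    \<comment> \<open>One \<epsilon> is spent on slow decrease, one on the mass outside the window
      and one on the average itself; 3 \<epsilon> is then below e.\<close>
    define \<epsilon> where "\<epsilon> = e / 4"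
    have \<epsilon>: "\<epsilon> > 0" using e by (simp add: \<epsilon>_def)
    obtain \<delta> X1 where \<delta>: "\<delta> > 0" and X1: "\<And>x h. x \<ge> X1 \<Longrightarrow> h \<in> {0..\<delta>} \<Longrightarrow> c (f (x + h)) \<ge> c (f x) - \<epsilon>"
      using sd \<epsilon> unfolding slow_decrease_def by metis
    \<comment> \<open>Centered at x + d, the window of radius d is exactly [x, x + \<delta>];
      centered at x - d it is [x - \<delta>, x].\<close>
    define d where "d = \<delta> / 2"
    have d: "d > 0" using \<delta> by (simp add: d_def)
    have "((\<lambda>T. LINT u|lborel. indicator {-T * d..T * d} u * K u) \<longlongrightarrow> \<kappa>) at_top"
      unfolding \<kappa>_def
    proof (rule integral_dominated_convergence_at_top[OF _ _ iK])
      show "AE u in lborel. ((\<lambda>T. indicator {-T * d..T * d} u * K u) \<longlongrightarrow> K u) at_top"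
      proof (rule AE_I2, rule tendsto_eventually)
        show "\<forall>\<^sub>F T in at_top. indicator {-T * d..T * d} u * K u = K u" for u
          using eventually_ge_at_top[of "\<bar>u\<bar> / d"]
        proof eventually_elim
          case (elim T)
          then have "\<bar>u\<bar> \<le> T * d" using d by (simp add: divide_le_eq)
          then have "u \<in> {-T * d..T * d}" by auto
          then show ?case by (simp add: indicator_def)
        qed
      qed
      show "\<forall>\<^sub>F T in at_top. AE u in lborel. norm (indicator {-T * d..T * d} u * K u) \<le> K u"
        using k(3) by (intro always_eventually allI AE_I2) (auto simp: indicator_def)
    qed simp_all
    then have "((\<lambda>T. 2 * B * (\<kappa> - (LINT u|lborel. indicator {-T * d..T * d} u * K u))) \<longlongrightarrow> 2 * B * (\<kappa> - \<kappa>)) at_top"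
      by (intro tendsto_intros)
    then have "\<forall>\<^sub>F T in at_top. 2 * B * (\<kappa> - (LINT u|lborel. indicator {-T * d..T * d} u * K u)) < \<epsilon> * \<kappa>"
      by (rule order_tendstoD) (use \<epsilon> \<kappa> in simp)
    then have "\<forall>\<^sub>F T in at_top. 2 * B * (\<kappa> - (LINT u|lborel. indicator {-T * d..T * d} u * K u)) < \<epsilon> * \<kappa> \<and> T > 0"
      using eventually_gt_at_top[of 0] by (rule eventually_conj)
    then obtain T where T: "2 * B * (\<kappa> - (LINT u|lborel. indicator {-T * d..T * d} u * K u)) < \<epsilon> * \<kappa>" "T > 0"
      unfolding eventually_at_top_linorder by blast
    \<comment> \<open>Concentration by the factor T preserves the integral, and K' is the transform
      of \<phi>(t / T).\<close>
    define K' where "K' u = T * K (T * u)" for u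
    have K'0: "K' u \<ge> 0" for u using T k(3) by (simp add: K'_def)
    have iK': "integrable lborel K'"
      using lborel_integrable_real_affine[OF iK, of T 0] T unfolding K'_def[abs_def] by simp
    have \<kappa>': "(LINT u|lborel. K' u) = \<kappa>"
      using lborel_integral_real_affine[of T K 0] T unfolding K'_def \<kappa>_def by simp
    have \<kappa>1': "(LINT u|lborel. indicator {-d..d} u * K' u) = (LINT u|lborel. indicator {-T * d..T * d} u * K u)"
    proof -
      have "(LINT u|lborel. indicator {-T * d..T * d} u * K u) = \<bar>T\<bar> *\<^sub>R (LINT u|lborel. indicator {-T * d..T * d} (0 + T * u) * K (0 + T * u))"
        by (rule lborel_integral_real_affine) (use T in simp)
      also have "\<dots> = (LINT u|lborel. indicator {-d..d} u * K' u)"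
      proof -
        have "indicator {-T * d..T * d} (0 + T * u) = (indicator {-d..d} u :: real)" for u
          using T mult_le_cancel_left_pos[of T "- d" u] mult_le_cancel_left_pos[of T u d] by (auto simp: indicator_def)
        then show ?thesis using T by (simp add: K'_def mult.left_commute)
      qed
      finally show ?thesis ..
    qed
    have tail: "2 * B * (\<kappa> - (LINT u|lborel. indicator {-d..d} u * K' u)) < \<epsilon> * \<kappa>"
      using T(1) by (simp only: \<kappa>1')
    have [measurable]: "K' \<in> borel_measurable borel" using iK' by auto
    have "test_fun_on UNIV (\<lambda>t. \<phi> ((1 / T) * t + 0))"
      by (rule test_fun_mono[OF test_fun_affine[OF k(1)]]) (use T in auto)
    then have t\<phi>: "test_fun_on UNIV (\<lambda>t. \<phi> (t / T))" by simp
    have four: "fourier (\<lambda>t. \<phi> (t / T)) u = of_real (K' u)" for u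
      unfolding fourier_dilate[OF T(2)] k(2) by (simp add: K'_def)
    define A where "A x = (LINT u|lborel. r u * K' (u - x))" for x
    \<comment> \<open>Below X there is no bound on f, so that part is averaged separately. It is
      integrable, and the kernel moves away from it as x grows.\<close>
    define A0 where "A0 x = (LINT u|lborel. r0 u * K' (u - x))" for x
    have K'b: "K' u \<le> T * N" for u
    proof -
      have "(1::real) \<le> (1 + (T * u)\<^sup>2)\<^sup>2" by (rule one_le_power) simp
      then have "N / (1 + (T * u)\<^sup>2)\<^sup>2 \<le> N" using k(7) by (simp add: divide_le_eq mult_le_cancel_left1)
      then have "K (T * u) \<le> N" using k(5)[of "T * u"] by linarith
      then show ?thesis unfolding K'_def using T by (intro mult_left_mono) auto
    qed
    have iw: "integrable lborel (\<lambda>u. T * N * norm (r0 u))" using ir0 by simp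
    have ib: "norm (r0 u * K' (u - x)) \<le> T * N * norm (r0 u)" for u x
    proof -
      have "\<bar>r0 u\<bar> * K' (u - x) \<le> \<bar>r0 u\<bar> * (T * N)" by (intro mult_left_mono K'b) simp
      then show ?thesis using K'0[of "u - x"] by (simp add: abs_mult mult.commute)
    qed
    have "((\<lambda>x. LINT u|lborel. r0 u * K' (u - x)) \<longlongrightarrow> (LINT u|(lborel::real measure). 0)) at_top"
    proof (rule integral_dominated_convergence_at_top[OF _ _ iw])
      show "AE u in lborel. ((\<lambda>x. r0 u * K' (u - x)) \<longlongrightarrow> 0) at_top"
      proof (rule AE_I2)
        fix u
        have "((\<lambda>x. K' (u - x)) \<longlongrightarrow> 0) at_top"
        proof (rule tendsto_sandwich[of "\<lambda>x. 0" _ _ "\<lambda>x. T * (N / (1 + (T * (u - x))\<^sup>2)\<^sup>2)"])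
          show "((\<lambda>x. T * (N / (1 + (T * (u - x))\<^sup>2)\<^sup>2)) \<longlongrightarrow> 0) at_top" using T(2) by real_asymp
          have "K' (u - x) \<le> T * (N / (1 + (T * (u - x))\<^sup>2)\<^sup>2)" for x
            unfolding K'_def using T(2) by (intro mult_left_mono k(5)) simp
          then show "\<forall>\<^sub>F x in at_top. K' (u - x) \<le> T * (N / (1 + (T * (u - x))\<^sup>2)\<^sup>2)" by (intro always_eventually allI)
        qed (use K'0 in auto)
        then show "((\<lambda>x. r0 u * K' (u - x)) \<longlongrightarrow> 0) at_top" by (rule tendsto_mult_right_zero)
      qed
      show "\<forall>\<^sub>F x in at_top. AE u in lborel. norm (r0 u * K' (u - x)) \<le> T * N * norm (r0 u)"
        using ib by (intro always_eventually allI AE_I2)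
    qed simp_all
    then have A0_lim: "(A0 \<longlongrightarrow> 0) at_top" by (simp add: A0_def[abs_def])
    have iff: "integrable lborel (\<lambda>u. f u * of_real (K' (u - x)))" for x
      unfolding four[symmetric] by (rule average_integrable[OF f B t\<phi>])
    have i0: "integrable lborel (\<lambda>u. r0 u * K' (u - x))" for x
      by (rule Bochner_Integration.integrable_bound[OF iw]) (simp, intro AE_I2 order_trans[OF ib abs_ge_self[where 'a=real, folded real_norm_def]])
    have icf: "integrable lborel (\<lambda>u. c (f u) * K' (u - x))" and 
      vcf: "(LINT u|lborel. c (f u) * K' (u - x)) = c (average f (\<lambda>t. \<phi> (t / T)) x)" for x
    proof -
      show "integrable lborel (\<lambda>u. c (f u) * K' (u - x))"
        using integrable_Re[OF iff[of x]] integrable_Im[OF iff[of x]] c by auto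
      show "(LINT u|lborel. c (f u) * K' (u - x)) = c (average f (\<lambda>t. \<phi> (t / T)) x)"
        using integral_Re[OF iff[of x]] integral_Im[OF iff[of x]] c unfolding average_def four by auto
    qed
    have "A = (\<lambda>x. c (average f (\<lambda>t. \<phi> (t / T)) x) - A0 x)"
    proof
      fix x
      have "r u * K' (u - x) = c (f u) * K' (u - x) - r0 u * K' (u - x)" for u by (simp add: r_def r0_def)
      then show "A x = c (average f (\<lambda>t. \<phi> (t / T)) x) - A0 x" unfolding A_def A0_def vcf[symmetric] using icf i0 by simp
    qed
    moreover have "((\<lambda>x. c (average f (\<lambda>t. \<phi> (t / T)) x)) \<longlongrightarrow> 0) at_top"
      using tendsto_Re[OF reg[OF t\<phi>]] tendsto_Im[OF reg[OF t\<phi>]] c by auto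
    ultimately have A_lim: "(A \<longlongrightarrow> 0) at_top"
      using tendsto_diff[OF _ A0_lim, of "\<lambda>x. c (average f (\<lambda>t. \<phi> (t / T)) x)" 0] by simp
    have A_shift: "A y = (LINT v|lborel. r (y + v) * K' v)" for y
      using lborel_integral_real_affine[of 1 "\<lambda>u. r u * K' (u - y)" y] by (simp add: A_def)
    have "\<forall>\<^sub>F x in at_top. \<bar>A x\<bar> < \<epsilon> * \<kappa>"
      using tendstoD[OF A_lim, of "\<epsilon> * \<kappa>"] \<epsilon> \<kappa> by simp
    then obtain X2 where X2: "\<And>x. x \<ge> X2 \<Longrightarrow> \<bar>A x\<bar> < \<epsilon> * \<kappa>" unfolding eventually_at_top_linorder by blast
    \<comment> \<open>All points used below are at least x - \<delta>; the threshold places them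
      beyond X, X1 and X2.\<close>
    define X3 where "X3 = max (max X X1 + 2 * \<delta> + 1) (X2 + \<delta>)"
    have "dist (c (f x)) 0 < e" if x: "x \<ge> X3" for x
    proof -
      have rx: "r u = c (f u)" if "u \<ge> x - \<delta>" for u using that x \<delta> by (auto simp: r_def X3_def)
      have dd: "2 * d = \<delta>" by (simp add: d_def)
      have up: "r (x + d + v) \<ge> r x - \<epsilon>" if "\<bar>v\<bar> \<le> d" for v
      proof -
        have "c (f (x + (d + v))) \<ge> c (f x) - \<epsilon>" using that x \<delta> dd by (intro X1) (auto simp: X3_def abs_le_iff)
        then show ?thesis using rx[of x] rx[of "x + d + v"] that \<delta> d by (simp add: add.assoc abs_le_iff)
      qed
      have lo: "- r (x - d + v) \<ge> - r x - \<epsilon>" if "\<bar>v\<bar> \<le> d" for v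
      proof -
        have "c (f (x - d + v + (d - v))) \<ge> c (f (x - d + v)) - \<epsilon>" using that x \<delta> dd by (intro X1) (auto simp: X3_def abs_le_iff)
        then show ?thesis using rx[of x] rx[of "x - d + v"] that \<delta> d dd by (simp add: abs_le_iff)
      qed
      have "(r x - \<epsilon>) * \<kappa> - 2 * B * (\<kappa> - (LINT u|lborel. indicator {-d..d} u * K' u)) \<le> A (x + d)"
        unfolding A_shift \<kappa>'[symmetric]
        by (rule average_lower_bound[OF K'0 iK', where r=r and B=B and c="r x" and d=d and y="x + d" and \<epsilon>=\<epsilon>]) (use up rB \<epsilon> in auto)
      moreover have "A (x + d) < \<epsilon> * \<kappa>" using X2[of "x + d"] x \<delta> d by (simp add: X3_def)
      ultimately have "(r x - \<epsilon>) * \<kappa> < (2 * \<epsilon>) * \<kappa>" using tail by simp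
      then have 1: "r x < 3 * \<epsilon>" using \<kappa> by (simp add: mult_less_cancel_right_pos)
      have "(- r x - \<epsilon>) * \<kappa> - 2 * B * (\<kappa> - (LINT u|lborel. indicator {-d..d} u * K' u)) \<le> (LINT v|lborel. - r (x - d + v) * K' v)"
        unfolding \<kappa>'[symmetric]
        by (rule average_lower_bound[OF K'0 iK', where r="\<lambda>u. - r u" and B=B and c="- r x" and d=d and y="x - d" and \<epsilon>=\<epsilon>]) (use lo rB \<epsilon> in auto)
      also have "\<dots> = - A (x - d)" unfolding A_shift by simp
      finally have "(- r x - \<epsilon>) * \<kappa> - 2 * B * (\<kappa> - (LINT u|lborel. indicator {-d..d} u * K' u)) \<le> - A (x - d)" .
      moreover have "- A (x - d) < \<epsilon> * \<kappa>" using X2[of "x - d"] x \<delta> d dd by (simp add: X3_def)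
      ultimately have "(- r x - \<epsilon>) * \<kappa> < (2 * \<epsilon>) * \<kappa>" using tail by simp
      then have 2: "- r x < 3 * \<epsilon>" using \<kappa> by (simp add: mult_less_cancel_right_pos)
      show ?thesis using 1 2 rx[of x] \<delta> e by (simp add: \<epsilon>_def abs_less_iff)
    qed
    then show "\<forall>\<^sub>F x in at_top. dist (c (f x)) 0 < e" unfolding eventually_at_top_linorder by blast
  qed
qed

theorem laplace_tauberian:
  assumes f: "laplace_able f" and Re: "slow_decrease (\<lambda>x. Re (f x))" and Im: "slow_decrease (\<lambda>x. Im (f x))"
    and E: "closed E" "E \<in> null_sets lborel" and pf: "local_pf_boundary (- E) (laplace f)"
    and pm: "\<And>t. t \<in> E \<Longrightarrow> pm_boundary_at t (\<lambda>s. laplace f s / (s - \<i> * of_real t))"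
  shows "(f \<longlongrightarrow> 0) at_top"
proof -
  obtain X1 C1 where 1: "X1 \<ge> 0" "C1 \<ge> 0" "\<And>x h. x \<ge> X1 \<Longrightarrow> h \<ge> 0 \<Longrightarrow> Re (f (x + h)) \<ge> Re (f x) - C1 * (1 + h)"
    using slow_decrease_imp_bounded_decrease[OF Re] by blast
  obtain X2 C2 where 2: "X2 \<ge> 0" "C2 \<ge> 0" "\<And>x h. x \<ge> X2 \<Longrightarrow> h \<ge> 0 \<Longrightarrow> Im (f (x + h)) \<ge> Im (f x) - C2 * (1 + h)"
    using slow_decrease_imp_bounded_decrease[OF Im] by blast
  define X where "X = max X1 X2"
  define C where "C = max C1 C2"
  have XC: "X \<ge> 0" "C \<ge> 0" using 1 2 by (auto simp: X_def C_def)
  have bd1: "Re (f (x + h)) \<ge> Re (f x) - C * (1 + h)" if "x \<ge> X" "h \<ge> 0" for x h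
  proof -
    have "C1 * (1 + h) \<le> C * (1 + h)" using that by (intro mult_right_mono) (auto simp: C_def)
    moreover have "Re (f (x + h)) \<ge> Re (f x) - C1 * (1 + h)" using 1(3)[of x h] that by (simp add: X_def)
    ultimately show ?thesis by linarith
  qed
  have bd2: "Im (f (x + h)) \<ge> Im (f x) - C * (1 + h)" if "x \<ge> X" "h \<ge> 0" for x h
  proof -
    have "C2 * (1 + h) \<le> C * (1 + h)" using that by (intro mult_right_mono) (auto simp: C_def)
    moreover have "Im (f (x + h)) \<ge> Im (f x) - C2 * (1 + h)" using 2(3)[of x h] that by (simp add: X_def)
    ultimately show ?thesis by linarith
  qed
  \<comment> \<open>If 0 lies in E, the hypothesis concerns the transform divided by s, that is, the
    transform of the primitive, and multiplication by s keeps the bounds. If 0 lies outside E, the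
    pseudofunction behavior there already gives them.\<close>
  have pm0: "pm_near (laplace f) 0"
  proof (cases "0 \<in> E")
    case True
    obtain a b where ab: "a < 0" "0 < b" "boundary_behavior local_pseudomeasure {a<..<b} (\<lambda>s. laplace f s / (s - \<i> * of_real 0))"
      using pm[OF True] unfolding pm_boundary_at_def by blast
    have "pm_near (\<lambda>s. laplace f s / (s - \<i> * of_real 0)) 0"
      by (rule boundary_behavior_pm_near[OF ab(3)]) (use ab in auto)
    moreover have q: "laplace (primitive f) s = laplace f s / (s - \<i> * of_real 0)" if "Re s > 0" for s
      using laplace_primitive(2)[OF f that] by simp
    ultimately have "pm_near (laplace (primitive f)) 0" using pm_near_cong[OF q] by simp
    then show ?thesis by (intro pm_near_quotient[OF f laplace_primitive(1)[OF f], of 0] q)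
  next
    case False
    then show ?thesis
      by (intro boundary_behavior_pm_near[OF pf[unfolded local_pf_boundary_def]]) (auto simp: pf_transform_def)
  qed
  obtain B where B: "\<And>x. x \<ge> X \<Longrightarrow> norm (f x) \<le> B"
    by (rule pm_near_bounded[OF f pm0 XC bd1 bd2]) auto
  have B': "norm (f x) \<le> B" if "x > X" for x using B that by simp
  have reg: "(average f \<phi> \<longlongrightarrow> 0) at_top" if "test_fun_on UNIV \<phi>" for \<phi>
  proof (rule regular_local[OF f, of X B UNIV \<phi>])
    show "\<exists>V. open V \<and> t \<in> V \<and> regular_on f V" for t
      by (rule no_singular_points[OF f _ XC(1) E pf, of B t]) (use B pm in auto)
  qed (use B' that in auto)
  have "((\<lambda>x. Re (f x)) \<longlongrightarrow> 0) at_top" "((\<lambda>x. Im (f x)) \<longlongrightarrow> 0) at_top"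
    by (rule slow_decrease_tendsto_0[OF f B' reg _ Re] slow_decrease_tendsto_0[OF f B' reg _ Im]; simp)+
  then show ?thesis unfolding tendsto_complex_iff by simp
qed

section \<open>Reduction to a Laplace transform that converges absolutely\<close>

lemma slowly_decreasing_real_imp:
  assumes "slowly_decreasing_real r"
  shows "slow_decrease r"
  unfolding slow_decrease_def
proof (intro allI impI)
  fix e :: real assume "e > 0"
  then obtain d where d: "d > 0" "Liminf at_top (\<lambda>x. INF h\<in>{0..d}. ereal (r (x + h) - r x)) > - ereal e"
    using assms unfolding slowly_decreasing_real_def by blast
  then have "\<forall>\<^sub>F x in at_top. - ereal e < (INF h\<in>{0..d}. ereal (r (x + h) - r x))" by (intro less_LiminfD)
  then obtain X where X: "\<And>x. x \<ge> X \<Longrightarrow> - ereal e < (INF h\<in>{0..d}. ereal (r (x + h) - r x))"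
    unfolding eventually_at_top_linorder by blast
  have "r (x + h) \<ge> r x - e" if "x \<ge> X" "h \<in> {0..d}" for x h
  proof -
    have "- ereal e < ereal (r (x + h) - r x)" by (rule less_le_trans[OF X[OF that(1)] INF_lower[OF that(2)]])
    then show ?thesis by simp
  qed
  then show "\<exists>d>0. \<exists>X. \<forall>x\<ge>X. \<forall>h\<in>{0..d}. r (x + h) \<ge> r x - e" using d(1) by blast
qed

lemma slow_decrease_perturb:
  assumes "slow_decrease r" "\<And>x h. x \<ge> 0 \<Longrightarrow> h \<ge> 0 \<Longrightarrow> q (x + h) - q x \<ge> r (x + h) - r x - M * h" "M \<ge> 0"
  shows "slow_decrease q"
  unfolding slow_decrease_def
proof (intro allI impI)
  fix e :: real assume e: "e > 0"
  then obtain d X where d: "d > 0" and X: "\<And>x h. x \<ge> X \<Longrightarrow> h \<in> {0..d} \<Longrightarrow> r (x + h) \<ge> r x - e / 2"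
    using assms(1) unfolding slow_decrease_def by (metis half_gt_zero)
  \<comment> \<open>Half of e goes to the slow decrease of r, the other half to M h; the 1 added to
    M covers M = 0.\<close>
  define d' where "d' = min d (e / (2 * (M + 1)))"
  have d': "d' > 0" using d e assms(3) by (simp add: d'_def)
  have Md: "M * h \<le> e / 2" if "h \<in> {0..d'}" for h
  proof -
    have "h \<le> e / (2 * (M + 1))" using that by (simp add: d'_def)
    then have "(M + 1) * h \<le> e / 2" using assms(3) by (simp add: field_simps)
    moreover have "M * h \<le> (M + 1) * h" using that by (intro mult_right_mono) auto
    ultimately show ?thesis by linarith
  qed
  have "q (x + h) \<ge> q x - e" if "x \<ge> max X 0" "h \<in> {0..d'}" for x h
  proof -
    have "r (x + h) \<ge> r x - e / 2" using that by (intro X) (auto simp: d'_def)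
    then show ?thesis using assms(2)[of x h] Md[OF that(2)] that by simp
  qed
  then show "\<exists>d>0. \<exists>X. \<forall>x\<ge>X. \<forall>h\<in>{0..d}. q (x + h) \<ge> q x - e" using d' by blast
qed

text \<open>Half of the exponent is given up to absorb the linear factor: 1 + x is at most (1 + 2 /
  \<sigma>) exp (\<sigma> x / 2) on the half-line.\<close>

lemma exp_decay_integrable:
  fixes \<sigma> :: real
  assumes "\<sigma> > 0"
  shows "integrable lborel (\<lambda>x. indicator {0..} x * ((1 + x) * exp (- \<sigma> * x)))"
proof (rule Bochner_Integration.integrable_bound)
  have "integrable lborel (\<lambda>x. norm (indicator {0..} x *\<^sub>R exp (- of_real (\<sigma> / 2) * complex_of_real x)))"
    using laplace_indicator_atLeast(1)[of "of_real (\<sigma> / 2)" 0] assms by (intro integrable_norm) simp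
  also have "(\<lambda>x. norm (indicator {0..} x *\<^sub>R exp (- of_real (\<sigma> / 2) * complex_of_real x))) = (\<lambda>x. indicator {0..} x * exp (- (\<sigma> / 2) * x))"
    by (auto simp: norm_exp_eq_Re indicator_def)
  finally show "integrable lborel (\<lambda>x. (1 + 2 / \<sigma>) * (indicator {0..} x * exp (- (\<sigma> / 2) * x)))"
    by (rule integrable_mult_right)
  show "AE x in lborel. norm (indicator {0..} x * ((1 + x) * exp (- \<sigma> * x))) \<le> norm ((1 + 2 / \<sigma>) * (indicator {0..} x * exp (- (\<sigma> / 2) * x)))"
  proof (rule AE_I2)
    fix x :: real
    show "norm (indicator {0..} x * ((1 + x) * exp (- \<sigma> * x))) \<le> norm ((1 + 2 / \<sigma>) * (indicator {0..} x * exp (- (\<sigma> / 2) * x)))"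
    proof (cases "x \<ge> 0")
      case True
      have "1 + x \<le> (1 + 2 / \<sigma>) * (1 + \<sigma> / 2 * x)" using assms True by (simp add: field_simps)
      also have "\<dots> \<le> (1 + 2 / \<sigma>) * exp (\<sigma> / 2 * x)" using assms by (intro mult_left_mono exp_ge_add_one_self) auto
      finally have "(1 + x) * exp (- \<sigma> * x) \<le> ((1 + 2 / \<sigma>) * exp (\<sigma> / 2 * x)) * exp (- \<sigma> * x)" by (rule mult_right_mono) simp
      also have "\<dots> = (1 + 2 / \<sigma>) * exp (- (\<sigma> / 2) * x)" unfolding mult.assoc exp_add[symmetric] by (simp add: field_simps)
      finally show ?thesis using True assms by (simp add: abs_mult)
    qed (simp add: indicator_def)
  qed
qed simp

text \<open>A boundedly decreasing function exceeds a linear one, so after adding a linear function the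
  convergence of the improper integral is monotone, hence absolute.\<close>

lemma improper_laplace_absolute:
  fixes r :: "real \<Rightarrow> real"
  assumes [measurable]: "r \<in> borel_measurable borel" and loc: "\<And>T. integrable lborel (\<lambda>x. indicator {0..T} x * (exp (- \<sigma> * x) * r x))"
    and \<sigma>: "\<sigma> > 0" and X: "X \<ge> 0" and C: "C \<ge> 0" and bd: "\<And>x h. x \<ge> X \<Longrightarrow> h \<ge> 0 \<Longrightarrow> r (x + h) \<ge> r x - C * (1 + h)"
    and lim: "((\<lambda>T. LINT x|lborel. indicator {0..T} x * (exp (- \<sigma> * x) * r x)) \<longlongrightarrow> l) at_top"
  shows "integrable lborel (\<lambda>x. indicator {0..} x * (exp (- \<sigma> * x) * r x))"
proof -
  \<comment> \<open>Bounded decrease from X gives r u \<ge> r X - C (1 + u), and c (1 + u)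
    compensates both terms.\<close>
  define c where "c = \<bar>r X\<bar> + C"
  have c: "c \<ge> 0" using C by (simp add: c_def)
  have r_lb: "r u + c * (1 + u) \<ge> 0" if "u \<ge> X" for u
  proof -
    have "r X - C * (1 + (u - X)) \<le> r (X + (u - X))" using that by (intro bd) auto
    moreover have "C * (1 + (u - X)) \<le> C * (1 + u)" using C X that by (intro mult_left_mono) auto
    moreover have "\<bar>r X\<bar> * 1 \<le> \<bar>r X\<bar> * (1 + u)" using X that by (intro mult_left_mono) auto
    ultimately have "- (\<bar>r X\<bar> * (1 + u) + C * (1 + u)) \<le> r (X + (u - X))"
      using abs_ge_minus_self[of "r X"] by linarith
    then show ?thesis unfolding c_def distrib_right[of "\<bar>r X\<bar>"] by simp
  qed
  define a where "a x = exp (- \<sigma> * x) * r x" for x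
  \<comment> \<open>The linear compensation with its exponential weight is integrable on its own, so
    adding it to the integrand and removing it at the end changes nothing about convergence.\<close>
  define w where "w x = indicator {X..} x * (c * ((1 + x) * exp (- \<sigma> * x)))" for x
  have [measurable]: "a \<in> borel_measurable borel" "w \<in> borel_measurable borel" unfolding a_def[abs_def] w_def[abs_def] by measurable
  have iw: "integrable lborel w"
  proof (rule Bochner_Integration.integrable_bound[OF integrable_mult_right[OF exp_decay_integrable[OF \<sigma>], of c]])
    show "AE x in lborel. norm (w x) \<le> norm (c * (indicator {0..} x * ((1 + x) * exp (- \<sigma> * x))))"
      by (rule AE_I2) (use X in \<open>auto simp: w_def indicator_def\<close>)
  qed simp
  have ih: "integrable lborel (\<lambda>x. indicator {0..<X} x * a x)"
  proof (rule Bochner_Integration.integrable_bound[OF loc[of X, folded a_def]])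
    show "AE x in lborel. norm (indicator {0..<X} x * a x) \<le> norm (indicator {0..X} x * a x)"
      by (rule AE_I2) (auto simp: indicator_def)
  qed simp
  have ihn: "integrable lborel (\<lambda>x. indicator {..real n} x * (indicator {0..<X} x * a x))" for n
    by (rule Bochner_Integration.integrable_bound[OF ih]) (auto simp: indicator_def intro!: AE_I2)
  have iwn: "integrable lborel (\<lambda>x. indicator {..real n} x * w x)" for n
    by (rule Bochner_Integration.integrable_bound[OF iw]) (auto simp: indicator_def intro!: AE_I2)
  have cut: "(\<lambda>n. indicator {..real n} x * z) \<longlonglongrightarrow> z" for x z :: real
  proof (rule tendsto_eventually)
    have "\<forall>\<^sub>F n in sequentially. x \<le> real n" 
      using filterlim_real_sequentially unfolding filterlim_at_top by blast
    then show "\<forall>\<^sub>F n in sequentially. indicator {..real n} x * z = z" by eventually_elim (simp add: indicator_def)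
  qed
  have dct: "(\<lambda>n. LINT x|lborel. indicator {..real n} x * k x) \<longlonglongrightarrow> (LINT x|lborel. k x)" if "integrable lborel k" for k :: "real \<Rightarrow> real"
  proof (rule integral_dominated_convergence[OF _ _ integrable_norm[OF that]])
    show "AE x in lborel. (\<lambda>n. indicator {..real n} x * k x) \<longlonglongrightarrow> k x" using cut by simp
    show "AE x in lborel. norm (indicator {..real n} x * k x) \<le> norm (k x)" for n by (rule AE_I2) (auto simp: indicator_def)
  qed (use that in auto)
  define g where "g x = indicator {X..} x * a x + w x" for x
  have [measurable]: "g \<in> borel_measurable borel" unfolding g_def[abs_def] by measurable
  have g0: "g x \<ge> 0" for x
  proof (cases "x \<ge> X")
    case True
    have "0 \<le> exp (- \<sigma> * x) * (r x + c * (1 + x))" using r_lb[OF True] by simp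
    then show ?thesis using True by (simp add: g_def a_def w_def algebra_simps)
  qed (simp add: g_def w_def)
  have gn: "indicator {..real n} x * g x = indicator {0..real n} x * a x - indicator {..real n} x * (indicator {0..<X} x * a x) + indicator {..real n} x * w x" for n x
    using X by (auto simp: g_def indicator_def)
  have ign: "integrable lborel (\<lambda>x. indicator {..real n} x * g x)" for n
    unfolding gn by (intro Bochner_Integration.integrable_add Bochner_Integration.integrable_diff loc[folded a_def] ihn iwn)
  have limg: "(\<lambda>n. LINT x|lborel. indicator {..real n} x * g x) \<longlonglongrightarrow> l - (LINT x|lborel. indicator {0..<X} x * a x) + (LINT x|lborel. w x)"
    unfolding gn Bochner_Integration.integral_add[OF Bochner_Integration.integrable_diff[OF loc[folded a_def] ihn] iwn]
      Bochner_Integration.integral_diff[OF loc[folded a_def] ihn]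
    by (intro tendsto_add tendsto_diff dct ih iw filterlim_compose[OF lim[folded a_def] filterlim_real_sequentially])
  have mono: "AE x in lborel. mono (\<lambda>n. indicator {..real n} x * g x)"
  proof (rule AE_I2)
    show "mono (\<lambda>n. indicator {..real n} x * g x)" for x
      using g0[of x] by (auto simp: mono_def indicator_def)
  qed
  have ig: "integrable lborel g"
    by (rule integrable_monotone_convergence[OF ign mono _ limg]) (use cut in auto)
  have "indicator {0..} x * (exp (- \<sigma> * x) * r x) = g x - w x + indicator {0..<X} x * a x" for x
    using X by (auto simp: g_def a_def indicator_def)
  then show ?thesis using ig iw ih by simp
qed

text \<open>\<open>laplace_able\<close> demands vanishing at every negative point. Truncation
  provides this for \<tau>, for g and for the constant b alike, and leaves the behavior at infinity
  untouched.\<close>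

definition half_line :: "(real \<Rightarrow> complex) \<Rightarrow> real \<Rightarrow> complex" where
  "half_line f x = (if x < 0 then 0 else f x)"

lemma half_line_indicator: "half_line f x = indicator {0..} x *\<^sub>R f x"
  by (simp add: half_line_def indicator_def)

text \<open>Absolute convergence is obtained at real \<sigma>, for real and imaginary part
  separately, since slow decrease is a condition on each. It then holds for every s with positive
  real part, and dominated convergence identifies the integral with the improper limit.\<close>

lemma improper_laplace:
  fixes \<tau> :: "real \<Rightarrow> complex" and L :: "complex \<Rightarrow> complex"
  assumes meas: "\<tau> \<in> borel_measurable lborel" and loc: "\<And>u v. set_integrable lborel {u..v} \<tau>"
    and sd: "slow_decrease (\<lambda>x. Re (\<tau> x))" "slow_decrease (\<lambda>x. Im (\<tau> x))"
    and L: "\<And>s. Re s > 0 \<Longrightarrow> ((\<lambda>T::real. LBINT x=0..T. \<tau> x * exp (- s * of_real x)) \<longlongrightarrow> L s) at_top"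
  shows "laplace_able (half_line \<tau>)" "\<And>s. Re s > 0 \<Longrightarrow> laplace (half_line \<tau>) s = L s"
proof -
  have [measurable]: "\<tau> \<in> borel_measurable borel" using meas by simp
  have [measurable]: "half_line \<tau> \<in> borel_measurable borel" unfolding half_line_def[abs_def] by measurable
  have iT: "integrable lborel (\<lambda>x. indicator {0..T} x *\<^sub>R (exp (- s * of_real x) * \<tau> x))" if "Re s > 0" for s T
  proof (rule Bochner_Integration.integrable_bound)
    have [measurable]: "(\<lambda>x::real. exp (- s * of_real x)) \<in> borel_measurable borel"
      by (intro borel_measurable_continuous_onI continuous_intros)
    show "integrable lborel (\<lambda>x. indicator {0..T} x *\<^sub>R \<tau> x)" using loc by (simp add: set_integrable_def)
    show "(\<lambda>x. indicator {0..T} x *\<^sub>R (exp (- s * of_real x) * \<tau> x)) \<in> borel_measurable lborel" by simp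
    have "norm (exp (- s * of_real x) * \<tau> x) \<le> norm (\<tau> x)" if "x \<ge> 0" for x
      using that \<open>Re s > 0\<close> unfolding norm_mult norm_exp_minus by (intro mult_left_le_one_le) auto
    then show "AE x in lborel. norm (indicator {0..T} x *\<^sub>R (exp (- s * of_real x) * \<tau> x)) \<le> norm (indicator {0..T} x *\<^sub>R \<tau> x)"
      by (intro AE_I2) (simp add: indicator_def)
  qed
  have lim: "((\<lambda>T. LINT x|lborel. indicator {0..T} x *\<^sub>R (exp (- s * of_real x) * \<tau> x)) \<longlongrightarrow> L s) at_top" if "Re s > 0" for s
  proof (rule Lim_transform_eventually[OF L[OF that]])
    show "\<forall>\<^sub>F T in at_top. (LBINT x=0..ereal T. \<tau> x * exp (- s * of_real x)) = (LINT x|lborel. indicator {0..T} x *\<^sub>R (exp (- s * of_real x) * \<tau> x))"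
      using eventually_ge_at_top[of 0]
    proof eventually_elim
      case (elim T)
      have "(LBINT x=ereal 0..ereal T. \<tau> x * exp (- s * of_real x)) = (LBINT x:{0..T}. \<tau> x * exp (- s * of_real x))"
        by (rule interval_integral_Icc[OF elim])
      then show ?case by (simp add: set_lebesgue_integral_def mult.commute[of "\<tau> _"] zero_ereal_def)
    qed
  qed
  have abs: "integrable lborel (\<lambda>x. indicator {0..} x * (exp (- \<sigma> * x) * c (\<tau> x)))" if \<sigma>: "\<sigma> > 0" and c: "c = Re \<or> c = Im" for \<sigma> c
  proof -
    have "slow_decrease (\<lambda>x. c (\<tau> x))" using c sd by auto
    then obtain X C where XC: "X \<ge> 0" "C \<ge> 0" "\<And>x h. x \<ge> X \<Longrightarrow> h \<ge> 0 \<Longrightarrow> c (\<tau> (x + h)) \<ge> c (\<tau> x) - C * (1 + h)"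
      using slow_decrease_imp_bounded_decrease by blast
    have [measurable]: "c \<in> borel_measurable borel" using c by auto
    have s: "Re (of_real \<sigma>) > 0" using \<sigma> by simp
    have eq: "c (indicator {0..T} x *\<^sub>R (exp (- of_real \<sigma> * of_real x) * \<tau> x)) = indicator {0..T} x * (exp (- \<sigma> * x) * c (\<tau> x))" for T x
    proof -
      have "exp (- of_real \<sigma> * of_real x) = complex_of_real (exp (- \<sigma> * x))" by (simp add: exp_of_real[symmetric])
      then show ?thesis using c by (auto simp: indicator_def)
    qed
    have i: "integrable lborel (\<lambda>x. indicator {0..T} x * (exp (- \<sigma> * x) * c (\<tau> x)))" for T
      using integrable_Re[OF iT[OF s, of T]] integrable_Im[OF iT[OF s, of T]] c unfolding eq[symmetric] by auto
    have v: "(LINT x|lborel. indicator {0..T} x * (exp (- \<sigma> * x) * c (\<tau> x))) = c (LINT x|lborel. indicator {0..T} x *\<^sub>R (exp (- of_real \<sigma> * of_real x) * \<tau> x))" for T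
      unfolding eq[symmetric] using integral_Re[OF iT[OF s, of T]] integral_Im[OF iT[OF s, of T]] c by auto
    have "((\<lambda>T. c (LINT x|lborel. indicator {0..T} x *\<^sub>R (exp (- of_real \<sigma> * of_real x) * \<tau> x))) \<longlongrightarrow> c (L (of_real \<sigma>))) at_top"
      using tendsto_Re[OF lim[OF s]] tendsto_Im[OF lim[OF s]] c by auto
    from improper_laplace_absolute[OF _ i \<sigma> XC(1,2,3) this[folded v]] show ?thesis by simp
  qed
  have int: "integrable lborel (\<lambda>x. of_real (exp (- \<sigma> * x)) * half_line \<tau> x)" if "\<sigma> > 0" for \<sigma>
  proof -
    have "integrable lborel (\<lambda>x. complex_of_real (indicator {0..} x * (exp (- \<sigma> * x) * Re (\<tau> x))) + \<i> * complex_of_real (indicator {0..} x * (exp (- \<sigma> * x) * Im (\<tau> x))))"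
      using abs[OF that] by (intro Bochner_Integration.integrable_add integrable_mult_right integrable_of_real) auto
    also have "(\<lambda>x. complex_of_real (indicator {0..} x * (exp (- \<sigma> * x) * Re (\<tau> x))) + \<i> * complex_of_real (indicator {0..} x * (exp (- \<sigma> * x) * Im (\<tau> x))))
      = (\<lambda>x. of_real (exp (- \<sigma> * x)) * half_line \<tau> x)"
      by (auto simp: half_line_def indicator_def complex_eq_iff)
    finally show ?thesis .
  qed
  show able: "laplace_able (half_line \<tau>)" unfolding laplace_able_def using int by (simp add: half_line_def)
  show "laplace (half_line \<tau>) s = L s" if s: "Re s > 0" for s
  proof -
    have [measurable]: "(\<lambda>x::real. exp (- s * of_real x)) \<in> borel_measurable borel"
      by (intro borel_measurable_continuous_onI continuous_intros)
    have "((\<lambda>T. LINT x|lborel. indicator {0..T} x *\<^sub>R (exp (- s * of_real x) * \<tau> x)) \<longlongrightarrow> laplace (half_line \<tau>) s) at_top"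
      unfolding laplace_def
    proof (rule integral_dominated_convergence_at_top[OF _ _ integrable_norm[OF laplace_integrable[OF able s]]])
      show "AE x in lborel. ((\<lambda>T. indicator {0..T} x *\<^sub>R (exp (- s * of_real x) * \<tau> x)) \<longlongrightarrow> exp (- s * of_real x) * half_line \<tau> x) at_top"
      proof (rule AE_I2, rule tendsto_eventually)
        show "\<forall>\<^sub>F T in at_top. indicator {0..T} x *\<^sub>R (exp (- s * of_real x) * \<tau> x) = exp (- s * of_real x) * half_line \<tau> x" for x
          using eventually_ge_at_top[of x] by eventually_elim (simp add: indicator_def half_line_def)
      qed
      show "\<forall>\<^sub>F T in at_top. AE x in lborel. norm (indicator {0..T} x *\<^sub>R (exp (- s * of_real x) * \<tau> x)) \<le> norm (exp (- s * of_real x) * half_line \<tau> x)"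
        by (intro always_eventually allI AE_I2) (simp add: indicator_def half_line_def)
    qed simp_all
    then show ?thesis using tendsto_unique[OF _ _ lim[OF s]] by simp
  qed
qed

lemma primitive_lipschitz:
  assumes g: "laplace_able g" and M: "AE x in lborel. norm (g x) \<le> M" and "h \<ge> 0"
  shows "norm (primitive g (x + h) - primitive g x) \<le> M * h"
proof -
  have i: "integrable lborel (\<lambda>u. indicator {..x + h} u *\<^sub>R g u - indicator {..x} u *\<^sub>R g u)"
    by (intro Bochner_Integration.integrable_diff laplace_able_head[OF g])
  have "norm (primitive g (x + h) - primitive g x) = norm (LINT u|lborel. indicator {..x + h} u *\<^sub>R g u - indicator {..x} u *\<^sub>R g u)"
    unfolding primitive_def using laplace_able_head[OF g] by simp
  also have "\<dots> \<le> (LINT u|lborel. norm (indicator {..x + h} u *\<^sub>R g u - indicator {..x} u *\<^sub>R g u))" by (rule integral_norm_bound)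
  also have "\<dots> \<le> (LINT u|lborel. M * indicator {x<..x + h} u)"
  proof (rule integral_mono_AE[OF integrable_norm[OF i]])
    show "integrable lborel (\<lambda>u. M * indicator {x<..x + h} u)" 
      by (intro integrable_mult_right integrable_real_indicator) (use assms in auto)
    show "AE u in lborel. norm (indicator {..x + h} u *\<^sub>R g u - indicator {..x} u *\<^sub>R g u) \<le> M * indicator {x<..x + h} u"
      using M by eventually_elim (use assms(3) in \<open>auto simp: indicator_def\<close>)
  qed
  also have "\<dots> = M * h" using assms(3) by simp
  finally show ?thesis .
qed

theorem theorem5p1:
  fixes \<tau> g :: "real \<Rightarrow> complex" and b :: complex
    and L G :: "complex \<Rightarrow> complex" and E :: "real set"
  assumes tau_meas: "\<tau> \<in> borel_measurable lborel"
    and tau_loc: "\<And>u v. set_integrable lborel {u..v} \<tau>"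
    and tau_supp: "AE x in lborel. x < 0 \<longrightarrow> \<tau> x = 0"
    and tau_sd: "slowly_decreasing \<tau>"
    and L_def: "\<And>s. Re s > 0 \<Longrightarrow>
       ((\<lambda>T::real. LBINT x=0..T. \<tau> x * exp (- s * of_real x)) \<longlongrightarrow> L s) at_top"
    and g_meas: "g \<in> borel_measurable lborel"
    and g_bdd: "\<exists>M. AE x in lborel. norm (g x) \<le> M"
    and G_def: "\<And>s. Re s > 0 \<Longrightarrow> G s = (LINT x:{0..}|lborel. g x * exp (- s * of_real x))"
  defines "F \<equiv> (\<lambda>s. L s - b / s - G s / s)"
  shows "((closed E \<and> E \<in> null_sets lborel
            \<and> local_pf_boundary (- E) F
            \<and> (\<forall>t\<in>E. pm_boundary_at t (\<lambda>s. F s / (s - \<i> * of_real t))))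
           \<longrightarrow> ((\<lambda>x. \<tau> x - b - (LBINT y=0..x. g y)) \<longlongrightarrow> 0) at_top)
       \<and> (((\<lambda>x. \<tau> x - b - (LBINT y=0..x. g y)) \<longlongrightarrow> 0) at_top
           \<longrightarrow> local_pf_boundary UNIV F)"
proof -
  have sd: "slow_decrease (\<lambda>x. Re (\<tau> x))" "slow_decrease (\<lambda>x. Im (\<tau> x))"
    using tau_sd slowly_decreasing_real_imp unfolding slowly_decreasing_def by auto
  have \<tau>1: "laplace_able (half_line \<tau>)"
    by (rule improper_laplace(1)[OF tau_meas tau_loc sd L_def])
  have \<tau>2: "laplace (half_line \<tau>) s = L s" if "Re s > 0" for s
    by (rule improper_laplace(2)[OF tau_meas tau_loc sd L_def that])
  have [measurable]: "g \<in> borel_measurable borel" using g_meas by simp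
  obtain M0 where M0: "AE x in lborel. norm (g x) \<le> M0" using g_bdd by blast
  \<comment> \<open>The truncated function takes the value 0, so its bound must not be negative; M
    also serves as the Lipschitz constant of the primitive.\<close>
  define M where "M = max M0 0"
  have "AE x in lborel. norm (half_line g x) \<le> M"
    using M0 by eventually_elim (auto simp: half_line_def M_def)
  note gM = this
  have g_able: "laplace_able (half_line g)"
    by (rule laplace_able_bounded[OF _ _ gM]) (unfold half_line_def[abs_def], simp_all)
  have b_able: "laplace_able (half_line (\<lambda>x. b))"
    by (rule laplace_able_bounded[of _ "norm b"]) (unfold half_line_def[abs_def], simp_all)
  have lb: "laplace (half_line (\<lambda>x. b)) s = b / s" if "Re s > 0" for s
  proof -
    have "laplace (half_line (\<lambda>x. b)) s = (LINT x|lborel. b * (indicator {0..} x *\<^sub>R exp (- s * of_real x)))"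
      unfolding laplace_def half_line_indicator by (simp add: mult.commute)
    also have "\<dots> = b / s" unfolding integral_mult_right_zero laplace_indicator_atLeast(2)[OF that] by simp
    finally show ?thesis .
  qed
  have lG: "laplace (half_line g) s = G s" if "Re s > 0" for s
    unfolding G_def[OF that] laplace_def half_line_indicator set_lebesgue_integral_def by (simp add: mult.commute[of "exp _"])
  define P where "P = primitive (half_line g)"
  have P_able: "laplace_able P" unfolding P_def by (rule laplace_primitive(1)[OF g_able])
  define \<rho> where "\<rho> x = half_line \<tau> x - half_line (\<lambda>x. b) x - P x" for x
  have \<rho>: "laplace_able \<rho>" unfolding \<rho>_def[abs_def]
    by (intro laplace_able_diff \<tau>1 b_able P_able)
  have F: "F s = laplace \<rho> s" if s: "Re s > 0" for s
    unfolding \<rho>_def[abs_def] F_def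
    using laplace_diff[OF laplace_able_diff[OF \<tau>1 b_able] P_able s] laplace_diff[OF \<tau>1 b_able s]
      \<tau>2[OF s] lb[OF s] laplace_primitive(2)[OF g_able s] lG[OF s] by (simp add: P_def)
  have P_eq: "P x = (LBINT y=0..x. g y)" if "x \<ge> 0" for x
  proof -
    have "(LBINT y=ereal 0..ereal x. g y) = (LBINT y:{0..x}. g y)" by (rule interval_integral_Icc[OF that])
    also have "\<dots> = P x" unfolding P_def primitive_def half_line_indicator set_lebesgue_integral_def
      by (rule Bochner_Integration.integral_cong) (auto simp: indicator_def)
    finally show ?thesis by (simp add: zero_ereal_def)
  qed
  have ev: "\<forall>\<^sub>F x in at_top. \<rho> x = \<tau> x - b - (LBINT y=0..x. g y)"
    using eventually_ge_at_top[of 0] by eventually_elim (simp add: \<rho>_def half_line_def P_eq)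
  have lim: "((\<lambda>x. \<tau> x - b - (LBINT y=0..x. g y)) \<longlongrightarrow> 0) at_top \<longleftrightarrow> (\<rho> \<longlongrightarrow> 0) at_top"
    using tendsto_cong[OF ev] by simp
  have pf: "local_pf_boundary U F \<longleftrightarrow> local_pf_boundary U (laplace \<rho>)" for U
    unfolding local_pf_boundary_def by (rule boundary_behavior_cong[OF F])
  have pm: "pm_boundary_at t (\<lambda>s. F s / (s - \<i> * of_real t)) \<longleftrightarrow> pm_boundary_at t (\<lambda>s. laplace \<rho> s / (s - \<i> * of_real t))" for t
    unfolding pm_boundary_at_def
    using boundary_behavior_cong[of "\<lambda>s. F s / (s - \<i> * of_real t)" "\<lambda>s. laplace \<rho> s / (s - \<i> * of_real t)"] F by simp
  \<comment> \<open>For x \<ge> 0 the constant b cancels in the increment, and the primitive is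
    Lipschitz with constant M, so increments of \<rho> differ from those of \<tau> by at most M
    h.\<close>
  have sd\<rho>: "slow_decrease (\<lambda>x. c (\<rho> x))" if c: "c = Re \<or> c = Im" for c
  proof (rule slow_decrease_perturb)
    show "slow_decrease (\<lambda>x. c (\<tau> x))" using c sd by auto
    show "M \<ge> 0" by (simp add: M_def)
    fix x h :: real assume xh: "x \<ge> 0" "h \<ge> 0"
    have "\<bar>c (P (x + h) - P x)\<bar> \<le> norm (P (x + h) - P x)" using c abs_Re_le_cmod abs_Im_le_cmod by auto
    also have "\<dots> \<le> M * h" unfolding P_def by (rule primitive_lipschitz[OF g_able gM xh(2)])
    finally have "c (P (x + h)) - c (P x) \<le> M * h" using c by auto
    then show "c (\<rho> (x + h)) - c (\<rho> x) \<ge> c (\<tau> (x + h)) - c (\<tau> x) - M * h"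
      using c xh by (auto simp: \<rho>_def half_line_def)
  qed
  show ?thesis unfolding lim pf pm
    using laplace_tauberian[OF \<rho> sd\<rho>[of Re] sd\<rho>[of Im]] local_pf_boundary_of_tendsto_0[OF \<rho>] by blast
qed

end
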